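(* Let $A=\mathrm{S}_m[\overline{p},\overline{q},r,s]$ and $B=\mathrm{S}_{m'}[\overline{p'},\overline{q'},r',s']$, and let $\phi\colon A\to B$ be a unital $\ast$-homomorphism. Then there is a unital $\ast$-homomorphism $\psi\colon A\to B$, approximately unitarily equivalent to $\phi$, such that: (i) $\psi(f)=U^*\mathrm{diag}(\Lambda_{\overline\nu}(f),\Lambda_{\overline\omega}(f),f\circ\lambda_1,\dots,f\circ\lambda_\mu)U$ for all $f\in A$, where $U$ is a unitary in $\mathrm{M}_{m'}(\mathrm{C}[0,1])$ such that $U(0)$ and $U(1)$ are permutation matrices, $\overline\nu\in\mathbb N^r$ and $\overline\omega\in\mathbb N^s$ each have a component equal to zero, and $\lambda_k\colon[0,1]\to[0,1]$ are continuous with $\lambda_1\le\dots\le\lambda_\mu$ pointwise; (ii) for each $t\in\mathrm{sp}(B)\setminus(0,1)$, $(\pi_t\circ\psi)(f)=\mathrm{diag}(\Lambda_{\overline{\nu_t}}(f),\Lambda_{\overline{\omega_t}}(f),f(\lambda_{t,1}),\dots,f(\lambda_{t,\mu_t}))$ for all $f\in A$, where $\overline{\nu_t}\in\mathbb N^r$ and $\overline{\omega_t}\in\mathbb N^s$ each have a component equal to zero and $0\le\lambda_{t,1}\le\dots\le\lambda_{t,\mu_t}\le1$.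
   Context: A splitting interval algebra is $\mathrm{S}_m[\overline{p},\overline{q},r,s]=\{f\in \mathrm{M}_m(\mathrm{C}[0,1]): f(0)\in \bigoplus_{i=1}^r \mathrm{M}_{p_i}(\mathbb{C}),\ f(1)\in \bigoplus_{j=1}^s \mathrm{M}_{q_j}(\mathbb{C})\}$ ($p_i,q_j$ positive integers, $\sum p_i=\sum q_j=m$), with irreducible representations $\pi_{0_i}(f)=(f(0))_i$ (the $i$-th diagonal block), $\pi_t(f)=f(t)$ for $t\in(0,1)$, $\pi_{1_j}(f)=(f(1))_j$, and spectrum $\mathrm{sp}(A)=\{0_1,\dots,0_r\}\cup(0,1)\cup\{1_1,\dots,1_s\}$; similarly for $B$, whose irreducible representations at the points $0_i,1_j$ of $\mathrm{sp}(B)$ take values in $\mathrm M_{p'_i}$, $\mathrm M_{q'_j}$. For $\overline\nu\in\mathbb N^r$, $\overline\omega\in\mathbb N^s$, $\Lambda_{\overline\nu}=\bigoplus_{i=1}^r\pi_{0_i}\otimes1_{\mathrm M_{\nu_i}}$ and $\Lambda_{\overline\omega}=\bigoplus_{j=1}^s\pi_{1_j}\otimes1_{\mathrm M_{\omega_j}}$ (here $\pi_{0_i},\pi_{1_j}$ are those of $A$). Approximate unitary equivalence: there are unitaries $u_n\in\widetilde B$ with $u_n^*\psi(a)u_n\to\phi(a)$ for all $a$. *)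

theory Defs
  imports "HOL-Analysis.Analysis" "Jordan_Normal_Form.Schur_Decomposition"
begin

(* Matrices are Jordan_Normal_Form complex matrices. An element of M_m(C[0,1]) is
   represented by a function real => complex mat which is constant outside [0,1]
   (f t = f (clamp01 t)), so that such functions are determined by their values on [0,1]. *)

definition clamp01 :: "real \<Rightarrow> real" where
  "clamp01 t = max 0 (min 1 t)"

definition blk_start :: "nat list \<Rightarrow> nat \<Rightarrow> nat" where
  "blk_start ps i = sum_list (take i ps)"

definition block_diag_wrt :: "nat list \<Rightarrow> complex mat \<Rightarrow> bool" where
  "block_diag_wrt ps M \<longleftrightarrow>
     (\<forall>a<sum_list ps. \<forall>b<sum_list ps. M $$ (a,b) \<noteq> 0 \<longrightarrow>
        (\<exists>i<length ps. blk_start ps i \<le> a \<and> a < blk_start ps (Suc i)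
                      \<and> blk_start ps i \<le> b \<and> b < blk_start ps (Suc i)))"

definition blk :: "nat list \<Rightarrow> nat \<Rightarrow> complex mat \<Rightarrow> complex mat" where
  "blk ps i M = mat (ps ! i) (ps ! i) (\<lambda>(a,b). M $$ (blk_start ps i + a, blk_start ps i + b))"

text \<open>Valid data for a splitting interval algebra S_m[p,q,r,s], r = length ps, s = length qs.\<close>
definition split_data :: "nat \<Rightarrow> nat list \<Rightarrow> nat list \<Rightarrow> bool" where
  "split_data m ps qs \<longleftrightarrow> ps \<noteq> [] \<and> qs \<noteq> [] \<and> (\<forall>p\<in>set ps. 0 < p) \<and> (\<forall>q\<in>set qs. 0 < q)
     \<and> sum_list ps = m \<and> sum_list qs = m"

definition S_alg :: "nat \<Rightarrow> nat list \<Rightarrow> nat list \<Rightarrow> (real \<Rightarrow> complex mat) set" where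
  "S_alg m ps qs = {f. (\<forall>t. f t \<in> carrier_mat m m) \<and> (\<forall>t. f t = f (clamp01 t))
      \<and> (\<forall>i<m. \<forall>j<m. continuous_on {0..1} (\<lambda>t. f t $$ (i,j)))
      \<and> block_diag_wrt ps (f 0) \<and> block_diag_wrt qs (f 1)}"

definition fadd :: "(real \<Rightarrow> complex mat) \<Rightarrow> (real \<Rightarrow> complex mat) \<Rightarrow> real \<Rightarrow> complex mat" where
  "fadd f g = (\<lambda>t. f t + g t)"
definition fminus :: "(real \<Rightarrow> complex mat) \<Rightarrow> (real \<Rightarrow> complex mat) \<Rightarrow> real \<Rightarrow> complex mat" where
  "fminus f g = (\<lambda>t. f t - g t)"
definition fmul :: "(real \<Rightarrow> complex mat) \<Rightarrow> (real \<Rightarrow> complex mat) \<Rightarrow> real \<Rightarrow> complex mat" where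
  "fmul f g = (\<lambda>t. f t * g t)"
definition fsmult :: "complex \<Rightarrow> (real \<Rightarrow> complex mat) \<Rightarrow> real \<Rightarrow> complex mat" where
  "fsmult c f = (\<lambda>t. c \<cdot>\<^sub>m f t)"
definition fadj :: "(real \<Rightarrow> complex mat) \<Rightarrow> real \<Rightarrow> complex mat" where
  "fadj f = (\<lambda>t. mat_adjoint (f t))"
definition funit :: "nat \<Rightarrow> real \<Rightarrow> complex mat" where
  "funit m = (\<lambda>t. 1\<^sub>m m)"

definition unital_star_hom ::
  "nat \<Rightarrow> nat list \<Rightarrow> nat list \<Rightarrow> nat \<Rightarrow> nat list \<Rightarrow> nat list
   \<Rightarrow> ((real \<Rightarrow> complex mat) \<Rightarrow> (real \<Rightarrow> complex mat)) \<Rightarrow> bool" where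
  "unital_star_hom m ps qs m' ps' qs' \<phi> \<longleftrightarrow>
     (\<forall>f\<in>S_alg m ps qs. \<phi> f \<in> S_alg m' ps' qs')
   \<and> (\<forall>f\<in>S_alg m ps qs. \<forall>g\<in>S_alg m ps qs. \<phi> (fadd f g) = fadd (\<phi> f) (\<phi> g))
   \<and> (\<forall>c. \<forall>f\<in>S_alg m ps qs. \<phi> (fsmult c f) = fsmult c (\<phi> f))
   \<and> (\<forall>f\<in>S_alg m ps qs. \<forall>g\<in>S_alg m ps qs. \<phi> (fmul f g) = fmul (\<phi> f) (\<phi> g))
   \<and> (\<forall>f\<in>S_alg m ps qs. \<phi> (fadj f) = fadj (\<phi> f))
   \<and> \<phi> (funit m) = funit m'"

definition cvec_norm :: "complex vec \<Rightarrow> real" where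
  "cvec_norm v = sqrt (\<Sum>i<dim_vec v. (cmod (v $ i))\<^sup>2)"

definition op_norm :: "complex mat \<Rightarrow> real" where
  "op_norm M = Sup {cvec_norm (M *\<^sub>v v) | v. v \<in> carrier_vec (dim_col M) \<and> cvec_norm v \<le> 1}"

definition fnorm :: "(real \<Rightarrow> complex mat) \<Rightarrow> real" where
  "fnorm f = Sup ((\<lambda>t. op_norm (f t)) ` {0..1})"

definition unitary_mat :: "nat \<Rightarrow> complex mat \<Rightarrow> bool" where
  "unitary_mat n U \<longleftrightarrow> U \<in> carrier_mat n n \<and> mat_adjoint U * U = 1\<^sub>m n \<and> U * mat_adjoint U = 1\<^sub>m n"

definition perm_matrix :: "nat \<Rightarrow> complex mat \<Rightarrow> bool" where
  "perm_matrix n P \<longleftrightarrow> (\<exists>\<sigma>. \<sigma> permutes {..<n} \<and> P = mat n n (\<lambda>(i,j). if i = \<sigma> j then 1 else 0))"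

definition approx_unit_equiv ::
  "nat \<Rightarrow> nat list \<Rightarrow> nat list \<Rightarrow> nat \<Rightarrow> nat list \<Rightarrow> nat list
   \<Rightarrow> ((real \<Rightarrow> complex mat) \<Rightarrow> (real \<Rightarrow> complex mat))
   \<Rightarrow> ((real \<Rightarrow> complex mat) \<Rightarrow> (real \<Rightarrow> complex mat)) \<Rightarrow> bool" where
  "approx_unit_equiv m ps qs m' ps' qs' \<phi> \<psi> \<longleftrightarrow>
     (\<exists>u :: nat \<Rightarrow> real \<Rightarrow> complex mat.
        (\<forall>n. u n \<in> S_alg m' ps' qs' \<and> (\<forall>t\<in>{0..1}. unitary_mat m' (u n t)))
      \<and> (\<forall>a\<in>S_alg m ps qs.
           (\<lambda>n. fnorm (fminus (fmul (fmul (fadj (u n)) (\<psi> a)) (u n)) (\<phi> a))) \<longlonglongrightarrow> 0))"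

text \<open>Lambda_nu applied to a matrix M (M = f(0) with ps, or M = f(1) with qs):
  the block diagonal matrix with nu_i copies of the i-th block of M, i = 1..length ps.\<close>
definition Lambda :: "nat list \<Rightarrow> nat list \<Rightarrow> complex mat \<Rightarrow> complex mat" where
  "Lambda ps nu M = diag_block_mat (concat (map (\<lambda>i. replicate (nu ! i) (blk ps i M)) [0..<length ps]))"

end

theory Submission
  imports Defs "Jordan_Normal_Form.Spectral_Radius"
begin

text \<open>
  Each evaluation \<open>f \<mapsto> \<phi> f t\<close> is a finite-dimensional representation. An eigenvector of the image of the
  central function \<open>t\<close> with eigenvalue \<open>x\<close> sees \<open>f\<close> only through \<open>f x\<close>, so matrix units at \<open>x\<close> generate an
  irreducible summand; splitting off summands and trading a full set of blocks at an endpoint for the point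
  itself gives the normal form \<open>diag (\<Lambda>\<^sub>\<nu>, \<Lambda>\<^sub>\<omega>, f x\<^sub>1, \<dots>, f x\<^sub>\<mu>)\<close>. Traces are continuous in \<open>t\<close>, which makes
  \<open>\<nu>\<close> and \<open>\<omega>\<close> constant and the sorted points \<open>x\<^sub>k\<close> continuous. At \<open>t = 0\<close> and \<open>t = 1\<close> the blocks of \<open>\<phi> f t\<close>
  have normal forms of their own, whose direct sum is a permutation of the global one; \<open>\<psi>\<close> is the conjugate of
  the global normal form by a unitary path between the two permutation matrices.

  Approximate unitary equivalence: let \<open>I t\<close> be the set of unitaries conjugating the normal form at \<open>t\<close> into
  \<open>\<phi> f t\<close>. It is path connected, being a coset of the unitary group of a commutant, and the graph of \<open>I\<close> is
  compact, so nearby fibres are close. Hence any two points of \<open>I 0\<close> and \<open>I 1\<close> are joined by a unitary path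
  arbitrarily close to the graph, and such paths conjugate the normal form approximately into \<open>\<phi>\<close>.
\<close>

section \<open>Complex matrices\<close>

text \<open>Exact equivalence is not to be expected: where points of the normal form collide, with
  each other or with an endpoint, its commutant grows, so the fibres of intertwiners jump with t and
  need not admit a continuous selection. Only upper semicontinuity survives. It suffices because at
  time t a path may stand near an intertwiner for another nearby time s, and so can run through the
  connected fibre over one s in an arbitrarily short time.

  The implementing unitaries must lie in B, hence be block diagonal at 0 and 1. Therefore the
  endpoint intertwiners are built blockwise and come out as \<open>Q0 * V0\<close> and
  \<open>Q1 * V1\<close>, with permutation matrices \<open>Q0\<close>, \<open>Q1\<close> and block
  diagonal \<open>V0\<close>, \<open>V1\<close>. Dividing an intertwining path by the path from
  \<open>Q0\<close> to \<open>Q1\<close> leaves \<open>V0\<close> and \<open>V1\<close> at its ends.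

  The vanishing components of \<nu> and \<omega> make the normal form rigid: otherwise a full set of
  endpoint blocks and the endpoint itself would describe the same matrix, and the multiplicities
  could jump along t.\<close>

lemma adj_dim [simp]:
  "dim_row (mat_adjoint A) = dim_col A" "dim_col (mat_adjoint A) = dim_row A"
  by (auto simp: mat_adjoint_def)

lemma adj_index [simp]:
  "i < dim_col A \<Longrightarrow> j < dim_row A \<Longrightarrow> mat_adjoint A $$ (i,j) = cnj (A $$ (j,i))"
  for A :: "complex mat"
  by (simp add: mat_adjoint_def mat_of_rows_index)

lemma adj_carrier [simp]: "A \<in> carrier_mat n k \<Longrightarrow> mat_adjoint A \<in> carrier_mat k n"
  by auto

lemma mult_index:
  "A \<in> carrier_mat n k \<Longrightarrow> B \<in> carrier_mat k l \<Longrightarrow> i < n \<Longrightarrow> j < l \<Longrightarrow>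
   (A * B) $$ (i,j) = (\<Sum>x<k. A $$ (i,x) * B $$ (x,j))"
  by (simp add: scalar_prod_def atLeast0LessThan)

lemma adj_adj [simp]: "mat_adjoint (mat_adjoint A) = A" for A :: "complex mat"
  by (rule eq_matI) auto

lemma adj_mult:
  fixes A B :: "complex mat"
  assumes A: "A \<in> carrier_mat n k" and B: "B \<in> carrier_mat k l"
  shows "mat_adjoint (A * B) = mat_adjoint B * mat_adjoint A"
proof (rule eq_matI)
  fix i j assume "i < dim_row (mat_adjoint B * mat_adjoint A)" "j < dim_col (mat_adjoint B * mat_adjoint A)"
  then have i: "i < l" and j: "j < n" using A B by auto
  have "mat_adjoint (A * B) $$ (i,j) = cnj ((A * B) $$ (j,i))" using i j A B by simp
  also have "\<dots> = (\<Sum>x<k. cnj (B $$ (x,i)) * cnj (A $$ (j,x)))"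
    by (simp only: mult_index[OF A B j i]) (simp add: mult.commute)
  also have "\<dots> = (mat_adjoint B * mat_adjoint A) $$ (i,j)"
    using mult_index[OF adj_carrier[OF B] adj_carrier[OF A] i j] i j A B by simp
  finally show "mat_adjoint (A * B) $$ (i,j) = (mat_adjoint B * mat_adjoint A) $$ (i,j)" .
qed (use A B in auto)

lemma adj_one [simp]: "mat_adjoint (1\<^sub>m n) = (1\<^sub>m n :: complex mat)"
  by (rule eq_matI) auto

lemma unitaryI:
  assumes "U \<in> carrier_mat n n" "mat_adjoint U * U = 1\<^sub>m n"
  shows "unitary_mat n U"
  using assms mat_mult_left_right_inverse[OF adj_carrier[OF assms(1)] assms] by (simp add: unitary_mat_def)

lemma unitaryD:
  assumes "unitary_mat n U"
  shows "U \<in> carrier_mat n n" "mat_adjoint U \<in> carrier_mat n n"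
    "mat_adjoint U * U = 1\<^sub>m n" "U * mat_adjoint U = 1\<^sub>m n"
  using assms by (auto simp: unitary_mat_def)

lemma unitary_one [simp]: "unitary_mat n (1\<^sub>m n)"
  by (rule unitaryI) auto

lemma unitary_adj: "unitary_mat n U \<Longrightarrow> unitary_mat n (mat_adjoint U)"
  by (simp add: unitary_mat_def)

text \<open>The premises are equations between dimensions, which the simplifier discharges by
  computation; a version with carriers would leave free dimensions to be guessed.\<close>

lemma mat_assoc:
  "dim_col A = dim_row B \<Longrightarrow> dim_col B = dim_row C \<Longrightarrow> A * B * C = A * (B * C)"
  for A B C :: "complex mat"
  by (rule assoc_mult_mat[where ?n\<^sub>1.0 = "dim_row A" and ?n\<^sub>2.0 = "dim_col A" and ?n\<^sub>3.0 = "dim_col B" and ?n\<^sub>4.0 = "dim_col C"]) auto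

lemma adj_mult_dim: "dim_col A = dim_row B \<Longrightarrow> mat_adjoint (A * B) = mat_adjoint B * mat_adjoint A"
  for A B :: "complex mat"
  by (rule adj_mult) auto

text \<open>Shaped for products that \<open>mat_assoc\<close> has bracketed to the right, where a
  unitary and its adjoint meet only as heads of nested products.\<close>

lemma unitary_cancel:
  assumes U: "unitary_mat n U" and B: "dim_row B = n"
  shows "mat_adjoint U * (U * B) = B" "U * (mat_adjoint U * B) = B"
proof -
  have "mat_adjoint U * (U * B) = (mat_adjoint U * U) * B" "U * (mat_adjoint U * B) = (U * mat_adjoint U) * B"
    using unitaryD(1)[OF U] B by (simp_all add: mat_assoc)
  then show "mat_adjoint U * (U * B) = B" "U * (mat_adjoint U * B) = B"
    using unitaryD[OF U] B by auto
qed

lemma unitary_cancel_right: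
  assumes U: "unitary_mat n U" and B: "dim_col B = n"
  shows "B * mat_adjoint U * U = B" "B * U * mat_adjoint U = B"
  using unitaryD[OF U] B by (simp_all add: mat_assoc)

lemma unitary_mult:
  assumes U: "unitary_mat n U" and V: "unitary_mat n V"
  shows "unitary_mat n (U * V)"
proof (rule unitaryI)
  note c = unitaryD[OF U] unitaryD[OF V]
  show "U * V \<in> carrier_mat n n" using c by auto
  show "mat_adjoint (U * V) * (U * V) = 1\<^sub>m n"
    using c(1,5,7) unitary_cancel[OF U] by (simp add: adj_mult_dim mat_assoc)
qed

lemma conj_mult:
  fixes U V M :: "complex mat"
  assumes "U \<in> carrier_mat n n" "V \<in> carrier_mat n n" "M \<in> carrier_mat n n"
  shows "mat_adjoint (U * V) * M * (U * V) = mat_adjoint V * (mat_adjoint U * M * U) * V"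
  using assms by (simp add: adj_mult_dim mat_assoc)

lemma conj_unitary_inv:
  assumes U: "unitary_mat n U" and M: "M \<in> carrier_mat n n"
  shows "U * (mat_adjoint U * M * U) * mat_adjoint U = M"
    "mat_adjoint U * (U * M * mat_adjoint U) * U = M"
  using unitaryD[OF U] M unitary_cancel[OF U] by (simp_all add: mat_assoc)

section \<open>Direct sums of two matrices, the recursion step of block diagonal matrices\<close>

definition dirsum :: "complex mat \<Rightarrow> complex mat \<Rightarrow> complex mat" where
  "dirsum A B = four_block_mat A (0\<^sub>m (dim_row A) (dim_col B)) (0\<^sub>m (dim_row B) (dim_col A)) B"

lemma diag_block_mat_Cons: "diag_block_mat (A # As) = dirsum A (diag_block_mat As)"
  by (simp add: dirsum_def Let_def)

lemma dirsum_dim [simp]: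
  "dim_row (dirsum A B) = dim_row A + dim_row B" "dim_col (dirsum A B) = dim_col A + dim_col B"
  by (simp_all add: dirsum_def)

lemma dirsum_carrier [simp]:
  "A \<in> carrier_mat n k \<Longrightarrow> B \<in> carrier_mat n' k' \<Longrightarrow> dirsum A B \<in> carrier_mat (n + n') (k + k')"
  by auto

lemma dirsum_index:
  "i < dim_row A + dim_row B \<Longrightarrow> j < dim_col A + dim_col B \<Longrightarrow> dirsum A B $$ (i,j) =
    (if i < dim_row A \<and> j < dim_col A then A $$ (i,j)
     else if dim_row A \<le> i \<and> dim_col A \<le> j then B $$ (i - dim_row A, j - dim_col A) else 0)"
  by (auto simp: dirsum_def)

lemma dirsum_mult_carrier:
  assumes "A \<in> carrier_mat n k" "B \<in> carrier_mat n' k'" "C \<in> carrier_mat k l" "D \<in> carrier_mat k' l'"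
  shows "dirsum A B * dirsum C D = dirsum (A * C) (B * D)"
  using mult_four_block_mat[OF assms(1) zero_carrier_mat zero_carrier_mat assms(2) assms(3) zero_carrier_mat zero_carrier_mat assms(4)]
    assms by (simp add: dirsum_def)

lemma dirsum_mult:
  "dim_col A = dim_row C \<Longrightarrow> dim_col B = dim_row D \<Longrightarrow> dirsum A B * dirsum C D = dirsum (A * C) (B * D)"
  by (rule dirsum_mult_carrier) auto

lemma dirsum_adj: "mat_adjoint (dirsum A B) = dirsum (mat_adjoint A) (mat_adjoint B)"
  by (rule eq_matI) (auto simp: dirsum_index)

lemma dirsum_one: "dirsum (1\<^sub>m a) (1\<^sub>m b) = 1\<^sub>m (a + b)"
  by (rule eq_matI) (auto simp: dirsum_index)

lemma dirsum_empty: "M \<in> carrier_mat 0 0 \<Longrightarrow> dirsum M B = B"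
  by (rule eq_matI) (auto simp: dirsum_index)

lemma dirsum_unitary:
  assumes "unitary_mat a U" "unitary_mat b V"
  shows "unitary_mat (a + b) (dirsum U V)"
proof (rule unitaryI)
  note c = unitaryD[OF assms(1)] unitaryD[OF assms(2)]
  show "dirsum U V \<in> carrier_mat (a + b) (a + b)" using c by simp
  show "mat_adjoint (dirsum U V) * dirsum U V = 1\<^sub>m (a + b)"
    using c by (simp add: dirsum_adj dirsum_mult dirsum_one)
qed

lemma diag_block_append: "diag_block_mat (As @ Bs) = dirsum (diag_block_mat As) (diag_block_mat Bs)"
  by (simp add: diag_block_mat_append dirsum_def Let_def)

lemma diag_block_concat:
  "diag_block_mat (map diag_block_mat Ass) = (diag_block_mat (concat Ass) :: complex mat)"
  by (induct Ass) (simp_all add: diag_block_mat_Cons diag_block_append del: diag_block_mat.simps(2))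

lemma diag_block_carrier:
  "(\<And>c. c \<in> set cs \<Longrightarrow> g c \<in> carrier_mat (d c) (d c)) \<Longrightarrow>
   diag_block_mat (map g cs) \<in> carrier_mat (sum_list (map d cs)) (sum_list (map d cs))"
  by (induct cs) (auto simp: Let_def)

section \<open>Column vectors, isometries and the splitting of reducing subspaces\<close>

definition normsq :: "complex mat \<Rightarrow> real" where
  "normsq v = (\<Sum>i<dim_row v. (cmod (v $$ (i,0)))\<^sup>2)"

lemma normsq_pos:
  assumes "v \<in> carrier_mat n 1" "v \<noteq> 0\<^sub>m n 1"
  shows "normsq v > 0"
proof -
  obtain i where i: "i < n" "v $$ (i,0) \<noteq> 0"
  proof (rule ccontr)
    assume "\<not> thesis"
    then have "\<forall>i<n. v $$ (i,0) = 0" using that by blast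
    then have "v = 0\<^sub>m n 1" using assms(1) by (intro eq_matI) auto
    then show False using assms by simp
  qed
  have "0 < (cmod (v $$ (i,0)))\<^sup>2" using i by simp
  also have "\<dots> \<le> normsq v" unfolding normsq_def
    using i assms by (intro member_le_sum) auto
  finally show ?thesis .
qed

lemma normsq_nonneg: "normsq v \<ge> 0"
  by (simp add: normsq_def sum_nonneg)

lemma normsq_eq:
  assumes "v \<in> carrier_mat n 1"
  shows "(mat_adjoint v * v) $$ (0,0) = of_real (normsq v)"
proof -
  have "(mat_adjoint v * v) $$ (0,0) = (\<Sum>x<n. mat_adjoint v $$ (0,x) * v $$ (x,0))"
    by (rule mult_index[OF adj_carrier[OF assms] assms]) auto
  also have "\<dots> = of_real (normsq v)"
    using assms by (auto simp: normsq_def complex_norm_square mult.commute simp del: of_real_power intro!: sum.cong)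
  finally show ?thesis .
qed


text \<open>Padding the adjoint of \<open>T\<close> by zero rows gives a singular square matrix.\<close>

lemma isometry_orthogonal_column:
  fixes T :: "complex mat"
  assumes T: "T \<in> carrier_mat n k" and k: "k < n"
  obtains v where "v \<in> carrier_mat n 1" "normsq v = 1" "mat_adjoint T * v = 0\<^sub>m k 1"
proof -
  define A :: "complex mat" where
    "A = mat\<^sub>r n n (\<lambda>i. if i = k then 0\<^sub>v n else vec n (\<lambda>j. if i < k then cnj (T $$ (j,i)) else 0))"
  have A: "A \<in> carrier_mat n n" by (simp add: A_def)
  have Ai: "A $$ (i,j) = (if i < k then cnj (T $$ (j,i)) else 0)" if "i < n" "j < n" for i j
    using that by (simp add: A_def)
  have "det A = 0" unfolding A_def by (rule det_row_0[OF k]) auto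
  then obtain w where w: "w \<in> carrier_vec n" "w \<noteq> 0\<^sub>v n" "A *\<^sub>v w = 0\<^sub>v n"
    using det_0_iff_vec_prod_zero[OF A] by blast
  define u where "u = mat n 1 (\<lambda>(i,_). vec_index w i)"
  have u: "u \<in> carrier_mat n 1" by (simp add: u_def)
  have u0: "u \<noteq> 0\<^sub>m n 1"
  proof
    assume h: "u = 0\<^sub>m n 1"
    have "vec_index w i = 0" if "i < n" for i
    proof -
      have "u $$ (i,0) = 0" using h that by simp
      then show ?thesis using that by (simp add: u_def)
    qed
    then have "w = 0\<^sub>v n" using w(1) by (intro eq_vecI) auto
    then show False using w(2) by simp
  qed
  define c where "c = sqrt (normsq u)"
  have c: "c > 0" "c\<^sup>2 = normsq u" using normsq_pos[OF u u0] by (auto simp: c_def)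
  define v where "v = complex_of_real (1 / c) \<cdot>\<^sub>m u"
  have v: "v \<in> carrier_mat n 1" using u by (simp add: v_def)
  have "normsq v = (1/c)\<^sup>2 * normsq u"
    unfolding normsq_def sum_distrib_left using u c
    by (intro sum.cong) (auto simp: v_def norm_mult norm_divide power_mult_distrib power_divide)
  then have v1: "normsq v = 1" using c normsq_pos[OF u u0] by (simp add: power_divide)
  have Tu: "(\<Sum>x<n. cnj (T $$ (x,i)) * vec_index w x) = 0" if i: "i < k" for i
  proof -
    have "(A *\<^sub>v w) = 0\<^sub>v n" by fact
    then have "vec_index (A *\<^sub>v w) i = 0" using i k by simp
    then show ?thesis using i k w(1) A
      by (simp add: scalar_prod_def atLeast0LessThan Ai)
  qed
  have "mat_adjoint T * v = 0\<^sub>m k 1"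
  proof (rule eq_matI)
    fix i j assume "i < dim_row (0\<^sub>m k 1 :: complex mat)" "j < dim_col (0\<^sub>m k 1 :: complex mat)"
    then have i: "i < k" and j: "j = 0" by auto
    have "(mat_adjoint T * v) $$ (i,0) = (\<Sum>x<n. of_real (1/c) * (cnj (T $$ (x,i)) * vec_index w x))"
      using i T by (subst mult_index[OF adj_carrier[OF T] v i]) (auto simp: v_def u_def intro!: sum.cong)
    also have "\<dots> = 0" by (simp only: sum_distrib_left[symmetric] Tu[OF i]) simp
    finally show "(mat_adjoint T * v) $$ (i,j) = 0\<^sub>m k 1 $$ (i,j)" using i j by simp
  qed (use T v in auto)
  then show ?thesis using that v v1 by blast
qed

text \<open>If n < k, zero rows pad \<open>T\<close> to a square isometry \<open>S\<close>, which is
  then unitary; but row n of \<open>S\<close> is zero, so the diagonal entry of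
  \<open>S * mat_adjoint S\<close> there would be both 1 and 0.\<close>

lemma isometry_dim_le:
  fixes T :: "complex mat"
  assumes T: "T \<in> carrier_mat n k" "mat_adjoint T * T = 1\<^sub>m k"
  shows "k \<le> n"
proof (rule ccontr)
  assume "\<not> k \<le> n"
  then have n: "n < k" by simp
  define S where "S = mat k k (\<lambda>(i,j). if i < n then T $$ (i,j) else 0)"
  have S: "S \<in> carrier_mat k k" by (simp add: S_def)
  have "mat_adjoint S * S = mat_adjoint T * T"
  proof (rule eq_matI)
    fix i j assume "i < dim_row (mat_adjoint T * T)" "j < dim_col (mat_adjoint T * T)"
    then have i: "i < k" and j: "j < k" using T by auto
    have "(mat_adjoint S * S) $$ (i,j) = (\<Sum>x<k. if x < n then cnj (T $$ (x,i)) * T $$ (x,j) else 0)"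
      using i j by (subst mult_index[OF adj_carrier[OF S] S i j]) (auto simp: S_def intro!: sum.cong)
    also have "\<dots> = (\<Sum>x<n. cnj (T $$ (x,i)) * T $$ (x,j))"
      using n by (intro sum.mono_neutral_cong_right) auto
    also have "\<dots> = (mat_adjoint T * T) $$ (i,j)"
      using i j T(1) by (subst mult_index[OF adj_carrier[OF T(1)] T(1) i j]) (auto intro!: sum.cong)
    finally show "(mat_adjoint S * S) $$ (i,j) = (mat_adjoint T * T) $$ (i,j)" .
  qed (use S T in auto)
  then have "unitary_mat k S" using S T by (intro unitaryI) auto
  then have "(S * mat_adjoint S) $$ (n,n) = 1" using unitaryD(4) n by simp
  moreover have "(S * mat_adjoint S) $$ (n,n) = 0"
    using n by (subst mult_index[OF S adj_carrier[OF S] n n]) (auto simp: S_def)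
  ultimately show False by simp
qed

text \<open>Orthonormal columns are appended one at a time, by induction on the number of missing
  columns; a square isometry is already unitary.\<close>

lemma isometry_extend:
  fixes T :: "complex mat"
  assumes "T \<in> carrier_mat n k" "mat_adjoint T * T = 1\<^sub>m k"
  obtains V where "unitary_mat n V" "\<And>i j. i < n \<Longrightarrow> j < k \<Longrightarrow> V $$ (i,j) = T $$ (i,j)"
proof -
  have "\<exists>V. unitary_mat n V \<and> (\<forall>i<n. \<forall>j<k. V $$ (i,j) = T $$ (i,j))"
    using assms
  proof (induct "n - k" arbitrary: k T)
    case 0
    then have "k = n" using isometry_dim_le[of T n k] by simp
    then show ?case using 0 unitaryI by blast
  next
    case (Suc l)
    note T = Suc.prems
    have kn: "k < n" using Suc.hyps(2) by simp
    obtain v where v: "v \<in> carrier_mat n 1" "normsq v = 1" and o: "mat_adjoint T * v = 0\<^sub>m k 1"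
      using isometry_orthogonal_column[OF T(1) kn] by blast
    define T' where "T' = mat n (Suc k) (\<lambda>(i,j). if j < k then T $$ (i,j) else v $$ (i,0))"
    have T': "T' \<in> carrier_mat n (Suc k)" by (simp add: T'_def)
    have o1: "(\<Sum>x<n. cnj (T $$ (x,i)) * v $$ (x,0)) = 0" if i: "i < k" for i
    proof -
      have "(mat_adjoint T * v) $$ (i,0) = 0" using o i by simp
      then show ?thesis
        using i T(1) by (subst (asm) mult_index[OF adj_carrier[OF T(1)] v(1) i]) auto
    qed
    have o2: "(\<Sum>x<n. cnj (v $$ (x,0)) * T $$ (x,i)) = 0" if i: "i < k" for i
      using arg_cong[OF o1[OF i], of cnj] by (simp add: mult.commute)
    have o3: "(\<Sum>x<n. cnj (v $$ (x,0)) * v $$ (x,0)) = 1"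
    proof -
      have "(mat_adjoint v * v) $$ (0,0) = 1" using normsq_eq[OF v(1)] v(2) by simp
      then show ?thesis
        using v(1) by (subst (asm) mult_index[OF adj_carrier[OF v(1)] v(1)]) auto
    qed
    have o4: "(\<Sum>x<n. cnj (T $$ (x,i)) * T $$ (x,j)) = (if i = j then 1 else 0)" if i: "i < k" and j: "j < k" for i j
    proof -
      have "(mat_adjoint T * T) $$ (i,j) = (if i = j then 1 else 0)" using T(2) i j by simp
      then show ?thesis
        using i j T(1) by (subst (asm) mult_index[OF adj_carrier[OF T(1)] T(1) i j]) auto
    qed
    have "mat_adjoint T' * T' = 1\<^sub>m (Suc k)"
    proof (rule eq_matI)
      fix i j assume "i < dim_row (1\<^sub>m (Suc k) :: complex mat)" "j < dim_col (1\<^sub>m (Suc k) :: complex mat)"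
      then have i: "i < Suc k" and j: "j < Suc k" by auto
      have "(mat_adjoint T' * T') $$ (i,j) = (\<Sum>x<n. cnj (if i < k then T $$ (x,i) else v $$ (x,0)) *
          (if j < k then T $$ (x,j) else v $$ (x,0)))"
        using i j by (subst mult_index[OF adj_carrier[OF T'] T' i j]) (auto simp: T'_def intro!: sum.cong)
      also have "\<dots> = (if i = j then 1 else 0)"
        using i j o1 o2 o3 o4 by (cases "i < k"; cases "j < k") auto
      finally show "(mat_adjoint T' * T') $$ (i,j) = 1\<^sub>m (Suc k) $$ (i,j)" using i j by simp
    qed (use T' in auto)
    moreover have "l = n - Suc k" using Suc.hyps(2) by simp
    ultimately obtain V where
      V: "unitary_mat n V" "\<forall>i<n. \<forall>j<Suc k. V $$ (i,j) = T' $$ (i,j)"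
      using Suc.hyps(1)[OF _ T'] by blast
    then show ?case by (intro exI[of _ V]) (auto simp: T'_def)
  qed
  then show ?thesis using that by blast
qed

text \<open>Vectors are kept as matrices with one column, so that a single associativity law serves
  matrices and vectors alike. Here the eigenvectors of the spectral theory are converted to that
  form.\<close>

lemma eigenvector_column:
  fixes A :: "complex mat"
  assumes A: "A \<in> carrier_mat n n" and n: "n > 0"
  obtains x v where "v \<in> carrier_mat n 1" "v \<noteq> 0\<^sub>m n 1" "A * v = x \<cdot>\<^sub>m v"
proof -
  from spectrum_non_empty[OF A n] obtain x w where "eigenvector A w x"
    unfolding spectrum_def eigenvalue_def by blast
  then have w: "w \<in> carrier_vec n" "w \<noteq> 0\<^sub>v n" "A *\<^sub>v w = x \<cdot>\<^sub>v w"
    using A by (auto simp: eigenvector_def)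
  define v where "v = mat n 1 (\<lambda>(i,_). vec_index w i)"
  have v: "v \<in> carrier_mat n 1" by (simp add: v_def)
  have "v \<noteq> 0\<^sub>m n 1"
  proof
    assume h: "v = 0\<^sub>m n 1"
    have "vec_index w i = 0" if "i < n" for i
    proof -
      have "v $$ (i,0) = 0" using h that by simp
      then show ?thesis using that by (simp add: v_def)
    qed
    then have "w = 0\<^sub>v n" using w(1) by (intro eq_vecI) auto
    then show False using w(2) by simp
  qed
  moreover have "A * v = x \<cdot>\<^sub>m v"
  proof (rule eq_matI)
    fix i j assume "i < dim_row (x \<cdot>\<^sub>m v)" "j < dim_col (x \<cdot>\<^sub>m v)"
    then have i: "i < n" and j: "j = 0" by (auto simp: v_def)
    have "vec_index (A *\<^sub>v w) i = x * vec_index w i" using w i by simp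
    then have "(\<Sum>k<n. A $$ (i,k) * vec_index w k) = x * vec_index w i"
      using i A w(1) by (simp add: scalar_prod_def atLeast0LessThan)
    then show "(A * v) $$ (i,j) = (x \<cdot>\<^sub>m v) $$ (i,j)"
      using i j by (subst mult_index[OF A v i]) (auto simp: v_def)
  qed (use A v in auto)
  ultimately show ?thesis using that v by blast
qed

text \<open>In the basis given by \<open>V\<close>, the first p vectors span the range of
  \<open>T\<close>. Invariance of that range under \<open>M\<close> empties the lower left corner,
  and invariance under the adjoint of \<open>M\<close> empties the upper right one.\<close>

lemma reducing_isometry:
  fixes M R T V :: "complex mat"
  assumes M: "M \<in> carrier_mat (p + k) (p + k)" and R: "R \<in> carrier_mat p p"
    and T: "T \<in> carrier_mat (p + k) p" and V: "unitary_mat (p + k) V"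
    and VT: "\<And>i j. i < p + k \<Longrightarrow> j < p \<Longrightarrow> V $$ (i,j) = T $$ (i,j)"
    and MT: "M * T = T * R" "mat_adjoint M * T = T * mat_adjoint R"
  shows "M = V * dirsum R (mat k k (\<lambda>(i,j). (mat_adjoint V * M * V) $$ (i + p, j + p))) * mat_adjoint V"
proof -
  let ?n = "p + k"
  \<comment> \<open>The inclusion of the first p coordinates. It turns the agreement of columns into
    \<open>V * J = T\<close>, so that right multiplication by \<open>J\<close> reads off the first p
    columns.\<close>
  define J :: "complex mat" where "J = mat ?n p (\<lambda>(i,j). if i = j then 1 else 0)"
  have J: "J \<in> carrier_mat ?n p" by (simp add: J_def)
  note Vc = unitaryD[OF V]
  have rJ: "(X * J) $$ (i,j) = X $$ (i,j)" if X: "X \<in> carrier_mat l ?n" and i: "i < l" and j: "j < p" for X i j l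
  proof -
    have "(X * J) $$ (i,j) = (\<Sum>x<?n. X $$ (i,x) * J $$ (x,j))" by (rule mult_index[OF X J i j])
    also have "\<dots> = (\<Sum>x<?n. if x = j then X $$ (i,x) else 0)"
      using j by (intro sum.cong) (auto simp: J_def)
    finally show ?thesis using j by simp
  qed
  have lJ: "(J * X) $$ (i,j) = (if i < p then X $$ (i,j) else 0)" if X: "X \<in> carrier_mat p p" and i: "i < ?n" and j: "j < p" for X i j
  proof -
    have "(J * X) $$ (i,j) = (\<Sum>x<p. J $$ (i,x) * X $$ (x,j))" by (rule mult_index[OF J X i j])
    also have "\<dots> = (\<Sum>x<p. if x = i then X $$ (x,j) else 0)"
      using i by (intro sum.cong) (auto simp: J_def)
    finally show ?thesis by simp
  qed
  have VJ: "V * J = T"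
    using Vc(1) J T VT by (intro eq_matI) (auto simp: rJ[OF Vc(1)] simp del: index_mult_mat(1))
  have key: "(mat_adjoint V * X * V) * J = J * Y"
    if X: "X \<in> carrier_mat ?n ?n" and Y: "Y \<in> carrier_mat p p" and XY: "X * T = T * Y" for X Y
  proof -
    have "(mat_adjoint V * X * V) * J = mat_adjoint V * (X * T)"
      using X Vc(1) J by (simp add: mat_assoc VJ)
    also have "\<dots> = mat_adjoint V * (V * J * Y)" by (simp add: XY VJ)
    also have "\<dots> = mat_adjoint V * (V * (J * Y))"
      using Vc(1) J Y by (simp add: mat_assoc)
    also have "\<dots> = J * Y" using J Y by (intro unitary_cancel[OF V]) auto
    finally show ?thesis .
  qed
  define N where "N = mat_adjoint V * M * V"
  have N: "N \<in> carrier_mat ?n ?n" using Vc M by (intro carrier_matI) (simp_all add: N_def)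
  have adjN: "mat_adjoint N = mat_adjoint V * mat_adjoint M * V"
    unfolding N_def using Vc M
    by (simp add: adj_mult_dim mat_assoc)
  have N1: "N $$ (i,j) = (if i < p then R $$ (i,j) else 0)" if "i < ?n" "j < p" for i j
    using key[OF M R MT(1)] rJ[OF N, of i j] lJ[OF R, of i j] that by (simp add: N_def del: index_mult_mat(1))
  have N2: "mat_adjoint N $$ (i,j) = (if i < p then mat_adjoint R $$ (i,j) else 0)" if "i < ?n" "j < p" for i j
    using key[OF _ _ MT(2)] M R adjN rJ[OF adj_carrier[OF N], of i j] lJ[OF adj_carrier[OF R], of i j] that
    by (simp del: index_mult_mat(1) adj_index)
  have N3: "N $$ (i,j) = 0" if "i < p" "p \<le> j" "j < ?n" for i j
    using N2[of j i] that N R by simp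
  have "N = dirsum R (mat k k (\<lambda>(i,j). N $$ (i + p, j + p)))"
    using N R by (intro eq_matI) (auto simp: dirsum_index N1 N3)
  then have "V * dirsum R (mat k k (\<lambda>(i,j). N $$ (i + p, j + p))) * mat_adjoint V = V * N * mat_adjoint V"
    by simp
  also have "\<dots> = M" unfolding N_def by (rule conj_unitary_inv(1)[OF V M])
  finally show ?thesis by (simp add: N_def)
qed

text \<open>Greedy splitting: \<open>piece\<close> finds one summand inside any nonzero
  representation and \<open>restr\<close> says that the orthogonal complement is again admissible.
  \<open>Rep\<close> stays abstract because the argument serves twice, for representations of the
  algebra and for a single unitary matrix, where it yields the spectral theorem.\<close>

lemma orthogonal_decomposition:
  fixes Rep :: "nat \<Rightarrow> ('f \<Rightarrow> complex mat) \<Rightarrow> bool" and r :: "'c \<Rightarrow> 'f \<Rightarrow> complex mat"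
    and d :: "'c \<Rightarrow> nat"
  assumes carrier: "\<And>n \<rho> f. Rep n \<rho> \<Longrightarrow> f \<in> F \<Longrightarrow> \<rho> f \<in> carrier_mat n n"
    and rcarrier: "\<And>c f. c \<in> C \<Longrightarrow> f \<in> F \<Longrightarrow> r c f \<in> carrier_mat (d c) (d c)"
    and dpos: "\<And>c. c \<in> C \<Longrightarrow> 0 < d c"
    and piece: "\<And>n \<rho>. Rep n \<rho> \<Longrightarrow> 0 < n \<Longrightarrow> \<exists>c\<in>C. \<exists>T. T \<in> carrier_mat n (d c) \<and> mat_adjoint T * T = 1\<^sub>m (d c) \<and>
        (\<forall>f\<in>F. \<rho> f * T = T * r c f \<and> mat_adjoint (\<rho> f) * T = T * mat_adjoint (r c f))"
    and restr: "\<And>p k \<rho> V B E. Rep (p + k) \<rho> \<Longrightarrow> unitary_mat (p + k) V \<Longrightarrow>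
        (\<And>f. f \<in> F \<Longrightarrow> B f \<in> carrier_mat p p \<and> E f \<in> carrier_mat k k \<and> \<rho> f = V * dirsum (B f) (E f) * mat_adjoint V) \<Longrightarrow> Rep k E"
    and "Rep n \<rho>"
  shows "\<exists>cs U. set cs \<subseteq> C \<and> sum_list (map d cs) = n \<and> unitary_mat n U \<and> (\<forall>f\<in>F. \<rho> f = mat_adjoint U * diag_block_mat (map (\<lambda>c. r c f) cs) * U)"
  using \<open>Rep n \<rho>\<close>
proof (induct n arbitrary: \<rho> rule: less_induct)
  case (less n)
  show ?case
  proof (cases "n = 0")
    case True
    have "\<rho> f = mat_adjoint (1\<^sub>m 0) * diag_block_mat (map (\<lambda>c. r c f) []) * 1\<^sub>m 0" if "f \<in> F" for f
      using carrier[OF less.prems that] True by (intro eq_matI) auto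
    then show ?thesis using True by (intro exI[of _ "[]"] exI[of _ "1\<^sub>m 0"]) auto
  next
    case False
    then obtain c T where c: "c \<in> C" and T: "T \<in> carrier_mat n (d c)" "mat_adjoint T * T = 1\<^sub>m (d c)"
      and TM: "\<And>f. f \<in> F \<Longrightarrow> \<rho> f * T = T * r c f \<and> mat_adjoint (\<rho> f) * T = T * mat_adjoint (r c f)"
      using piece[OF less.prems] by blast
    define p where "p = d c"
    define k where "k = n - p"
    have n: "n = p + k" using isometry_dim_le[OF T] by (simp add: k_def p_def)
    have p: "p > 0" using dpos[OF c] by (simp add: p_def)
    obtain V where V: "unitary_mat n V" "\<And>i j. i < n \<Longrightarrow> j < p \<Longrightarrow> V $$ (i,j) = T $$ (i,j)"
      using isometry_extend[OF T] p_def by blast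
    \<comment> \<open>The compression to the orthogonal complement of the range of \<open>T\<close>,
      in the basis completed by \<open>V\<close>.\<close>
    define E where "E f = mat k k (\<lambda>(i,j). (mat_adjoint V * \<rho> f * V) $$ (i + p, j + p))" for f
    have E: "E f \<in> carrier_mat k k" for f by (simp add: E_def)
    have R: "r c f \<in> carrier_mat p p" if "f \<in> F" for f using rcarrier[OF c that] by (simp add: p_def)
    have dec: "\<rho> f = V * dirsum (r c f) (E f) * mat_adjoint V" if f: "f \<in> F" for f
      unfolding E_def using carrier[OF less.prems f] R[OF f] T(1) V TM[OF f] unfolding n
      by (intro reducing_isometry[where T=T]) (auto simp: p_def)
    have "Rep k E" using restr[of p k \<rho> V "r c" E] less.prems V dec R E by (simp add: n)
    moreover have "k < n" using p n by simp
    ultimately obtain cs W where cs: "set cs \<subseteq> C" "sum_list (map d cs) = k" and W: "unitary_mat k W"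
      and EW: "\<And>f. f \<in> F \<Longrightarrow> E f = mat_adjoint W * diag_block_mat (map (\<lambda>c. r c f) cs) * W"
      using less.hyps by blast
    define D where "D f = diag_block_mat (map (\<lambda>c. r c f) cs)" for f
    define U where "U = dirsum (1\<^sub>m p) W * mat_adjoint V"
    have sW: "unitary_mat n (dirsum (1\<^sub>m p) W)" using dirsum_unitary[OF unitary_one W] n by simp
    have U: "unitary_mat n U" unfolding U_def using sW unitary_adj[OF V(1)] by (rule unitary_mult)
    have "\<rho> f = mat_adjoint U * diag_block_mat (map (\<lambda>c. r c f) (c # cs)) * U" if f: "f \<in> F" for f
    proof -
      note Wc = unitaryD[OF W]
      have Dc: "D f \<in> carrier_mat k k"
        using diag_block_carrier[of cs "\<lambda>c. r c f" d] rcarrier[OF _ f] cs by (auto simp: D_def)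
      have "mat_adjoint U * dirsum (r c f) (D f) * U
        = mat_adjoint (mat_adjoint V) * (mat_adjoint (dirsum (1\<^sub>m p) W) * dirsum (r c f) (D f) * dirsum (1\<^sub>m p) W) * mat_adjoint V"
        unfolding U_def using unitaryD[OF sW] unitaryD[OF V(1)] R[OF f] Dc n by (intro conj_mult) auto
      also have "mat_adjoint (dirsum (1\<^sub>m p) W) * dirsum (r c f) (D f) * dirsum (1\<^sub>m p) W = dirsum (r c f) (E f)"
        using R[OF f] Dc Wc EW[OF f] by (simp add: dirsum_adj dirsum_mult D_def)
      finally show ?thesis using dec[OF f] by (simp add: diag_block_mat_Cons D_def del: diag_block_mat.simps(2))
    qed
    then show ?thesis using cs c U n by (intro exI[of _ "c # cs"] exI[of _ U]) (auto simp: p_def)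
  qed
qed

section \<open>Splitting interval algebras\<close>

text \<open>On indices below \<open>sum_list ps\<close> this is an equivalence relation whose
  classes are the blocks. Transitivity is what closes block diagonal matrices under
  products.\<close>

definition same_block :: "nat list \<Rightarrow> nat \<Rightarrow> nat \<Rightarrow> bool" where
  "same_block ps a b \<longleftrightarrow> (\<exists>i<length ps. blk_start ps i \<le> a \<and> a < blk_start ps (Suc i)
     \<and> blk_start ps i \<le> b \<and> b < blk_start ps (Suc i))"

lemma block_diag_iff:
  "block_diag_wrt ps M \<longleftrightarrow> (\<forall>a<sum_list ps. \<forall>b<sum_list ps. M $$ (a,b) \<noteq> 0 \<longrightarrow> same_block ps a b)"
  by (simp add: block_diag_wrt_def same_block_def)

lemma blk_start_0 [simp]: "blk_start ps 0 = 0"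
  by (simp add: blk_start_def)

lemma blk_start_Suc: "i < length ps \<Longrightarrow> blk_start ps (Suc i) = blk_start ps i + ps ! i"
  by (simp add: blk_start_def take_Suc_conv_app_nth)

lemma blk_start_length: "blk_start ps (length ps) = sum_list ps"
  by (simp add: blk_start_def)

lemma blk_start_mono: "i \<le> j \<Longrightarrow> blk_start ps i \<le> blk_start ps j"
proof (induct rule: dec_induct)
  case (step k)
  then show ?case
    by (cases "k < length ps") (simp_all add: blk_start_Suc, simp add: blk_start_def)
qed simp

lemma blk_start_le: "i < length ps \<Longrightarrow> blk_start ps i + ps ! i \<le> sum_list ps"
  using blk_start_mono[of "Suc i" "length ps" ps] by (simp add: blk_start_Suc blk_start_length)

lemma block_unique:
  assumes "blk_start ps i \<le> a" "a < blk_start ps (Suc i)" "blk_start ps j \<le> a" "a < blk_start ps (Suc j)"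
  shows "i = j"
proof (rule ccontr)
  assume "i \<noteq> j"
  then consider "Suc i \<le> j" | "Suc j \<le> i" by linarith
  then show False using blk_start_mono[of "Suc i" j ps] blk_start_mono[of "Suc j" i ps] assms by cases auto
qed

lemma block_exists:
  assumes "a < sum_list ps"
  obtains i where "i < length ps" "blk_start ps i \<le> a" "a < blk_start ps i + ps ! i"
proof -
  define i where "i = (LEAST i. a < blk_start ps (Suc i))"
  have ne: "a < blk_start ps (Suc (length ps - 1))"
    using assms by (cases ps) (auto simp: blk_start_def)
  have i: "a < blk_start ps (Suc i)" unfolding i_def using ne by (rule LeastI)
  have il: "i < length ps"
    using Least_le[of "\<lambda>i. a < blk_start ps (Suc i)", OF ne] assms by (cases ps) (auto simp: i_def)
  have "blk_start ps i \<le> a"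
  proof (cases i)
    case (Suc k)
    then show ?thesis using not_less_Least[of k "\<lambda>i. a < blk_start ps (Suc i)"] i_def by auto
  qed simp
  then show ?thesis using that i il by (simp add: blk_start_Suc)
qed

lemma same_block_refl: "a < sum_list ps \<Longrightarrow> same_block ps a a"
  by (erule block_exists) (auto simp: same_block_def blk_start_Suc)

lemma same_block_sym: "same_block ps a b \<Longrightarrow> same_block ps b a"
  by (auto simp: same_block_def)

lemma same_block_trans: "same_block ps a b \<Longrightarrow> same_block ps b c \<Longrightarrow> same_block ps a c"
  unfolding same_block_def using block_unique by blast

lemma same_block_iff:
  assumes "i < length ps" "blk_start ps i \<le> a" "a < blk_start ps i + ps ! i"
  shows "same_block ps a b \<longleftrightarrow> blk_start ps i \<le> b \<and> b < blk_start ps i + ps ! i"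
proof
  assume "same_block ps a b"
  then obtain j where "j < length ps" "blk_start ps j \<le> a" "a < blk_start ps (Suc j)" "blk_start ps j \<le> b" "b < blk_start ps (Suc j)"
    by (auto simp: same_block_def)
  moreover from this have "j = i" using block_unique[of ps j a i] assms by (simp add: blk_start_Suc)
  ultimately show "blk_start ps i \<le> b \<and> b < blk_start ps i + ps ! i" by (simp add: blk_start_Suc)
qed (use assms in \<open>auto simp: same_block_def blk_start_Suc\<close>)

lemma block_diag_mult:
  assumes "M \<in> carrier_mat (sum_list ps) (sum_list ps)" "N \<in> carrier_mat (sum_list ps) (sum_list ps)"
    and "block_diag_wrt ps M" "block_diag_wrt ps N"
  shows "block_diag_wrt ps (M * N)"
  unfolding block_diag_iff
proof (intro allI impI)
  fix a b assume a: "a < sum_list ps" and b: "b < sum_list ps" and "(M * N) $$ (a,b) \<noteq> 0"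
  then have "(\<Sum>x<sum_list ps. M $$ (a,x) * N $$ (x,b)) \<noteq> 0"
    using mult_index[OF assms(1,2)] by simp
  then obtain x where "x < sum_list ps" "M $$ (a,x) \<noteq> 0" "N $$ (x,b) \<noteq> 0"
    by (metis (no_types, lifting) lessThan_iff mult_eq_0_iff sum.neutral)
  then show "same_block ps a b" using assms(3,4) a b same_block_trans unfolding block_diag_iff by blast
qed

section \<open>Closure properties and standard elements of the algebra\<close>

lemma clamp01_in [simp]: "clamp01 t \<in> {0..1}" "0 \<le> clamp01 t" "clamp01 t \<le> 1"
  by (auto simp: clamp01_def)

lemma clamp01_id [simp]: "0 \<le> t \<Longrightarrow> t \<le> 1 \<Longrightarrow> clamp01 t = t"
  by (simp add: clamp01_def)

lemma S_algD:
  assumes "f \<in> S_alg m ps qs"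
  shows "f t \<in> carrier_mat m m" "dim_row (f t) = m" "dim_col (f t) = m" "f t = f (clamp01 t)"
    "i < m \<Longrightarrow> j < m \<Longrightarrow> continuous_on {0..1} (\<lambda>t. f t $$ (i,j))"
    "block_diag_wrt ps (f 0)" "block_diag_wrt qs (f 1)"
  using assms unfolding S_alg_def by (blast, auto)

lemma fadd_S_alg:
  assumes "f \<in> S_alg m ps qs" "g \<in> S_alg m ps qs" "sum_list ps = m" "sum_list qs = m"
  shows "fadd f g \<in> S_alg m ps qs"
proof -
  note f = S_algD[OF assms(1)] and g = S_algD[OF assms(2)]
  have "continuous_on {0..1} (\<lambda>t. (f t + g t) $$ (i,j))" if "i < m" "j < m" for i j
    using that f(2,3) g(2,3) continuous_on_add[OF f(5)[OF that] g(5)[OF that]] by simp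
  moreover have "block_diag_wrt ps (f 0 + g 0)" "block_diag_wrt qs (f 1 + g 1)"
    using f(2,3,6,7) g(2,3,6,7) assms(3,4) unfolding block_diag_iff by (auto; metis add.right_neutral)+
  moreover have "f t + g t = f (clamp01 t) + g (clamp01 t)" for t using f(4) g(4) by metis
  ultimately show ?thesis using f(1) g(1) unfolding S_alg_def fadd_def by auto
qed

lemma fsmult_S_alg:
  assumes "f \<in> S_alg m ps qs" "sum_list ps = m" "sum_list qs = m"
  shows "fsmult c f \<in> S_alg m ps qs"
proof -
  note f = S_algD[OF assms(1)]
  have "continuous_on {0..1} (\<lambda>t. (c \<cdot>\<^sub>m f t) $$ (i,j))" if "i < m" "j < m" for i j
    using that f(2,3) continuous_on_mult_left[OF f(5)[OF that], of c] by simp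
  moreover have "block_diag_wrt ps (c \<cdot>\<^sub>m f 0)" "block_diag_wrt qs (c \<cdot>\<^sub>m f 1)"
    using f(2,3,6,7) assms(2,3) unfolding block_diag_iff by auto
  moreover have "c \<cdot>\<^sub>m f t = c \<cdot>\<^sub>m f (clamp01 t)" for t using f(4) by metis
  ultimately show ?thesis using f(1) unfolding S_alg_def fsmult_def by auto
qed

lemma fmul_S_alg:
  assumes "f \<in> S_alg m ps qs" "g \<in> S_alg m ps qs" "sum_list ps = m" "sum_list qs = m"
  shows "fmul f g \<in> S_alg m ps qs"
proof -
  note f = S_algD[OF assms(1)] and g = S_algD[OF assms(2)]
  have "continuous_on {0..1} (\<lambda>t. (f t * g t) $$ (i,j))" if i: "i < m" and j: "j < m" for i j
    unfolding mult_index[OF f(1) g(1) i j] using i j f(5) g(5) by (intro continuous_intros) auto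
  moreover have "block_diag_wrt ps (f 0 * g 0)" "block_diag_wrt qs (f 1 * g 1)"
    using f(1,6,7) g(1,6,7) assms(3,4) by (auto intro!: block_diag_mult)
  moreover have "f t * g t = f (clamp01 t) * g (clamp01 t)" for t using f(4) g(4) by metis
  ultimately show ?thesis using mult_carrier_mat[OF f(1) g(1)] unfolding S_alg_def fmul_def by auto
qed

lemma fadj_S_alg:
  assumes "f \<in> S_alg m ps qs" "sum_list ps = m" "sum_list qs = m"
  shows "fadj f \<in> S_alg m ps qs"
proof -
  note f = S_algD[OF assms(1)]
  have "continuous_on {0..1} (\<lambda>t. mat_adjoint (f t) $$ (i,j))" if "i < m" "j < m" for i j
    using that f(2,3) continuous_on_cnj[OF f(5)[OF that(2,1)]] by simp
  moreover have "block_diag_wrt ps (mat_adjoint (f 0))" "block_diag_wrt qs (mat_adjoint (f 1))"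
    using f(2,3,6,7) assms(2,3) unfolding block_diag_iff by (auto intro: same_block_sym)
  moreover have "mat_adjoint (f t) = mat_adjoint (f (clamp01 t))" for t using f(4) by metis
  ultimately show ?thesis using f(1) unfolding S_alg_def fadj_def by auto
qed

text \<open>The clamp builds in the constancy outside [0,1] that \<open>S_alg\<close> demands;
  membership is then a matter of continuity and of the block conditions at 0 and 1.\<close>

definition entry_fun :: "nat \<Rightarrow> (nat \<Rightarrow> nat \<Rightarrow> real \<Rightarrow> complex) \<Rightarrow> real \<Rightarrow> complex mat" where
  "entry_fun m g = (\<lambda>t. mat m m (\<lambda>(i,j). g i j (clamp01 t)))"

lemma entry_fun_dim [simp]:
  "dim_row (entry_fun m g t) = m" "dim_col (entry_fun m g t) = m" "entry_fun m g t \<in> carrier_mat m m"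
  by (simp_all add: entry_fun_def)

lemma entry_fun_index:
  "i < m \<Longrightarrow> j < m \<Longrightarrow> entry_fun m g t $$ (i,j) = g i j (clamp01 t)"
  by (simp add: entry_fun_def)

lemma entry_fun_S_alg:
  assumes "sum_list ps = m" "sum_list qs = m"
    and "\<And>i j. i < m \<Longrightarrow> j < m \<Longrightarrow> continuous_on {0..1} (g i j)"
    and "\<And>i j. i < m \<Longrightarrow> j < m \<Longrightarrow> g i j 0 \<noteq> 0 \<Longrightarrow> same_block ps i j"
    and "\<And>i j. i < m \<Longrightarrow> j < m \<Longrightarrow> g i j 1 \<noteq> 0 \<Longrightarrow> same_block qs i j"
  shows "entry_fun m g \<in> S_alg m ps qs"
proof -
  have "continuous_on {0..1} (\<lambda>t. entry_fun m g t $$ (i,j))" if "i < m" "j < m" for i j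
    using assms(3)[OF that] that
    by (subst continuous_on_cong[OF refl, of _ _ "g i j"]) (auto simp: entry_fun_index)
  moreover have "entry_fun m g t = entry_fun m g (clamp01 t)" for t by (simp add: entry_fun_def)
  ultimately show ?thesis using assms(1,2,4,5)
    unfolding S_alg_def block_diag_iff by (auto simp: entry_fun_index)
qed

definition scal :: "nat \<Rightarrow> (real \<Rightarrow> complex) \<Rightarrow> real \<Rightarrow> complex mat" where
  "scal m k = entry_fun m (\<lambda>i j t. if i = j then k t else 0)"

text \<open>A matrix unit weighted by a scalar function. The weight must vanish at each endpoint
  whose block structure separates the indices \<open>a\<close> and \<open>b\<close>; otherwise the
  element is not in the algebra.\<close>

definition munit :: "nat \<Rightarrow> (real \<Rightarrow> complex) \<Rightarrow> nat \<Rightarrow> nat \<Rightarrow> real \<Rightarrow> complex mat" where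
  "munit m c a b = entry_fun m (\<lambda>i j t. if i = a \<and> j = b then c t else 0)"

lemma continuous_on_if_const:
  "continuous_on S k \<Longrightarrow> continuous_on S (\<lambda>t. if P then k t else 0)" for k :: "real \<Rightarrow> complex"
  by (cases P) auto

lemma scal_S_alg:
  assumes "sum_list ps = m" "sum_list qs = m" "continuous_on {0..1} k"
  shows "scal m k \<in> S_alg m ps qs"
  unfolding scal_def using assms by (intro entry_fun_S_alg continuous_on_if_const) (auto split: if_splits intro: same_block_refl)

lemma munit_S_alg:
  assumes "sum_list ps = m" "sum_list qs = m" "continuous_on {0..1} c"
    and "c 0 \<noteq> 0 \<Longrightarrow> same_block ps a b" "c 1 \<noteq> 0 \<Longrightarrow> same_block qs a b"
  shows "munit m c a b \<in> S_alg m ps qs"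
  unfolding munit_def using assms by (intro entry_fun_S_alg continuous_on_if_const) (auto split: if_splits)

lemma scal_index: "i < m \<Longrightarrow> j < m \<Longrightarrow> scal m k t $$ (i,j) = (if i = j then k (clamp01 t) else 0)"
  by (simp add: scal_def entry_fun_index)

lemma munit_index:
  "i < m \<Longrightarrow> j < m \<Longrightarrow> munit m c a b t $$ (i,j) = (if i = a \<and> j = b then c (clamp01 t) else 0)"
  by (simp add: munit_def entry_fun_index)

lemma scal_dim [simp]: "dim_row (scal m k t) = m" "dim_col (scal m k t) = m" "scal m k t \<in> carrier_mat m m"
  by (simp_all add: scal_def)

lemma munit_dim [simp]: "dim_row (munit m c a b t) = m" "dim_col (munit m c a b t) = m"
  "munit m c a b t \<in> carrier_mat m m"
  by (simp_all add: munit_def)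

lemma scal_one: "scal m (\<lambda>t. 1) = funit m"
  by (intro ext eq_matI) (auto simp: funit_def scal_index)

lemma scal_add: "fadd (scal m k) (scal m l) = scal m (\<lambda>t. k t + l t)"
  by (intro ext eq_matI) (auto simp: fadd_def scal_index)

lemma scal_smult: "fsmult c (scal m k) = scal m (\<lambda>t. c * k t)"
  by (intro ext eq_matI) (auto simp: fsmult_def scal_index)

lemma scal_adj: "fadj (scal m k) = scal m (\<lambda>t. cnj (k t))"
  by (intro ext eq_matI) (auto simp: fadj_def scal_index)

lemma mult_scal_index:
  assumes "M \<in> carrier_mat m m" "i < m" "j < m"
  shows "(M * scal m k t) $$ (i,j) = M $$ (i,j) * k (clamp01 t)"
proof -
  have "(M * scal m k t) $$ (i,j) = (\<Sum>x<m. M $$ (i,x) * scal m k t $$ (x,j))"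
    by (rule mult_index[OF assms(1) scal_dim(3) assms(2,3)])
  also have "\<dots> = (\<Sum>x<m. if x = j then M $$ (i,j) * k (clamp01 t) else 0)"
    using assms by (intro sum.cong) (auto simp: scal_index)
  finally show ?thesis using assms by simp
qed

lemma scal_mult: "fmul (scal m k) (scal m l) = scal m (\<lambda>t. k t * l t)"
  unfolding fmul_def by (intro ext eq_matI) (auto simp: mult_scal_index scal_index simp del: index_mult_mat(1))

lemma mult_munit_index:
  assumes "M \<in> carrier_mat m m" "i < m" "j < m" "a < m"
  shows "(M * munit m c a b t) $$ (i,j) = (if j = b then M $$ (i,a) * c (clamp01 t) else 0)"
proof -
  have "(M * munit m c a b t) $$ (i,j) = (\<Sum>x<m. M $$ (i,x) * munit m c a b t $$ (x,j))"
    by (rule mult_index[OF assms(1) munit_dim(3) assms(2,3)])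
  also have "\<dots> = (\<Sum>x<m. if x = a then (if j = b then M $$ (i,a) * c (clamp01 t) else 0) else 0)"
    using assms by (intro sum.cong) (auto simp: munit_index)
  finally show ?thesis using assms by simp
qed

text \<open>Finite sums are formed entrywise with the size fixed in advance, so that the empty sum
  is the zero matrix of the right dimension.\<close>

definition fsum :: "nat \<Rightarrow> nat \<Rightarrow> (nat \<Rightarrow> real \<Rightarrow> complex mat) \<Rightarrow> real \<Rightarrow> complex mat" where
  "fsum m p G = (\<lambda>t. mat m m (\<lambda>(i,j). \<Sum>c<p. G c t $$ (i,j)))"

definition ip :: "complex mat \<Rightarrow> complex mat \<Rightarrow> complex" where
  "ip u v = (mat_adjoint u * v) $$ (0,0)"

lemma ip_sum: "u \<in> carrier_mat n 1 \<Longrightarrow> v \<in> carrier_mat n 1 \<Longrightarrow> ip u v = (\<Sum>x<n. cnj (u $$ (x,0)) * v $$ (x,0))"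
  unfolding ip_def by (subst mult_index[where n=1 and k=n and l=1]) (auto intro!: sum.cong)

lemma ip_self: "v \<in> carrier_mat n 1 \<Longrightarrow> ip v v = of_real (normsq v)"
  unfolding ip_def by (rule normsq_eq)

lemma ip_add: "u \<in> carrier_mat n 1 \<Longrightarrow> v \<in> carrier_mat n 1 \<Longrightarrow> w \<in> carrier_mat n 1 \<Longrightarrow> ip u (v + w) = ip u v + ip u w"
  by (simp add: ip_sum[where n=n] algebra_simps sum.distrib)

lemma ip_smult: "u \<in> carrier_mat n 1 \<Longrightarrow> v \<in> carrier_mat n 1 \<Longrightarrow> ip u (c \<cdot>\<^sub>m v) = c * ip u v"
  by (simp add: ip_sum[where n=n] sum_distrib_left mult_ac)

lemma ip_adj:
  "u \<in> carrier_mat n 1 \<Longrightarrow> M \<in> carrier_mat n k \<Longrightarrow> v \<in> carrier_mat k 1 \<Longrightarrow> ip u (M * v) = ip (mat_adjoint M * u) v"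
  unfolding ip_def by (simp add: adj_mult_dim mat_assoc)

lemma normsq_zero_iff: "v \<in> carrier_mat n 1 \<Longrightarrow> normsq v = 0 \<longleftrightarrow> v = 0\<^sub>m n 1"
  using normsq_pos[of v n] by (cases "v = 0\<^sub>m n 1") (auto simp: normsq_def)

text \<open>With \<open>0 / 0 = 0\<close> the quotient vanishes, hence is continuous, at the zeros of \<open>F\<close>.\<close>

lemma continuous_on_div_sqrt:
  fixes f :: "real \<Rightarrow> complex" and F :: "real \<Rightarrow> real"
  assumes f: "continuous_on S f" and F: "continuous_on S F" and le: "\<And>t. t \<in> S \<Longrightarrow> cmod (f t) \<le> F t"
  shows "continuous_on S (\<lambda>t. f t / of_real (sqrt (F t)))"
  unfolding continuous_on_eq_continuous_within
proof
  fix t assume t: "t \<in> S"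
  show "continuous (at t within S) (\<lambda>t. f t / of_real (sqrt (F t)))"
  proof (cases "F t = 0")
    case False
    have "continuous (at t within S) f" "continuous (at t within S) F"
      using f F t by (auto simp: continuous_on_eq_continuous_within)
    then show ?thesis using False by (intro continuous_intros) auto
  next
    case True
    have bd: "cmod (f s / of_real (sqrt (F s))) \<le> sqrt (F s)" if "s \<in> S" for s
    proof (cases "F s = 0")
      case False
      then have F0: "F s > 0" using le[OF that] norm_ge_zero[of "f s"] by linarith
      have "cmod (f s) / sqrt (F s) \<le> F s / sqrt (F s)"
        using F0 le[OF that] by (intro divide_right_mono) auto
      then show ?thesis using F0 by (simp add: norm_divide real_div_sqrt)
    qed simp
    have "((\<lambda>s. sqrt (F s)) \<longlongrightarrow> sqrt (F t)) (at t within S)"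
      using F t by (intro tendsto_intros) (auto simp: continuous_on_def)
    then have "((\<lambda>s. sqrt (F s)) \<longlongrightarrow> 0) (at t within S)" using True by simp
    then have "((\<lambda>s. f s / of_real (sqrt (F s))) \<longlongrightarrow> 0) (at t within S)"
      by (rule Lim_null_comparison[rotated]) (use bd in \<open>auto simp: eventually_at_filter\<close>)
    then show ?thesis using True by (simp add: continuous_within)
  qed
qed

text \<open>Near \<open>x\<close> the function is below \<open>e\<close> by continuity, and away
  from \<open>x\<close> the quadratic term exceeds its maximum. The bound is useful because the
  square of the coordinate minus \<open>x\<close> annihilates an eigenvector, so that only the
  arbitrary \<open>e\<close> remains.\<close>

lemma quadratic_majorant:
  fixes k :: "real \<Rightarrow> real"
  assumes k: "continuous_on {0..1} k" and x: "x \<in> {0..1}" "k x = 0" and e: "e > 0"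
  obtains C where "C \<ge> 0" "\<And>t. t \<in> {0..1} \<Longrightarrow> k t \<le> e + C * (t - x)\<^sup>2"
proof -
  obtain d where d: "d > 0" "\<And>t. t \<in> {0..1} \<Longrightarrow> \<bar>t - x\<bar> < d \<Longrightarrow> \<bar>k t\<bar> < e"
    using k x e unfolding continuous_on_iff dist_real_def by (metis diff_zero)
  have "compact (k ` {0..1})" using k by (intro compact_continuous_image) auto
  then obtain K where K: "\<And>t. t \<in> {0..1} \<Longrightarrow> \<bar>k t\<bar> \<le> K"
    by (meson bounded_real compact_imp_bounded imageI)
  have K0: "K \<ge> 0" using K[OF x(1)] by linarith
  show ?thesis
  \<comment> \<open>Outside the \<open>d\<close>-neighbourhood of \<open>x\<close> the factor
    \<open>(t - x)\<^sup>2 / d\<^sup>2\<close> is at least 1, so this constant dominates the bound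
    \<open>K\<close>.\<close>
  proof (rule that[of "K / d\<^sup>2"])
    fix t :: real assume t: "t \<in> {0..1}"
    show "k t \<le> e + K / d\<^sup>2 * (t - x)\<^sup>2"
    proof (cases "\<bar>t - x\<bar> < d")
      case True
      have "0 \<le> K / d\<^sup>2 * (t - x)\<^sup>2" using K0 by simp
      then show ?thesis using d(2)[OF t True] by linarith
    next
      case False
      then have "d\<^sup>2 \<le> (t - x)\<^sup>2" using d(1) by (metis abs_le_square_iff abs_of_pos not_le)
      then have "K * 1 \<le> K * ((t - x)\<^sup>2 / d\<^sup>2)" using K0 d(1) by (intro mult_left_mono) auto
      then show ?thesis using K[OF t] e by simp
    qed
  qed (use K0 in simp)
qed

section \<open>Finite-dimensional representations\<close>

text \<open>Labels for the building blocks of representations: the i-th block at 0, the j-th block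
  at 1, and evaluation at a point. The points 0 and 1 are also allowed in \<open>PX\<close>,
  although evaluation there splits into blocks; the normal form exploits this overlap.\<close>

datatype piece = P0 nat | P1 nat | PX real

locale splitting_data =
  fixes m :: nat and ps qs :: "nat list"
  assumes data: "split_data m ps qs"
begin

abbreviation "A \<equiv> S_alg m ps qs"

lemma sums: "sum_list ps = m" "sum_list qs = m"
  and ne: "ps \<noteq> []" "qs \<noteq> []"
  and ppos: "i < length ps \<Longrightarrow> 0 < ps ! i" and qpos: "j < length qs \<Longrightarrow> 0 < qs ! j"
  using data by (auto simp: split_data_def)

lemma m_pos: "0 < m"
  using ppos[of 0] ne sums(1) member_le_sum_list[of "ps ! 0" ps] by (cases ps) auto

lemmas closed =
  fadd_S_alg[OF _ _ sums] fsmult_S_alg[OF _ sums] fmul_S_alg[OF _ _ sums] fadj_S_alg[OF _ sums]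
  scal_S_alg[OF sums] munit_S_alg[OF sums]

lemma funit_in: "funit m \<in> A"
  using closed(5)[of "\<lambda>t. 1"] by (simp add: scal_one)

definition is_rep :: "nat \<Rightarrow> ((real \<Rightarrow> complex mat) \<Rightarrow> complex mat) \<Rightarrow> bool" where
  "is_rep n \<rho> \<longleftrightarrow> (\<forall>f\<in>A. \<rho> f \<in> carrier_mat n n)
     \<and> (\<forall>f\<in>A. \<forall>g\<in>A. \<rho> (fadd f g) = \<rho> f + \<rho> g)
     \<and> (\<forall>c. \<forall>f\<in>A. \<rho> (fsmult c f) = c \<cdot>\<^sub>m \<rho> f)
     \<and> (\<forall>f\<in>A. \<forall>g\<in>A. \<rho> (fmul f g) = \<rho> f * \<rho> g)
     \<and> (\<forall>f\<in>A. \<rho> (fadj f) = mat_adjoint (\<rho> f))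
     \<and> \<rho> (funit m) = 1\<^sub>m n"

section \<open>Vector functionals of a representation and eigenvectors of the coordinate
  function\<close>

context
  fixes n :: nat and \<rho> :: "(real \<Rightarrow> complex mat) \<Rightarrow> complex mat" and v :: "complex mat"
  assumes rep: "is_rep n \<rho>" and v: "v \<in> carrier_mat n 1"
begin

lemma rep_carrier: "f \<in> A \<Longrightarrow> \<rho> f \<in> carrier_mat n n"
  and rep_dim: "f \<in> A \<Longrightarrow> dim_row (\<rho> f) = n" "f \<in> A \<Longrightarrow> dim_col (\<rho> f) = n"
  and rep_add: "f \<in> A \<Longrightarrow> g \<in> A \<Longrightarrow> \<rho> (fadd f g) = \<rho> f + \<rho> g"
  and rep_smult: "f \<in> A \<Longrightarrow> \<rho> (fsmult c f) = c \<cdot>\<^sub>m \<rho> f"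
  and rep_mul: "f \<in> A \<Longrightarrow> g \<in> A \<Longrightarrow> \<rho> (fmul f g) = \<rho> f * \<rho> g"
  and rep_adj: "f \<in> A \<Longrightarrow> \<rho> (fadj f) = mat_adjoint (\<rho> f)"
  and rep_unit: "\<rho> (funit m) = 1\<^sub>m n"
  using rep by (auto simp: is_rep_def)

lemma rep_vec: "f \<in> A \<Longrightarrow> \<rho> f * v \<in> carrier_mat n 1"
  using rep_carrier v by (metis mult_carrier_mat)

lemma rep_add_vec: "f \<in> A \<Longrightarrow> g \<in> A \<Longrightarrow> \<rho> (fadd f g) * v = \<rho> f * v + \<rho> g * v"
  using rep_carrier v by (simp add: rep_add add_mult_distrib_mat[where nr=n and n=n and nc=1])

lemma rep_smult_vec: "f \<in> A \<Longrightarrow> \<rho> (fsmult c f) * v = c \<cdot>\<^sub>m (\<rho> f * v)"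
  using rep_carrier v by (simp add: rep_smult mult_smult_assoc_mat[where nr=n and n=n and nc=1])

lemma rep_mul_vec: "f \<in> A \<Longrightarrow> g \<in> A \<Longrightarrow> \<rho> (fmul f g) * v = \<rho> f * (\<rho> g * v)"
  using rep_dim v by (simp add: rep_mul mat_assoc)

lemma rep_unit_vec: "\<rho> (funit m) * v = v"
  using v by (simp add: rep_unit)

text \<open>Moves all inner products of vectors generated from \<open>v\<close> into the vector
  functional of \<open>v\<close>, where identities of the algebra can be applied.\<close>

lemma rep_ip: "f \<in> A \<Longrightarrow> g \<in> A \<Longrightarrow> ip (\<rho> f * v) (\<rho> g * v) = ip v (\<rho> (fmul (fadj f) g) * v)"
proof -
  assume f: "f \<in> A" and g: "g \<in> A"
  have "ip v (\<rho> (fmul (fadj f) g) * v) = ip v (mat_adjoint (\<rho> f) * (\<rho> g * v))"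
    using f g rep_dim v by (simp add: rep_mul rep_adj closed mat_assoc)
  also have "\<dots> = ip (\<rho> f * v) (\<rho> g * v)"
    using ip_adj[OF v adj_carrier[OF rep_carrier[OF f]] rep_vec[OF g]] by simp
  finally show ?thesis by simp
qed

lemma scal_cong: "(\<And>t. t \<in> {0..1} \<Longrightarrow> k t = l t) \<Longrightarrow> scal m k = scal m l"
  by (intro ext eq_matI) (auto simp: scal_index)

text \<open>A nonnegative scalar function is the square of its selfadjoint root, so the vector
  functional takes a squared norm on it. All positivity arguments below rest on this.\<close>

lemma rep_ip_scal:
  fixes k :: "real \<Rightarrow> real"
  assumes k: "continuous_on {0..1} k" "\<And>t. t \<in> {0..1} \<Longrightarrow> 0 \<le> k t"
  shows "ip v (\<rho> (scal m (\<lambda>t. of_real (k t))) * v) = of_real (normsq (\<rho> (scal m (\<lambda>t. of_real (sqrt (k t)))) * v))"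
proof -
  have r: "scal m (\<lambda>t. of_real (sqrt (k t))) \<in> A" using k by (intro closed continuous_intros)
  have "scal m (\<lambda>t. of_real (k t)) = fmul (fadj (scal m (\<lambda>t. of_real (sqrt (k t))))) (scal m (\<lambda>t. of_real (sqrt (k t))))"
    unfolding scal_adj scal_mult using k(2) by (intro scal_cong) (simp flip: of_real_mult)
  then show ?thesis using rep_ip[OF r r] ip_self[OF rep_vec[OF r]] by simp
qed

text \<open>Pairing the eigenvalue equation with \<open>v\<close> expresses \<open>z\<close> as a
  quotient of two squared norms.\<close>

lemma rep_eigenvalue_nonneg:
  fixes k :: "real \<Rightarrow> real"
  assumes k: "continuous_on {0..1} k" "\<And>t. t \<in> {0..1} \<Longrightarrow> 0 \<le> k t"
    and v0: "v \<noteq> 0\<^sub>m n 1" and z: "\<rho> (scal m (\<lambda>t. of_real (k t))) * v = z \<cdot>\<^sub>m v"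
  shows "z = of_real (Re z)" "Re z \<ge> 0"
proof -
  let ?N = "normsq (\<rho> (scal m (\<lambda>t. of_real (sqrt (k t)))) * v)"
  have "z * of_real (normsq v) = of_real ?N"
    using rep_ip_scal[OF k] ip_smult[OF v v] ip_self[OF v] z by simp
  moreover have p: "normsq v > 0" using normsq_pos[OF v v0] .
  ultimately have "z = of_real (?N / normsq v)" by (simp add: field_simps)
  moreover have "?N / normsq v \<ge> 0" using p normsq_nonneg by simp
  ultimately show "z = of_real (Re z)" "Re z \<ge> 0" by simp_all
qed

context
  fixes x :: real
  assumes x: "x \<in> {0..1}" and ev: "\<rho> (scal m of_real) * v = of_real x \<cdot>\<^sub>m v"
begin

text \<open>Since the square of the coordinate minus \<open>x\<close> kills \<open>v\<close>,
  positivity of the vector functional on \<open>e + C * (t - x)\<^sup>2 - (k t)\<^sup>2\<close>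
  bounds the squared norm of the image by \<open>e\<close> times that of \<open>v\<close>, for every
  positive \<open>e\<close>.\<close>

lemma rep_kill_scal:
  fixes k :: "real \<Rightarrow> real"
  assumes k: "continuous_on {0..1} k" "\<And>t. t \<in> {0..1} \<Longrightarrow> 0 \<le> k t" "k x = 0"
  shows "\<rho> (scal m (\<lambda>t. of_real (k t))) * v = 0\<^sub>m n 1"
proof -
  define w where "w = \<rho> (scal m (\<lambda>t. of_real (k t))) * v"
  have kA: "scal m (\<lambda>t. of_real (k t)) \<in> A" using k by (intro closed continuous_intros)
  have w: "w \<in> carrier_mat n 1" unfolding w_def by (rule rep_vec[OF kA])
  let ?k2 = "scal m (\<lambda>t. of_real ((k t)\<^sup>2))"
  have k2A: "?k2 \<in> A" using k by (intro closed continuous_intros)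
  have ipk2: "ip v (\<rho> ?k2 * v) = of_real (normsq w)"
  proof -
    have "scal m (\<lambda>t. complex_of_real (sqrt ((k t)\<^sup>2))) = scal m (\<lambda>t. of_real (k t))"
      using k(2) by (intro scal_cong) simp
    then show ?thesis using rep_ip_scal[of "\<lambda>t. (k t)\<^sup>2"] k(1) by (simp add: w_def continuous_on_power)
  qed
  let ?l = "scal m (\<lambda>t. of_real t - of_real x)"
  have hA: "scal m of_real \<in> A" and lA: "?l \<in> A" by (intro closed continuous_intros)+
  have "?l = fadd (scal m of_real) (fsmult (- of_real x) (funit m))"
    unfolding scal_one[symmetric] scal_smult scal_add by (rule scal_cong) simp
  then have "\<rho> ?l * v = of_real x \<cdot>\<^sub>m v + (- of_real x) \<cdot>\<^sub>m v"
    using hA funit_in closed ev by (simp add: rep_add_vec rep_smult_vec rep_unit_vec)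
  also have "\<dots> = 0\<^sub>m n 1" using v by (intro eq_matI) auto
  finally have lv: "\<rho> ?l * v = 0\<^sub>m n 1" .
  let ?q = "scal m (\<lambda>t. of_real ((t - x)\<^sup>2))"
  have "?q = fmul ?l ?l" unfolding scal_mult by (intro scal_cong) (simp add: power2_eq_square)
  then have qv: "\<rho> ?q * v = 0\<^sub>m n 1"
    using lA lv rep_carrier[OF lA] by (simp add: rep_mul_vec)
  have qA: "?q \<in> A" by (intro closed continuous_intros)
  have "normsq w \<le> e * normsq v" if e: "e > 0" for e
  proof -
    obtain C where C: "C \<ge> 0" "\<And>t. t \<in> {0..1} \<Longrightarrow> (k t)\<^sup>2 \<le> e + C * (t - x)\<^sup>2"
      using quadratic_majorant[of "\<lambda>t. (k t)\<^sup>2" x e] k x e by (auto intro: continuous_on_power)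
    let ?g = "\<lambda>t. e + C * (t - x)\<^sup>2 - (k t)\<^sup>2"
    let ?G = "fadd (fsmult (of_real e) (funit m)) (fadd (fsmult (of_real C) ?q) (fsmult (-1) ?k2))"
    have "scal m (\<lambda>t. of_real (?g t)) = ?G"
      unfolding scal_one[symmetric] scal_smult scal_add by (rule scal_cong) simp
    moreover have "\<rho> ?G * v = of_real e \<cdot>\<^sub>m v + (of_real C \<cdot>\<^sub>m (0\<^sub>m n 1) + (-1) \<cdot>\<^sub>m (\<rho> ?k2 * v))"
      using qA k2A funit_in closed qv by (simp add: rep_add_vec rep_smult_vec rep_unit_vec)
    moreover have "ip v (of_real e \<cdot>\<^sub>m v + (of_real C \<cdot>\<^sub>m (0\<^sub>m n 1) + (-1) \<cdot>\<^sub>m (\<rho> ?k2 * v)))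
      = of_real e * of_real (normsq v) - of_real (normsq w)"
    proof -
      have "ip v (0\<^sub>m n 1) = 0" using v by (simp add: ip_sum[where n=n])
      then show ?thesis using v rep_vec[OF k2A] ipk2 ip_self[OF v]
        by (simp add: ip_add[where n=n] ip_smult[where n=n])
    qed
    ultimately have "ip v (\<rho> (scal m (\<lambda>t. of_real (?g t))) * v) = of_real (e * normsq v - normsq w)" by simp
    moreover have "continuous_on {0..1} ?g" using k(1) by (intro continuous_intros)
    moreover have "\<And>t. t \<in> {0..1} \<Longrightarrow> 0 \<le> ?g t" using C(2) by simp
    ultimately have "of_real (e * normsq v - normsq w) = complex_of_real (normsq (\<rho> (scal m (\<lambda>t. of_real (sqrt (?g t)))) * v))"
      using rep_ip_scal[of ?g] by simp
    then have "e * normsq v - normsq w = normsq (\<rho> (scal m (\<lambda>t. of_real (sqrt (?g t)))) * v)"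
      by (simp only: of_real_eq_iff)
    then show ?thesis using normsq_nonneg by (metis diff_ge_0_iff_ge)
  qed
  note le = this
  have "normsq w \<le> 0"
  proof (rule field_le_epsilon)
    fix e :: real assume e: "e > 0"
    have p: "normsq v + 1 > 0" using normsq_nonneg[of v] by linarith
    \<comment> \<open>The added 1 keeps the quotient meaningful when \<open>v\<close> is the zero
      vector, which this context permits.\<close>
    have "normsq w \<le> e / (normsq v + 1) * normsq v" using e p by (intro le) simp
    also have "\<dots> \<le> e" using e p normsq_nonneg[of v] by (simp add: field_simps)
    finally show "normsq w \<le> 0 + e" by simp
  qed
  then show ?thesis using normsq_nonneg[of w] normsq_zero_iff[OF w] by (simp add: w_def)
qed

text \<open>Factor \<open>f\<close> as \<open>(f / k) * k\<close> with \<open>k\<close> the square root of the entrywise 1-norm of \<open>f\<close>.\<close>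

lemma rep_kill:
  assumes f: "f \<in> A" and fx: "f x = 0\<^sub>m m m"
  shows "\<rho> f * v = 0\<^sub>m n 1"
proof -
  note fD = S_algD[OF f]
  define F where "F t = (\<Sum>i<m. \<Sum>j<m. cmod (f t $$ (i,j)))" for t
  have Fc: "continuous_on {0..1} F" unfolding F_def using fD(5) by (intro continuous_intros) auto
  have F0: "F t \<ge> 0" for t unfolding F_def by (intro sum_nonneg) auto
  have le: "cmod (f t $$ (i,j)) \<le> F t" if "i < m" "j < m" for i j t
  proof -
    have "cmod (f t $$ (i,j)) \<le> (\<Sum>j<m. cmod (f t $$ (i,j)))" using that by (intro member_le_sum) auto
    also have "\<dots> \<le> F t" unfolding F_def
      using that by (intro member_le_sum[where f="\<lambda>i. \<Sum>j<m. cmod (f t $$ (i,j))"] sum_nonneg) auto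
    finally show ?thesis .
  qed
  define k where "k t = sqrt (F t)" for t
  define g where "g = entry_fun m (\<lambda>i j t. f t $$ (i,j) / of_real (sqrt (F t)))"
  \<comment> \<open>Division by a scalar function leaves zero entries zero, so \<open>g\<close>
    inherits both block conditions; continuity at the zeros of \<open>F\<close> comes from the bound
    of each entry by \<open>F\<close>.\<close>
  have gA: "g \<in> A" unfolding g_def
    using sums fD(5,6,7) le by (intro entry_fun_S_alg continuous_on_div_sqrt Fc) (auto simp: block_diag_iff)
  have kc: "continuous_on {0..1} k" unfolding k_def using Fc by (intro continuous_intros)
  have kA: "scal m (\<lambda>t. of_real (k t)) \<in> A" using kc by (intro closed continuous_intros)
  have "f = fmul g (scal m (\<lambda>t. of_real (k t)))"
  proof (intro ext eq_matI)
    fix t i j assume "i < dim_row (fmul g (scal m (\<lambda>t. of_real (k t))) t)" "j < dim_col (fmul g (scal m (\<lambda>t. of_real (k t))) t)"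
    then have i: "i < m" and j: "j < m" by (auto simp: fmul_def g_def)
    let ?t = "clamp01 t"
    have "f t $$ (i,j) = f ?t $$ (i,j)" using fD(4) by metis
    also have "\<dots> = f ?t $$ (i,j) / of_real (sqrt (F ?t)) * of_real (k ?t)"
    proof (cases "F ?t = 0")
      case True
      then show ?thesis using le[OF i j, of ?t] by simp
    next
      case False
      then show ?thesis by (simp add: k_def)
    qed
    also have "\<dots> = fmul g (scal m (\<lambda>t. of_real (k t))) t $$ (i,j)"
      unfolding fmul_def using i j
      by (subst mult_scal_index) (auto simp: g_def entry_fun_index)
    finally show "f t $$ (i,j) = fmul g (scal m (\<lambda>t. of_real (k t))) t $$ (i,j)" .
  qed (use fD in \<open>auto simp: fmul_def g_def\<close>)
  then have "\<rho> f * v = \<rho> g * (\<rho> (scal m (\<lambda>t. of_real (k t))) * v)"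
    using rep_mul_vec[OF gA kA] by simp
  \<comment> \<open>As \<open>f x = 0\<close> forces \<open>F x = 0\<close>, the scalar factor falls
    under the scalar case.\<close>
  also have "\<rho> (scal m (\<lambda>t. of_real (k t))) * v = 0\<^sub>m n 1"
    using F0 fx by (intro rep_kill_scal kc) (auto simp: k_def F_def intro!: sum.neutral)
  finally show ?thesis using rep_carrier[OF gA] by simp
qed

text \<open>On the cyclic vector \<open>v\<close> the representation factors through evaluation at
  \<open>x\<close>. Relations between elements therefore have to be checked only at that one
  point.\<close>

lemma rep_eq_at:
  assumes f: "f \<in> A" and g: "g \<in> A" and fg: "f x = g x"
  shows "\<rho> f * v = \<rho> g * v"
proof -
  let ?d = "fadd f (fsmult (-1) g)"
  have dA: "?d \<in> A" using f g by (intro closed)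
  have "?d x = 0\<^sub>m m m" using fg S_algD(2,3)[OF g] by (intro eq_matI) (auto simp: fadd_def fsmult_def)
  then have z: "\<rho> f * v + (-1) \<cdot>\<^sub>m (\<rho> g * v) = 0\<^sub>m n 1"
    using rep_kill[OF dA] f g closed by (simp add: rep_add_vec rep_smult_vec)
  show ?thesis
  proof (rule eq_matI)
    fix i j assume "i < dim_row (\<rho> g * v)" "j < dim_col (\<rho> g * v)"
    then have ij: "i < n" "j < 1" using rep_vec[OF g] by auto
    have "(\<rho> f * v + (-1) \<cdot>\<^sub>m (\<rho> g * v)) $$ (i,j) = 0" using z ij by simp
    then show "(\<rho> f * v) $$ (i,j) = (\<rho> g * v) $$ (i,j)"
      using ij rep_vec[OF f] rep_vec[OF g] by (simp del: index_mult_mat)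
  qed (use rep_dim[OF f] rep_dim[OF g] v in auto)
qed

end

lemma rep_fsum:
  assumes "\<And>c. c < p \<Longrightarrow> G c \<in> A"
  shows "fsum m p G \<in> A \<and> (\<forall>i<n. (\<rho> (fsum m p G) * v) $$ (i,0) = (\<Sum>c<p. (\<rho> (G c) * v) $$ (i,0)))"
  using assms
proof (induct p)
  case 0
  have "fsum m 0 G = fsmult 0 (funit m)"
    by (intro ext eq_matI) (auto simp: fsum_def fsmult_def funit_def)
  then show ?case using funit_in closed v by (simp add: rep_smult_vec rep_unit_vec)
next
  case (Suc p)
  have IH: "fsum m p G \<in> A" "\<And>i. i < n \<Longrightarrow> (\<rho> (fsum m p G) * v) $$ (i,0) = (\<Sum>c<p. (\<rho> (G c) * v) $$ (i,0))"
    using Suc by auto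
  have Gp: "G p \<in> A" using Suc.prems by simp
  have e: "fsum m (Suc p) G = fadd (fsum m p G) (G p)"
    using S_algD(2,3)[OF Gp] by (intro ext eq_matI) (auto simp: fsum_def fadd_def)
  show ?case
    using IH Gp rep_vec[OF IH(1)] rep_vec[OF Gp] closed(1)
    by (auto simp: e rep_add_vec simp del: index_mult_mat)
qed

end

end

text \<open>Allows an identity between direct sums to be read off on the second summand; this is how
  the complement of a split summand inherits its properties.\<close>

lemma dirsum_right_inj:
  assumes "dirsum B E = dirsum B' E'" "B \<in> carrier_mat p p" "B' \<in> carrier_mat p p"
    "E \<in> carrier_mat k k" "E' \<in> carrier_mat k k"
  shows "E = E'"
proof (rule eq_matI)
  fix i j assume "i < dim_row E'" "j < dim_col E'"
  then have ij: "i < k" "j < k" using assms by auto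
  have "dirsum B E $$ (i + p, j + p) = dirsum B' E' $$ (i + p, j + p)" using assms(1) by simp
  then show "E $$ (i,j) = E' $$ (i,j)" using ij assms(2-) by (simp add: dirsum_index)
qed (use assms in auto)

context splitting_data
begin

text \<open>The vectors obtained by applying the matrix units of one column to \<open>v\<close> are
  pairwise orthogonal and of equal norm, and after normalisation they form the columns of the
  isometry. The weighted units satisfy the relations of matrix units only at \<open>x\<close>, which
  is enough because \<open>v\<close> sees nothing else. The premise \<open>col\<close> says that
  \<open>f x\<close> leaves the index range of the summand invariant, and \<open>nz\<close> keeps
  the common norm positive.\<close>

lemma piece_at:
  assumes rep: "is_rep n \<rho>" and v: "v \<in> carrier_mat n 1"
    and x: "x \<in> {0..1}" and ev: "\<rho> (scal m of_real) * v = of_real x \<cdot>\<^sub>m v"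
    and sp: "s + p \<le> m" and a0: "a0 < p" and cx: "c x = 1"
    and mem: "\<And>b. b < p \<Longrightarrow> munit m c (s + b) (s + a0) \<in> A"
    and col: "\<And>f b i. f \<in> A \<Longrightarrow> b < p \<Longrightarrow> i < m \<Longrightarrow> f x $$ (i, s + b) \<noteq> 0 \<Longrightarrow> s \<le> i \<and> i < s + p"
    and nz: "\<rho> (munit m c (s + a0) (s + a0)) * v \<noteq> 0\<^sub>m n 1"
  shows "\<exists>T. T \<in> carrier_mat n p \<and> mat_adjoint T * T = 1\<^sub>m p \<and>
    (\<forall>f\<in>A. \<rho> f * T = T * mat p p (\<lambda>(i,j). f x $$ (s + i, s + j))
       \<and> mat_adjoint (\<rho> f) * T = T * mat_adjoint (mat p p (\<lambda>(i,j). f x $$ (s + i, s + j))))"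
proof -
  note rv = rep_vec[OF rep v] and rc = rep_carrier[OF rep v]
  have x': "clamp01 x = x" using x by simp
  define E where "E b = munit m c (s + b) (s + a0)" for b
  have E: "E b \<in> A" if "b < p" for b using mem[OF that] by (simp add: E_def)
  define w where "w b = \<rho> (E b) * v" for b
  have w: "w b \<in> carrier_mat n 1" if "b < p" for b unfolding w_def using rv[OF E[OF that]] .
  define kap where "kap = normsq (w a0)"
  have kap: "kap > 0" unfolding kap_def using nz by (intro normsq_pos[OF w[OF a0]]) (simp add: w_def E_def)
  have EE: "fmul (fadj (E b)) (E b') x $$ (i,j) = (if b = b' \<and> i = s + a0 \<and> j = s + a0 then 1 else 0)"
    if "b < p" "b' < p" "i < m" "j < m" for b b' i j
    using that sp a0 by (simp only: fmul_def E_def, subst mult_munit_index) (auto simp: fadj_def E_def munit_index x' cx)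
  have dims: "dim_row (fmul (fadj (E b)) (E b') x) = m" "dim_col (fmul (fadj (E b)) (E b') x) = m" for b b'
    by (simp_all add: fmul_def fadj_def E_def)
  have ipw: "ip (w b) (w b') = (if b = b' then of_real kap else 0)" if b: "b < p" "b' < p" for b b'
  proof (cases "b = b'")
    case True
    have "ip (w b) (w b) = ip v (\<rho> (fmul (fadj (E b)) (E b)) * v)"
      unfolding w_def using rep_ip[OF rep v E E] b by simp
    also have "\<rho> (fmul (fadj (E b)) (E b)) * v = \<rho> (fmul (fadj (E a0)) (E a0)) * v"
    proof (rule rep_eq_at[OF rep v x ev])
      show "fmul (fadj (E b)) (E b) x = fmul (fadj (E a0)) (E a0) x"
        using b a0 EE by (intro eq_matI) (auto simp: dims)
    qed (use E b a0 in \<open>auto intro: closed\<close>)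
    also have "ip v \<dots> = ip (w a0) (w a0)"
      unfolding w_def using rep_ip[OF rep v E E] a0 by simp
    also have "\<dots> = of_real kap" using ip_self[OF w[OF a0]] by (simp add: kap_def)
    finally show ?thesis using True by simp
  next
    case False
    have "ip (w b) (w b') = ip v (\<rho> (fmul (fadj (E b)) (E b')) * v)"
      unfolding w_def using rep_ip[OF rep v E E] b by simp
    also have "\<rho> (fmul (fadj (E b)) (E b')) * v = 0\<^sub>m n 1"
    proof (rule rep_kill[OF rep v x ev])
      show "fmul (fadj (E b)) (E b') x = 0\<^sub>m m m"
        using b False EE by (intro eq_matI) (auto simp: dims)
    qed (use E b in \<open>auto intro: closed\<close>)
    also have "ip v (0\<^sub>m n 1) = 0" using v by (simp add: ip_sum[where n=n])
    finally show ?thesis using False by simp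
  qed
  \<comment> \<open>The factor normalising the common squared norm \<open>kap\<close> to 1.\<close>
  define be where "be = complex_of_real (1 / sqrt kap)"
  have be: "cnj be * be * of_real kap = 1"
    using kap by (simp add: be_def flip: of_real_mult)
  define T where "T = mat n p (\<lambda>(i,b). be * w b $$ (i,0))"
  have T: "T \<in> carrier_mat n p" by (simp add: T_def)
  define R where "R f = mat p p (\<lambda>(i,j). f x $$ (s + i, s + j))" for f :: "real \<Rightarrow> complex mat"
  have R: "R f \<in> carrier_mat p p" for f by (simp add: R_def)
  have TT: "mat_adjoint T * T = 1\<^sub>m p"
  proof (rule eq_matI)
    fix i j assume "i < dim_row (1\<^sub>m p :: complex mat)" "j < dim_col (1\<^sub>m p :: complex mat)"
    then have i: "i < p" and j: "j < p" by auto
    have "(mat_adjoint T * T) $$ (i,j) = (\<Sum>y<n. mat_adjoint T $$ (i,y) * T $$ (y,j))"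
      by (rule mult_index[OF adj_carrier[OF T] T i j])
    also have "\<dots> = (\<Sum>y<n. cnj be * be * (cnj (w i $$ (y,0)) * w j $$ (y,0)))"
      using i j T by (intro sum.cong) (auto simp: T_def)
    also have "\<dots> = cnj be * be * ip (w i) (w j)"
      by (simp add: ip_sum[OF w[OF i] w[OF j]] sum_distrib_left)
    also have "\<dots> = (if i = j then 1 else 0)" using ipw[OF i j] be by simp
    finally show "(mat_adjoint T * T) $$ (i,j) = 1\<^sub>m p $$ (i,j)" using i j by simp
  qed (use T in auto)
  have RT: "\<rho> f * T = T * R f" if f: "f \<in> A" for f
  proof (rule eq_matI)
    fix i b assume "i < dim_row (T * R f)" "b < dim_col (T * R f)"
    then have i: "i < n" and b: "b < p" using T R by (auto simp: R_def)
    define G where "G cc = fsmult (f x $$ (s + cc, s + b)) (E cc)" for cc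
    have G: "G cc \<in> A" if "cc < p" for cc unfolding G_def using E[OF that] by (rule closed)
    note fs = rep_fsum[OF rep v, of p G]
    have fsA: "fsum m p G \<in> A" using fs G by blast
    \<comment> \<open>At \<open>x\<close>, multiplying a unit by \<open>f\<close> gives the
      combination of the units in the same column with coefficients from column \<open>s + b\<close>
      of \<open>f x\<close>; no other rows occur, by \<open>col\<close>.\<close>
    have "fmul f (E b) x = fsum m p G x"
    proof (rule eq_matI)
      fix k l assume "k < dim_row (fsum m p G x)" "l < dim_col (fsum m p G x)"
      then have kl: "k < m" "l < m" by (auto simp: fsum_def)
      have "fmul f (E b) x $$ (k,l) = (if l = s + a0 then f x $$ (k, s + b) else 0)"
        unfolding fmul_def E_def using kl b a0 sp S_algD(1)[OF f]
        by (subst mult_munit_index) (auto simp: x' cx)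
      also have "\<dots> = (\<Sum>cc<p. if cc = k - s then (if s \<le> k \<and> l = s + a0 then f x $$ (k, s + b) else 0) else 0)"
        using col[OF f b kl(1)] by (cases "f x $$ (k, s + b) = 0") auto
      also have "\<dots> = (\<Sum>cc<p. G cc x $$ (k,l))"
        using kl sp by (intro sum.cong) (auto simp: G_def E_def fsmult_def munit_index x' cx)
      finally show "fmul f (E b) x $$ (k,l) = fsum m p G x $$ (k,l)" using kl by (simp add: fsum_def)
    qed (use S_algD[OF f] in \<open>auto simp: fsum_def fmul_def E_def\<close>)
    then have eq: "\<rho> (fmul f (E b)) * v = \<rho> (fsum m p G) * v"
      using f E[OF b] fsA by (intro rep_eq_at[OF rep v x ev]) (auto intro: closed)
    have "(\<rho> f * T) $$ (i,b) = (\<Sum>y<n. \<rho> f $$ (i,y) * T $$ (y,b))" by (rule mult_index[OF rc[OF f] T i b])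
    also have "\<dots> = (\<Sum>y<n. be * (\<rho> f $$ (i,y) * w b $$ (y,0)))"
      using b by (intro sum.cong) (auto simp: T_def)
    also have "\<dots> = be * (\<rho> f * w b) $$ (i,0)"
      unfolding sum_distrib_left[symmetric] by (subst mult_index[OF rc[OF f] w[OF b] i]) auto
    also have "\<rho> f * w b = \<rho> (fsum m p G) * v"
      using eq rep_mul_vec[OF rep v f E[OF b]] by (simp add: w_def)
    also have "be * (\<rho> (fsum m p G) * v) $$ (i,0) = (\<Sum>cc<p. be * (\<rho> (G cc) * v) $$ (i,0))"
      using fs G i by (simp add: sum_distrib_left del: index_mult_mat)
    also have "\<dots> = (\<Sum>cc<p. T $$ (i,cc) * R f $$ (cc,b))"
    proof (intro sum.cong refl)
      fix cc assume "cc \<in> {..<p}"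
      then have cc: "cc < p" by simp
      have "\<rho> (G cc) * v = f x $$ (s + cc, s + b) \<cdot>\<^sub>m w cc"
        unfolding G_def w_def by (rule rep_smult_vec[OF rep v E[OF cc]])
      then show "be * (\<rho> (G cc) * v) $$ (i,0) = T $$ (i,cc) * R f $$ (cc,b)"
        using cc b i w[OF cc] by (simp add: T_def R_def del: index_mult_mat)
    qed
    also have "\<dots> = (T * R f) $$ (i,b)" by (rule mult_index[OF T R i b, symmetric])
    finally show "(\<rho> f * T) $$ (i,b) = (T * R f) $$ (i,b)" .
  qed (use T R rc[OF that] in \<open>auto simp: R_def\<close>)
  \<comment> \<open>The adjoint relation is the direct relation for \<open>fadj f\<close>.\<close>
  have "mat_adjoint (\<rho> f) * T = T * mat_adjoint (R f)" if f: "f \<in> A" for f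
  proof -
    have "R (fadj f) = mat_adjoint (R f)"
      using S_algD(2,3)[OF f] sp by (intro eq_matI) (auto simp: R_def fadj_def)
    then show ?thesis using RT[OF closed(4)[OF f]] rep_adj[OF rep v f] by simp
  qed
  then show ?thesis using T TT RT by (auto simp: R_def)
qed

text \<open>The summand is the block of \<open>rs\<close> containing \<open>a\<close>: at an
  endpoint, \<open>f x\<close> does not leave this block. Only units inside one block are required
  to lie in the algebra.\<close>

lemma piece_at_endpoint:
  assumes rep: "is_rep n \<rho>" and v: "v \<in> carrier_mat n 1"
    and x: "x \<in> {0..1}" and ev: "\<rho> (scal m of_real) * v = of_real x \<cdot>\<^sub>m v"
    and rs: "sum_list rs = m" and a: "a < m" and cx: "c x = 1"
    and mem: "\<And>b. same_block rs b a \<Longrightarrow> munit m c b a \<in> A"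
    and bd: "\<And>f. f \<in> A \<Longrightarrow> block_diag_wrt rs (f x)"
    and nz: "\<rho> (munit m c a a) * v \<noteq> 0\<^sub>m n 1"
  shows "\<exists>i<length rs. \<exists>T. T \<in> carrier_mat n (rs ! i) \<and> mat_adjoint T * T = 1\<^sub>m (rs ! i) \<and>
    (\<forall>f\<in>A. \<rho> f * T = T * blk rs i (f x) \<and> mat_adjoint (\<rho> f) * T = T * mat_adjoint (blk rs i (f x)))"
proof -
  obtain i where i: "i < length rs" "blk_start rs i \<le> a" "a < blk_start rs i + rs ! i"
    using block_exists[of a rs] a rs by metis
  let ?s = "blk_start rs i"
  have s: "?s + (a - ?s) = a" using i by simp
  have "\<exists>T. T \<in> carrier_mat n (rs ! i) \<and> mat_adjoint T * T = 1\<^sub>m (rs ! i) \<and>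
    (\<forall>f\<in>A. \<rho> f * T = T * mat (rs ! i) (rs ! i) (\<lambda>(j,k). f x $$ (?s + j, ?s + k))
     \<and> mat_adjoint (\<rho> f) * T = T * mat_adjoint (mat (rs ! i) (rs ! i) (\<lambda>(j,k). f x $$ (?s + j, ?s + k))))"
  proof (rule piece_at[OF rep v x ev, where c = c and ?a0.0 = "a - ?s"])
    fix f b j assume f: "f \<in> A" and b: "b < rs ! i" and j: "j < m" and "f x $$ (j, ?s + b) \<noteq> 0"
    then have "same_block rs j (?s + b)"
      using bd[OF f] blk_start_le[OF i(1)] rs by (auto simp: block_diag_iff)
    then have "same_block rs (?s + b) j" by (rule same_block_sym)
    then show "?s \<le> j \<and> j < ?s + rs ! i" using same_block_iff[of i rs "?s + b" j] i(1) b by simp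
  next
    fix b assume "b < rs ! i"
    then show "munit m c (?s + b) (?s + (a - ?s)) \<in> A"
      unfolding s using i by (intro mem) (simp add: same_block_iff)
  qed (use i cx nz blk_start_le[OF i(1)] rs s in auto)
  then show ?thesis using i(1) by (auto simp: blk_def)
qed

definition pieces :: "piece set" where
  "pieces = P0 ` {..<length ps} \<union> P1 ` {..<length qs} \<union> PX ` {0..1}"

fun ev :: "piece \<Rightarrow> (real \<Rightarrow> complex mat) \<Rightarrow> complex mat" where
  "ev (P0 i) f = blk ps i (f 0)"
| "ev (P1 j) f = blk qs j (f 1)"
| "ev (PX x) f = f x"

fun pdim :: "piece \<Rightarrow> nat" where
  "pdim (P0 i) = ps ! i"
| "pdim (P1 j) = qs ! j"
| "pdim (PX x) = m"

lemma ev_carrier: "f \<in> A \<Longrightarrow> ev c f \<in> carrier_mat (pdim c) (pdim c)"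
  by (cases c) (auto simp: blk_def intro: S_algD(1))

lemma pdim_pos: "c \<in> pieces \<Longrightarrow> 0 < pdim c"
  using m_pos ppos qpos by (auto simp: pieces_def)

text \<open>Both the coordinate and 1 minus the coordinate are nonnegative, so an eigenvalue of the
  coordinate lies in [0,1]. The diagonal matrix units sum to the identity, hence one of them does
  not kill the eigenvector. Its weight may then be changed to any admissible function that is 1 at
  \<open>x\<close>, and the position of \<open>x\<close> decides which summand arises.\<close>

lemma rep_piece:
  assumes rep: "is_rep n \<rho>" and n: "0 < n"
  shows "\<exists>c\<in>pieces. \<exists>T. T \<in> carrier_mat n (pdim c) \<and> mat_adjoint T * T = 1\<^sub>m (pdim c) \<and>
    (\<forall>f\<in>A. \<rho> f * T = T * ev c f \<and> mat_adjoint (\<rho> f) * T = T * mat_adjoint (ev c f))"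
proof -
  have hA: "scal m of_real \<in> A" by (intro closed continuous_intros)
  have "\<rho> (scal m of_real) \<in> carrier_mat n n" using rep hA by (simp add: is_rep_def)
  then obtain z v where v: "v \<in> carrier_mat n 1" "v \<noteq> 0\<^sub>m n 1" and zv: "\<rho> (scal m of_real) * v = z \<cdot>\<^sub>m v"
    using eigenvector_column n by metis
  have z0: "z = of_real (Re z)" "Re z \<ge> 0"
    using rep_eigenvalue_nonneg[OF rep v(1), of "\<lambda>t. t" z] v(2) zv by (auto simp: continuous_on_id)
  have "scal m (\<lambda>t. of_real (1 - t)) = fadd (funit m) (fsmult (-1) (scal m of_real))"
    unfolding scal_one[symmetric] scal_smult scal_add by simp
  then have "\<rho> (scal m (\<lambda>t. of_real (1 - t))) * v = v + (-1) \<cdot>\<^sub>m (z \<cdot>\<^sub>m v)"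
    using hA funit_in zv by (simp add: closed rep_add_vec[OF rep v(1)] rep_smult_vec[OF rep v(1)] rep_unit_vec[OF rep v(1)])
  also have "\<dots> = (1 - z) \<cdot>\<^sub>m v" using v(1) by (intro eq_matI) (auto simp: algebra_simps)
  finally have "Re (1 - z) \<ge> 0"
    using rep_eigenvalue_nonneg(2)[OF rep v(1), of "\<lambda>t. 1 - t" "1 - z"] v(2)
    by (simp add: continuous_on_diff continuous_on_id)
  then have x: "Re z \<in> {0..1}" using z0 by simp
  define x where "x = Re z"
  have x: "x \<in> {0..1}" and ev: "\<rho> (scal m of_real) * v = of_real x \<cdot>\<^sub>m v"
    using x zv z0 by (simp_all add: x_def)
  have "\<exists>a<m. \<rho> (munit m (\<lambda>_. 1) a a) * v \<noteq> 0\<^sub>m n 1"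
  proof (rule ccontr)
    assume "\<not> ?thesis"
    then have z: "\<And>a. a < m \<Longrightarrow> \<rho> (munit m (\<lambda>_. 1) a a) * v = 0\<^sub>m n 1" by blast
    let ?G = "\<lambda>a. munit m (\<lambda>_. 1) a a"
    have "fsum m m ?G = funit m"
    proof (intro ext eq_matI)
      fix t i j assume "i < dim_row (funit m t)" "j < dim_col (funit m t)"
      then have ij: "i < m" "j < m" by (auto simp: funit_def)
      have "(\<Sum>c<m. ?G c t $$ (i,j)) = (\<Sum>c<m. if c = i then (if i = j then 1 else 0) else 0)"
        using ij by (intro sum.cong) (auto simp: munit_index)
      then show "fsum m m ?G t $$ (i,j) = funit m t $$ (i,j)" using ij by (simp add: fsum_def funit_def)
    qed (auto simp: fsum_def funit_def)
    moreover have "?G c \<in> A" if "c < m" for c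
      using that sums by (intro closed) (auto intro: same_block_refl)
    ultimately have "v $$ (i,0) = 0" if "i < n" for i
      using rep_fsum[OF rep v(1), of m ?G] rep_unit_vec[OF rep v(1)] z that by (simp del: index_mult_mat)
    then have "v = 0\<^sub>m n 1" using v(1) by (intro eq_matI) auto
    then show False using v(2) by simp
  qed
  then obtain a where a: "a < m" "\<rho> (munit m (\<lambda>_. 1) a a) * v \<noteq> 0\<^sub>m n 1" by blast
  have nz: "\<rho> (munit m c a a) * v \<noteq> 0\<^sub>m n 1" if "c x = 1" "munit m c a a \<in> A" for c
  proof -
    have "munit m (\<lambda>_. 1) a a \<in> A" using a(1) sums by (intro closed) (auto intro: same_block_refl)
    moreover have "munit m c a a x = munit m (\<lambda>_. 1) a a x"
      using that(1) x by (intro eq_matI) (auto simp: munit_index)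
    ultimately have "\<rho> (munit m c a a) * v = \<rho> (munit m (\<lambda>_. 1) a a) * v"
      using rep_eq_at[OF rep v(1) x ev that(2)] by blast
    then show ?thesis using a(2) by simp
  qed
  consider "x = 0" | "x = 1" | "0 < x" "x < 1" using x by fastforce
  then show ?thesis
  proof cases
    case 1
    \<comment> \<open>Equal to 1 at 0 and vanishing at 1, where indices of one block of
      \<open>ps\<close> may lie in different blocks of \<open>qs\<close>.\<close>
    let ?c = "\<lambda>t. 1 - complex_of_real t"
    have mem: "munit m ?c b a \<in> A" if "same_block ps b a" for b
      using that by (intro closed) (auto intro!: continuous_intros)
    then have "munit m ?c a a \<in> A" using same_block_refl[of a ps] a(1) sums by simp
    then have "\<rho> (munit m ?c a a) * v \<noteq> 0\<^sub>m n 1" using 1 by (intro nz) auto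
    with piece_at_endpoint[OF rep v(1) x ev sums(1) a(1), of ?c] mem S_algD(6) 1
    obtain i T where i: "i < length ps" and T: "T \<in> carrier_mat n (ps ! i)" "mat_adjoint T * T = 1\<^sub>m (ps ! i)"
      "\<forall>f\<in>A. \<rho> f * T = T * blk ps i (f x) \<and> mat_adjoint (\<rho> f) * T = T * mat_adjoint (blk ps i (f x))"
      by auto
    show ?thesis using i T 1 by (intro bexI[of _ "P0 i"]) (auto simp: pieces_def)
  next
    case 2
    let ?c = "\<lambda>t. complex_of_real t"
    have mem: "munit m ?c b a \<in> A" if "same_block qs b a" for b
      using that by (intro closed) (auto intro!: continuous_intros)
    then have "munit m ?c a a \<in> A" using same_block_refl[of a qs] a(1) sums by simp
    then have "\<rho> (munit m ?c a a) * v \<noteq> 0\<^sub>m n 1" using 2 by (intro nz) auto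
    with piece_at_endpoint[OF rep v(1) x ev sums(2) a(1), of ?c] mem S_algD(7) 2
    obtain i T where i: "i < length qs" and T: "T \<in> carrier_mat n (qs ! i)" "mat_adjoint T * T = 1\<^sub>m (qs ! i)"
      "\<forall>f\<in>A. \<rho> f * T = T * blk qs i (f x) \<and> mat_adjoint (\<rho> f) * T = T * mat_adjoint (blk qs i (f x))"
      by auto
    show ?thesis using i T 2 by (intro bexI[of _ "P1 i"]) (auto simp: pieces_def)
  next
    case 3
    \<comment> \<open>Vanishes at both endpoints, so every weighted unit is admissible; the
      denominator makes the value at \<open>x\<close> equal to 1.\<close>
    let ?c = "\<lambda>t. complex_of_real (t * (1 - t) / (x * (1 - x)))"
    have mem: "munit m ?c b b' \<in> A" for b b'
      using 3 by (intro closed) (auto intro!: continuous_intros)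
    have "\<exists>T. T \<in> carrier_mat n m \<and> mat_adjoint T * T = 1\<^sub>m m \<and>
      (\<forall>f\<in>A. \<rho> f * T = T * mat m m (\<lambda>(j,k). f x $$ (0 + j, 0 + k))
       \<and> mat_adjoint (\<rho> f) * T = T * mat_adjoint (mat m m (\<lambda>(j,k). f x $$ (0 + j, 0 + k))))"
      using 3 mem a(1) nz[of ?c] by (intro piece_at[OF rep v(1) x ev, where c = ?c and ?a0.0 = a]) auto
    moreover have "mat m m (\<lambda>(j,k). f x $$ (0 + j, 0 + k)) = f x" if "f \<in> A" for f
      using S_algD(2,3)[OF that] by (intro eq_matI) auto
    ultimately show ?thesis using x by (intro bexI[of _ "PX x"]) (auto simp: pieces_def)
  qed
qed

text \<open>After conjugation by \<open>V\<close> every axiom becomes an identity between direct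
  sums, whose second summands are compared.\<close>

lemma rep_restrict:
  assumes rep: "is_rep (p + k) \<rho>" and V: "unitary_mat (p + k) V"
    and dec: "\<And>f. f \<in> A \<Longrightarrow> B f \<in> carrier_mat p p \<and> E f \<in> carrier_mat k k \<and> \<rho> f = V * dirsum (B f) (E f) * mat_adjoint V"
  shows "is_rep k E"
proof -
  let ?n = "p + k"
  note Vc = unitaryD[OF V]
  have c: "B f \<in> carrier_mat p p" "E f \<in> carrier_mat k k" if "f \<in> A" for f using dec[OF that] by auto
  have inv: "dirsum (B f) (E f) = mat_adjoint V * \<rho> f * V" if f: "f \<in> A" for f
    using conj_unitary_inv(2)[OF V, of "dirsum (B f) (E f)"] dec[OF f] by simp
  have rc: "\<rho> f \<in> carrier_mat ?n ?n" if "f \<in> A" for f using rep that by (simp add: is_rep_def)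
  have add: "E (fadd f g) = E f + E g" if f: "f \<in> A" and g: "g \<in> A" for f g
  proof (rule dirsum_right_inj)
    have "dirsum (B (fadd f g)) (E (fadd f g)) = mat_adjoint V * (\<rho> f + \<rho> g) * V"
      using inv[OF closed(1)[OF f g]] rep f g by (simp add: is_rep_def)
    also have "\<dots> = mat_adjoint V * \<rho> f * V + mat_adjoint V * \<rho> g * V"
      using mult_add_distrib_mat[OF Vc(2) rc[OF f] rc[OF g]]
        add_mult_distrib_mat[OF mult_carrier_mat[OF Vc(2) rc[OF f]] mult_carrier_mat[OF Vc(2) rc[OF g]] Vc(1)] by simp
    also have "\<dots> = dirsum (B f) (E f) + dirsum (B g) (E g)" by (simp add: inv f g)
    also have "\<dots> = dirsum (B f + B g) (E f + E g)"
      using c[OF f] c[OF g] by (intro eq_matI) (auto simp: dirsum_index)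
    finally show "dirsum (B (fadd f g)) (E (fadd f g)) = dirsum (B f + B g) (E f + E g)" .
  qed (use c[OF f] c[OF g] c[OF closed(1)[OF f g]] in auto)
  have smult: "E (fsmult z f) = z \<cdot>\<^sub>m E f" if f: "f \<in> A" for f z
  proof (rule dirsum_right_inj)
    have "dirsum (B (fsmult z f)) (E (fsmult z f)) = mat_adjoint V * (z \<cdot>\<^sub>m \<rho> f) * V"
      using inv[OF closed(2)[OF f]] rep f by (simp add: is_rep_def)
    also have "\<dots> = z \<cdot>\<^sub>m (mat_adjoint V * \<rho> f * V)"
      using mult_smult_distrib[OF Vc(2) rc[OF f]]
        mult_smult_assoc_mat[OF mult_carrier_mat[OF Vc(2) rc[OF f]] Vc(1)] by simp
    also have "\<dots> = dirsum (z \<cdot>\<^sub>m B f) (z \<cdot>\<^sub>m E f)"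
      unfolding inv[OF f, symmetric] using c[OF f] by (intro eq_matI) (auto simp: dirsum_index)
    finally show "dirsum (B (fsmult z f)) (E (fsmult z f)) = dirsum (z \<cdot>\<^sub>m B f) (z \<cdot>\<^sub>m E f)" .
  qed (use c[OF f] c[OF closed(2)[OF f]] in auto)
  have mul: "E (fmul f g) = E f * E g" if f: "f \<in> A" and g: "g \<in> A" for f g
  proof (rule dirsum_right_inj)
    have "dirsum (B (fmul f g)) (E (fmul f g)) = mat_adjoint V * (\<rho> f * \<rho> g) * V"
      using inv[OF closed(3)[OF f g]] rep f g by (simp add: is_rep_def)
    also have "\<dots> = (mat_adjoint V * \<rho> f * V) * (mat_adjoint V * \<rho> g * V)"
      using Vc(1) rc[OF f] rc[OF g] by (simp add: mat_assoc unitary_cancel[OF V])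
    also have "\<dots> = dirsum (B f) (E f) * dirsum (B g) (E g)" by (simp add: inv f g)
    also have "\<dots> = dirsum (B f * B g) (E f * E g)"
      using c[OF f] c[OF g] by (intro dirsum_mult) auto
    finally show "dirsum (B (fmul f g)) (E (fmul f g)) = dirsum (B f * B g) (E f * E g)" .
  qed (use c[OF f] c[OF g] c[OF closed(3)[OF f g]] in auto)
  have adj: "E (fadj f) = mat_adjoint (E f)" if f: "f \<in> A" for f
  proof (rule dirsum_right_inj)
    have "dirsum (B (fadj f)) (E (fadj f)) = mat_adjoint V * mat_adjoint (\<rho> f) * V"
      using inv[OF closed(4)[OF f]] rep f by (simp add: is_rep_def)
    also have "\<dots> = mat_adjoint (mat_adjoint V * \<rho> f * V)"
      using Vc(1) rc[OF f] by (simp add: mat_assoc adj_mult_dim)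
    also have "\<dots> = dirsum (mat_adjoint (B f)) (mat_adjoint (E f))"
      by (simp add: inv[OF f, symmetric] dirsum_adj)
    finally show "dirsum (B (fadj f)) (E (fadj f)) = dirsum (mat_adjoint (B f)) (mat_adjoint (E f))" .
  qed (use c[OF f] c[OF closed(4)[OF f]] in auto)
  have unit: "E (funit m) = 1\<^sub>m k"
  proof (rule dirsum_right_inj)
    have "dirsum (B (funit m)) (E (funit m)) = mat_adjoint V * 1\<^sub>m ?n * V"
      using inv[OF funit_in] rep by (simp add: is_rep_def)
    also have "\<dots> = dirsum (1\<^sub>m p) (1\<^sub>m k)" using Vc by (simp add: dirsum_one)
    finally show "dirsum (B (funit m)) (E (funit m)) = dirsum (1\<^sub>m p) (1\<^sub>m k)" .
  qed (use c[OF funit_in] in auto)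
  show ?thesis unfolding is_rep_def using c add smult mul adj unit by auto
qed

lemma rep_decomposition:
  assumes "is_rep n \<rho>"
  shows "\<exists>cs U. set cs \<subseteq> pieces \<and> sum_list (map pdim cs) = n \<and> unitary_mat n U \<and>
    (\<forall>f\<in>A. \<rho> f = mat_adjoint U * diag_block_mat (map (\<lambda>c. ev c f) cs) * U)"
proof (rule orthogonal_decomposition[where Rep = is_rep and F = A and C = pieces and r = ev and d = pdim, OF _ _ _ _ _ assms])
  show "\<And>n \<rho> f. is_rep n \<rho> \<Longrightarrow> f \<in> A \<Longrightarrow> \<rho> f \<in> carrier_mat n n" by (simp add: is_rep_def)
  show "\<And>c f. c \<in> pieces \<Longrightarrow> f \<in> A \<Longrightarrow> ev c f \<in> carrier_mat (pdim c) (pdim c)" by (rule ev_carrier)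
  show "\<And>c. c \<in> pieces \<Longrightarrow> 0 < pdim c" by (rule pdim_pos)
  show "\<And>n \<rho>. is_rep n \<rho> \<Longrightarrow> 0 < n \<Longrightarrow> \<exists>c\<in>pieces. \<exists>T. T \<in> carrier_mat n (pdim c) \<and> mat_adjoint T * T = 1\<^sub>m (pdim c) \<and>
        (\<forall>f\<in>A. \<rho> f * T = T * ev c f \<and> mat_adjoint (\<rho> f) * T = T * mat_adjoint (ev c f))"
    by (rule rep_piece)
  show "\<And>p k \<rho> V B E. is_rep (p + k) \<rho> \<Longrightarrow> unitary_mat (p + k) V \<Longrightarrow>
        (\<And>f. f \<in> A \<Longrightarrow> B f \<in> carrier_mat p p \<and> E f \<in> carrier_mat k k \<and> \<rho> f = V * dirsum (B f) (E f) * mat_adjoint V) \<Longrightarrow> is_rep k E"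
    by (rule rep_restrict) blast+
qed

end

section \<open>Normal forms\<close>

lemma diag_block_of_blocks_aux:
  assumes "block_diag_wrt ps M" "k \<le> length ps"
  shows "diag_block_mat (map (\<lambda>i. blk ps i M) [0..<k]) = mat (blk_start ps k) (blk_start ps k) (\<lambda>(i,j). M $$ (i,j))"
  using assms(2)
proof (induct k)
  case 0
  show ?case by (rule eq_matI) auto
next
  case (Suc k)
  let ?s = "blk_start ps k" and ?p = "ps ! k"
  have k: "k < length ps" using Suc.prems by simp
  have le: "?s + ?p \<le> sum_list ps" by (rule blk_start_le[OF k])
  have z: "M $$ (i,j) = 0 \<and> M $$ (j,i) = 0" if "i < ?s" "?s \<le> j" "j < ?s + ?p" for i j
  proof -
    have "\<not> same_block ps j i" using that same_block_iff[OF k, of j i] by auto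
    then show ?thesis using assms(1) that le same_block_sym unfolding block_diag_iff by (metis add_leD1 le_trans not_le order.strict_trans2)
  qed
  have "diag_block_mat (map (\<lambda>i. blk ps i M) [0..<Suc k]) = dirsum (mat ?s ?s (\<lambda>(i,j). M $$ (i,j))) (blk ps k M)"
    using Suc by (simp add: diag_block_append del: diag_block_mat.simps(2))
  also have "\<dots> = mat (blk_start ps (Suc k)) (blk_start ps (Suc k)) (\<lambda>(i,j). M $$ (i,j))"
    unfolding blk_start_Suc[OF k]
  proof (rule eq_matI)
    fix i j assume "i < dim_row (mat (?s + ?p) (?s + ?p) (\<lambda>(i,j). M $$ (i,j)))"
      "j < dim_col (mat (?s + ?p) (?s + ?p) (\<lambda>(i,j). M $$ (i,j)))"
    then have ij: "i < ?s + ?p" "j < ?s + ?p" by auto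
    then show "dirsum (mat ?s ?s (\<lambda>(i,j). M $$ (i,j))) (blk ps k M) $$ (i,j) = mat (?s + ?p) (?s + ?p) (\<lambda>(i,j). M $$ (i,j)) $$ (i,j)"
      using z[of i j] z[of j i]
      by (cases "i < ?s"; cases "j < ?s") (simp_all add: dirsum_index blk_def less_diff_conv2 add.commute)
  qed (simp_all add: blk_def)
  finally show ?case .
qed

lemma diag_block_of_blocks:
  assumes "block_diag_wrt ps M" "M \<in> carrier_mat (sum_list ps) (sum_list ps)"
  shows "diag_block_mat (map (\<lambda>i. blk ps i M) [0..<length ps]) = M"
  using diag_block_of_blocks_aux[OF assms(1) order.refl] assms(2)
  by (auto simp: blk_start_length intro!: eq_matI)

lemma perm_matrix_conj:
  assumes \<sigma>: "\<sigma> permutes {..<n}" and M: "M \<in> carrier_mat n n" and ij: "i < n" "j < n"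
    and P: "P = mat n n (\<lambda>(i,j). if i = \<sigma> j then 1 else (0::complex))"
  shows "(mat_adjoint P * M * P) $$ (i,j) = M $$ (\<sigma> i, \<sigma> j)"
proof -
  have Pc: "P \<in> carrier_mat n n" by (simp add: P)
  have s: "\<sigma> i < n" "\<sigma> j < n" using permutes_in_image[OF \<sigma>] ij by auto
  have MP: "(M * P) $$ (k,j) = M $$ (k, \<sigma> j)" if k: "k < n" for k
  proof -
    have "(M * P) $$ (k,j) = (\<Sum>x<n. M $$ (k,x) * P $$ (x,j))" by (rule mult_index[OF M Pc k ij(2)])
    also have "\<dots> = (\<Sum>x<n. if x = \<sigma> j then M $$ (k,x) else 0)"
      using ij by (intro sum.cong) (auto simp: P)
    finally show ?thesis using s by simp
  qed
  have "(mat_adjoint P * M * P) $$ (i,j) = (mat_adjoint P * (M * P)) $$ (i,j)" using Pc M by (simp add: mat_assoc)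
  also have "\<dots> = (\<Sum>x<n. mat_adjoint P $$ (i,x) * (M * P) $$ (x,j))"
    by (rule mult_index[OF adj_carrier[OF Pc] mult_carrier_mat[OF M Pc] ij])
  also have "\<dots> = (\<Sum>x<n. if x = \<sigma> i then M $$ (x, \<sigma> j) else 0)"
  proof (intro sum.cong refl)
    fix x assume "x \<in> {..<n}"
    then have "mat_adjoint P $$ (i,x) = (if x = \<sigma> i then 1 else 0)" "(M * P) $$ (x,j) = M $$ (x, \<sigma> j)"
      using ij MP by (simp_all add: P)
    then show "mat_adjoint P $$ (i,x) * (M * P) $$ (x,j) = (if x = \<sigma> i then M $$ (x, \<sigma> j) else 0)" by simp
  qed
  finally show ?thesis using s by simp
qed

lemma perm_matrix_unitary:
  assumes "perm_matrix n P"
  shows "unitary_mat n P"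
proof -
  obtain \<sigma> where \<sigma>: "\<sigma> permutes {..<n}" and P: "P = mat n n (\<lambda>(i,j). if i = \<sigma> j then 1 else 0)"
    using assms by (auto simp: perm_matrix_def)
  have Pc: "P \<in> carrier_mat n n" by (simp add: P)
  have "mat_adjoint P * 1\<^sub>m n * P = 1\<^sub>m n"
  proof (rule eq_matI)
    fix i j assume "i < dim_row (1\<^sub>m n :: complex mat)" "j < dim_col (1\<^sub>m n :: complex mat)"
    then have ij: "i < n" "j < n" by auto
    show "(mat_adjoint P * 1\<^sub>m n * P) $$ (i,j) = 1\<^sub>m n $$ (i,j)"
      using perm_matrix_conj[OF \<sigma> one_carrier_mat ij P] permutes_in_image[OF \<sigma>] ij permutes_inj[OF \<sigma>]
      by (auto simp: inj_eq)
  qed (use Pc in auto)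
  then show ?thesis using Pc by (intro unitaryI) auto
qed

context splitting_data
begin

abbreviation D :: "piece list \<Rightarrow> (real \<Rightarrow> complex mat) \<Rightarrow> complex mat" where
  "D cs f \<equiv> diag_block_mat (map (\<lambda>c. ev c f) cs)"

abbreviation tdim :: "piece list \<Rightarrow> nat" where
  "tdim cs \<equiv> sum_list (map pdim cs)"

lemma D_carrier: "f \<in> A \<Longrightarrow> D cs f \<in> carrier_mat (tdim cs) (tdim cs)"
  by (rule diag_block_carrier) (rule ev_carrier)

lemma D_Cons: "D (c # cs) f = dirsum (ev c f) (D cs f)"
  by (simp add: diag_block_mat_Cons del: diag_block_mat.simps(2))

lemma D_append: "D (cs @ ds) f = dirsum (D cs f) (D ds f)"
  by (simp add: diag_block_append)

text \<open>One index map has to serve all \<open>f\<close> at once, so that it comes from a single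
  permutation matrix. It is kept as an injective self-map of an initial segment, without prescribed
  values outside, which makes composing and shifting easy.\<close>

definition sim :: "piece list \<Rightarrow> piece list \<Rightarrow> bool" where
  "sim cs ds \<longleftrightarrow> tdim cs = tdim ds \<and> (\<exists>\<sigma>. inj_on \<sigma> {..<tdim cs} \<and> \<sigma> ` {..<tdim cs} \<subseteq> {..<tdim cs} \<and>
     (\<forall>f\<in>A. \<forall>i<tdim cs. \<forall>j<tdim cs. D cs f $$ (i,j) = D ds f $$ (\<sigma> i, \<sigma> j)))"

lemma sim_eqI: "tdim cs = tdim ds \<Longrightarrow> (\<And>f. f \<in> A \<Longrightarrow> D cs f = D ds f) \<Longrightarrow> sim cs ds"
  unfolding sim_def by (auto intro!: exI[of _ id])

lemma simE:
  assumes "sim cs ds"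
  obtains \<sigma> where "tdim ds = tdim cs" "inj_on \<sigma> {..<tdim cs}" "\<sigma> ` {..<tdim cs} \<subseteq> {..<tdim cs}"
    "\<And>f i j. f \<in> A \<Longrightarrow> i < tdim cs \<Longrightarrow> j < tdim cs \<Longrightarrow> D cs f $$ (i,j) = D ds f $$ (\<sigma> i, \<sigma> j)"
  using assms unfolding sim_def by (elim conjE exE) (rule that, (rule sym, assumption), assumption, assumption, blast)

lemma sim_trans:
  assumes "sim cs ds" "sim ds es"
  shows "sim cs es"
proof -
  let ?n = "tdim cs"
  obtain \<sigma> where \<sigma>: "inj_on \<sigma> {..<?n}" "\<sigma> ` {..<?n} \<subseteq> {..<?n}" and d: "tdim ds = ?n"
    and s: "\<And>f i j. f \<in> A \<Longrightarrow> i < ?n \<Longrightarrow> j < ?n \<Longrightarrow> D cs f $$ (i,j) = D ds f $$ (\<sigma> i, \<sigma> j)"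
    using assms(1) by (rule simE) blast
  obtain \<tau> where \<tau>: "inj_on \<tau> {..<?n}" "\<tau> ` {..<?n} \<subseteq> {..<?n}" and e: "tdim es = ?n"
    and t: "\<And>f i j. f \<in> A \<Longrightarrow> i < ?n \<Longrightarrow> j < ?n \<Longrightarrow> D ds f $$ (i,j) = D es f $$ (\<tau> i, \<tau> j)"
    using assms(2) unfolding d[symmetric] by (rule simE) (simp only: d)
  have a: "inj_on (\<tau> \<circ> \<sigma>) {..<?n}" using \<sigma> \<tau> by (meson comp_inj_on inj_on_subset)
  have b: "(\<tau> \<circ> \<sigma>) ` {..<?n} \<subseteq> {..<?n}" using \<sigma>(2) \<tau>(2) by auto
  have c: "D cs f $$ (i,j) = D es f $$ ((\<tau> \<circ> \<sigma>) i, (\<tau> \<circ> \<sigma>) j)" if "f \<in> A" "i < ?n" "j < ?n" for f i j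
  proof -
    have "\<sigma> i < ?n" "\<sigma> j < ?n" using \<sigma>(2) that by auto
    then show ?thesis using s[OF that] t that by simp
  qed
  show ?thesis unfolding sim_def e
    by (intro conjI exI[of _ "\<tau> \<circ> \<sigma>"] ballI allI impI refl a b) (rule c)
qed

lemma sim_Cons:
  assumes "sim cs ds"
  shows "sim (c # cs) (c # ds)"
proof -
  let ?n = "tdim cs" and ?p = "pdim c"
  obtain \<sigma> where \<sigma>: "inj_on \<sigma> {..<?n}" "\<sigma> ` {..<?n} \<subseteq> {..<?n}" and d: "tdim ds = ?n"
    and s: "\<And>f i j. f \<in> A \<Longrightarrow> i < ?n \<Longrightarrow> j < ?n \<Longrightarrow> D cs f $$ (i,j) = D ds f $$ (\<sigma> i, \<sigma> j)"
    using assms by (rule simE) blast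
  define \<tau> where "\<tau> i = (if i < ?p then i else \<sigma> (i - ?p) + ?p)" for i
  have \<sigma>n: "\<sigma> i < ?n" if "i < ?n" for i using \<sigma>(2) that by auto
  have "inj_on \<tau> {..<?p + ?n}"
  proof (rule inj_onI)
    fix i j assume "i \<in> {..<?p + ?n}" "j \<in> {..<?p + ?n}" and e: "\<tau> i = \<tau> j"
    then have ij: "i < ?p + ?n" "j < ?p + ?n" by auto
    show "i = j"
    proof (cases "i < ?p \<or> j < ?p")
      case True
      then show ?thesis using e by (auto simp: \<tau>_def split: if_splits)
    next
      case False
      then have "\<sigma> (i - ?p) = \<sigma> (j - ?p)" using e by (simp add: \<tau>_def)
      then have "i - ?p = j - ?p" using \<sigma>(1) ij False by (auto simp: inj_on_def)
      then show ?thesis using False by linarith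
    qed
  qed
  moreover have t: "\<tau> i < ?p + ?n" if "i < ?p + ?n" for i
    using \<sigma>n[of "i - ?p"] that by (auto simp: \<tau>_def)
  moreover have "D (c # cs) f $$ (i,j) = D (c # ds) f $$ (\<tau> i, \<tau> j)" if f: "f \<in> A" and ij: "i < ?p + ?n" "j < ?p + ?n" for f i j
  proof -
    note cc = ev_carrier[OF f, of c] D_carrier[OF f, of cs] D_carrier[OF f, of ds]
    show ?thesis
      unfolding D_Cons using cc d ij t[OF ij(1)] t[OF ij(2)] s[OF f, of "i - ?p" "j - ?p"]
      by (subst (1 2) dirsum_index) (auto simp: \<tau>_def)
  qed
  ultimately show ?thesis unfolding sim_def using d by (auto intro!: exI[of _ \<tau>])
qed

lemma sim_swap: "sim (c # d # cs) (d # c # cs)"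
proof -
  let ?n = "tdim cs" and ?a = "pdim c" and ?b = "pdim d"
  \<comment> \<open>Interchanges the first two blocks and fixes the indices after them.\<close>
  define \<tau> where "\<tau> i = (if i < ?a then i + ?b else if i < ?a + ?b then i - ?a else i)" for i
  have "inj_on \<tau> {..<?a + (?b + ?n)}" by (auto simp: inj_on_def \<tau>_def split: if_splits)
  moreover have t: "\<tau> i < ?a + (?b + ?n)" if "i < ?a + (?b + ?n)" for i using that by (auto simp: \<tau>_def)
  moreover have "D (c # d # cs) f $$ (i,j) = D (d # c # cs) f $$ (\<tau> i, \<tau> j)"
    if f: "f \<in> A" and ij: "i < ?a + (?b + ?n)" "j < ?a + (?b + ?n)" for f i j
  proof -
    note cc = ev_carrier[OF f, of c] ev_carrier[OF f, of d] D_carrier[OF f, of cs]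
    have dims: "dim_row (ev c f) = ?a" "dim_col (ev c f) = ?a" "dim_row (ev d f) = ?b" "dim_col (ev d f) = ?b"
      "dim_row (D cs f) = ?n" "dim_col (D cs f) = ?n" using cc by auto
    consider "i < ?a" | "?a \<le> i" "i < ?a + ?b" | "?a + ?b \<le> i" by linarith
    then show ?thesis unfolding D_Cons
    proof cases
      case 1
      consider "j < ?a" | "?a \<le> j" "j < ?a + ?b" | "?a + ?b \<le> j" by linarith
      then show "dirsum (ev c f) (dirsum (ev d f) (D cs f)) $$ (i,j) = dirsum (ev d f) (dirsum (ev c f) (D cs f)) $$ (\<tau> i, \<tau> j)"
        by cases (use 1 ij in \<open>simp_all add: dirsum_index dims \<tau>_def\<close>)
    next
      case 2
      consider "j < ?a" | "?a \<le> j" "j < ?a + ?b" | "?a + ?b \<le> j" by linarith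
      then show "dirsum (ev c f) (dirsum (ev d f) (D cs f)) $$ (i,j) = dirsum (ev d f) (dirsum (ev c f) (D cs f)) $$ (\<tau> i, \<tau> j)"
        by cases (use 2 ij in \<open>simp_all add: dirsum_index dims \<tau>_def less_diff_conv2 add.commute\<close>)
    next
      case 3
      consider "j < ?a" | "?a \<le> j" "j < ?a + ?b" | "?a + ?b \<le> j" by linarith
      then show "dirsum (ev c f) (dirsum (ev d f) (D cs f)) $$ (i,j) = dirsum (ev d f) (dirsum (ev c f) (D cs f)) $$ (\<tau> i, \<tau> j)"
        by cases (use 3 ij in \<open>simp_all add: dirsum_index dims \<tau>_def le_diff_conv2 less_diff_conv2 add.commute diff_commute\<close>)
    qed
  qed
  ultimately show ?thesis unfolding sim_def by (auto intro!: exI[of _ \<tau>] simp: add_ac)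
qed

lemma sim_refl: "sim cs cs"
  by (rule sim_eqI) auto

lemma sim_insert: "sim (c # as @ bs) (as @ c # bs)"
proof (induct as)
  case (Cons a as)
  have "sim (c # a # as @ bs) (a # c # as @ bs)" by (rule sim_swap)
  also have "sim \<dots> (a # as @ c # bs)" by (rule sim_Cons[OF Cons])
  finally (sim_trans) show ?case by simp
qed (simp add: sim_refl)

text \<open>Any rearrangement is obtained by repeatedly moving the head of the list to its place,
  and such a move is a chain of swaps of neighbours.\<close>

lemma sim_mset: "mset cs = mset ds \<Longrightarrow> sim cs ds"
proof (induct cs arbitrary: ds)
  case (Cons c cs)
  have "c \<in> set ds" using Cons.prems by (metis list.set_intros(1) set_mset_mset)
  then obtain as bs where ds: "ds = as @ c # bs" by (meson split_list)
  then have "mset cs = mset (as @ bs)" using Cons.prems by simp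
  from sim_trans[OF sim_Cons[OF Cons.hyps[OF this]] sim_insert] show ?case by (simp add: ds)
qed (simp add: sim_refl)

lemma sim_perm:
  assumes "sim cs ds"
  obtains P where "perm_matrix (tdim cs) P" "\<And>f. f \<in> A \<Longrightarrow> D cs f = mat_adjoint P * D ds f * P"
proof -
  let ?n = "tdim cs"
  obtain \<sigma> where \<sigma>: "inj_on \<sigma> {..<?n}" "\<sigma> ` {..<?n} \<subseteq> {..<?n}" and d: "tdim ds = ?n"
    and s: "\<And>f i j. f \<in> A \<Longrightarrow> i < ?n \<Longrightarrow> j < ?n \<Longrightarrow> D cs f $$ (i,j) = D ds f $$ (\<sigma> i, \<sigma> j)"
    using assms by (rule simE) blast
  \<comment> \<open>A permutation has to fix everything outside the segment.\<close>
  define \<tau> where "\<tau> i = (if i < ?n then \<sigma> i else i)" for i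
  have \<tau>: "\<tau> permutes {..<?n}"
    using \<sigma> by (intro inj_imp_permutes) (auto simp: \<tau>_def inj_on_def)
  define P where "P = mat ?n ?n (\<lambda>(i,j). if i = \<tau> j then 1 else (0::complex))"
  have "D cs f = mat_adjoint P * D ds f * P" if f: "f \<in> A" for f
  proof (rule eq_matI)
    fix i j assume "i < dim_row (mat_adjoint P * D ds f * P)" "j < dim_col (mat_adjoint P * D ds f * P)"
    then have ij: "i < ?n" "j < ?n" by (auto simp: P_def)
    have "D ds f \<in> carrier_mat ?n ?n" using D_carrier[OF f, of ds] d by simp
    then show "D cs f $$ (i,j) = (mat_adjoint P * D ds f * P) $$ (i,j)"
      using perm_matrix_conj[OF \<tau> _ ij P_def] s[OF f ij] ij by (simp add: \<tau>_def del: index_mult_mat)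
  qed (use D_carrier[OF f, of cs] in \<open>auto simp: P_def\<close>)
  moreover have "perm_matrix ?n P" using \<tau> by (auto simp: perm_matrix_def P_def)
  ultimately show ?thesis using that by blast
qed

definition nf_list :: "nat list \<Rightarrow> nat list \<Rightarrow> real list \<Rightarrow> piece list" where
  "nf_list nu om xs = concat (map (\<lambda>i. replicate (nu ! i) (P0 i)) [0..<length ps])
     @ concat (map (\<lambda>j. replicate (om ! j) (P1 j)) [0..<length qs]) @ map PX xs"

definition is_nf :: "nat list \<Rightarrow> nat list \<Rightarrow> real list \<Rightarrow> bool" where
  "is_nf nu om xs \<longleftrightarrow> length nu = length ps \<and> (\<exists>i<length ps. nu ! i = 0)
     \<and> length om = length qs \<and> (\<exists>j<length qs. om ! j = 0) \<and> sorted xs \<and> set xs \<subseteq> {0..1}"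

lemma D_nf_list:
  "D (nf_list nu om xs) f = diag_block_mat ([Lambda ps nu (f 0), Lambda qs om (f 1)] @ map f xs)"
  by (simp add: nf_list_def diag_block_append diag_block_mat_Cons Lambda_def map_concat comp_def
      del: diag_block_mat.simps(2))

lemma count_concat_replicate:
  "count (mset (concat (map (\<lambda>i. replicate (h i) (g i)) [0..<r]))) c = (\<Sum>i<r. if c = g i then h i else 0)"
  by (induct r) auto

lemma tdim_nf_list:
  "tdim (nf_list nu om xs) = (\<Sum>i<length ps. nu ! i * ps ! i) + (\<Sum>j<length qs. om ! j * qs ! j) + length xs * m"
proof -
  have 1: "sum_list (map pdim (concat (map (\<lambda>i. replicate (h i) (g i)) [0..<r]))) = (\<Sum>i<r. h i * pdim (g i))" for h g r
    by (induct r) (auto simp: sum_list_replicate)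
  show ?thesis unfolding nf_list_def map_append sum_list_append 1
    by (simp add: comp_def sum_list_triv)
qed

definition points :: "piece list \<Rightarrow> real list" where
  "points cs = concat (map (\<lambda>c. case c of PX x \<Rightarrow> [x] | _ \<Rightarrow> []) cs)"

lemma count_points: "count (mset (points cs)) x = count (mset cs) (PX x)"
  by (induct cs) (auto simp: points_def split: piece.splits)

text \<open>Each trade of a full set of blocks for a point lowers the number of pieces that are not
  points, so the process ends. When neither endpoint admits a trade, some block at 0 and some block
  at 1 are absent, and these give the vanishing components.\<close>

lemma normal_form:
  assumes "set cs \<subseteq> pieces"
  shows "\<exists>nu om xs. is_nf nu om xs \<and> sim cs (nf_list nu om xs)"
  using assms
proof (induct "length (filter (\<lambda>c. \<forall>x. c \<noteq> PX x) cs)" arbitrary: cs rule: less_induct)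
  case less
  let ?meas = "\<lambda>cs. length (filter (\<lambda>c. \<forall>x. c \<noteq> PX x) cs)"
  \<comment> \<open>Here \<open>L\<close> holds each block of one endpoint exactly once;
    distinctness makes it a sub-multiset of \<open>cs\<close>. The trade changes no matrix, because
    the blocks of \<open>f x\<close> assemble to \<open>f x\<close>.\<close>
  have collapse: ?case
    if L: "set L \<subseteq> set cs" "distinct L" "L \<noteq> []" "\<And>c. c \<in> set L \<Longrightarrow> \<forall>x. c \<noteq> PX x" and x: "x \<in> {0..1}"
      and LD: "tdim L = m" "\<And>f. f \<in> A \<Longrightarrow> D L f = f x" for L x
  proof -
    have "count (mset L) c \<le> count (mset cs) c" for c
    proof (cases "c \<in> set L")
      case True
      then have "count (mset L) c = 1" using L(2) by (simp add: distinct_count_atmost_1)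
      moreover have "0 < count (mset cs) c" using L(1) True by auto
      ultimately show ?thesis by linarith
    qed (simp add: count_mset_0_iff[THEN iffD2])
    then have "mset L \<subseteq># mset cs" by (rule mset_subset_eqI)
    then obtain M where "mset cs = mset L + M" by (metis mset_subset_eq_exists_conv)
    then obtain cs' where cs': "mset cs = mset (L @ cs')" by (metis ex_mset mset_append)
    have "sim cs (L @ cs')" using cs' by (rule sim_mset)
    also have "sim (L @ cs') (PX x # cs')"
    proof (rule sim_eqI)
      show "tdim (L @ cs') = tdim (PX x # cs')" by (simp add: LD(1))
      show "D (L @ cs') f = D (PX x # cs') f" if "f \<in> A" for f
        using LD(2)[OF that] by (simp only: D_append D_Cons ev.simps)
    qed
    finally (sim_trans) have s: "sim cs (PX x # cs')" .
    have "?meas cs = ?meas (L @ cs')" using cs' by (metis mset_filter size_mset)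
    moreover have "?meas L > 0" using L(3,4) by (cases L) auto
    ultimately have "?meas (PX x # cs') < ?meas cs" by simp
    moreover have "set (PX x # cs') \<subseteq> pieces"
      using less.prems cs' x mset_eq_setD[OF cs'] by (auto simp: pieces_def)
    ultimately obtain nu om xs where "is_nf nu om xs" "sim (PX x # cs') (nf_list nu om xs)" using less.hyps by blast
    then show ?thesis using sim_trans[OF s] by blast
  qed
  show ?case
  proof (cases "P0 ` {..<length ps} \<subseteq> set cs")
    case True
    show ?thesis
    proof (rule collapse[of "map P0 [0..<length ps]" 0])
      show "tdim (map P0 [0..<length ps]) = m"
        using sums(1) by (simp add: comp_def map_nth)
      show "D (map P0 [0..<length ps]) f = f 0" if "f \<in> A" for f
        using diag_block_of_blocks[of ps "f 0"] S_algD(1,6)[OF that] sums by (simp add: comp_def)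
    qed (use True ne in \<open>auto simp: distinct_map inj_on_def\<close>)
  next
    case F0: False
    show ?thesis
    proof (cases "P1 ` {..<length qs} \<subseteq> set cs")
      case True
      show ?thesis
      proof (rule collapse[of "map P1 [0..<length qs]" 1])
        show "tdim (map P1 [0..<length qs]) = m"
          using sums(2) by (simp add: comp_def map_nth)
        show "D (map P1 [0..<length qs]) f = f 1" if "f \<in> A" for f
          using diag_block_of_blocks[of qs "f 1"] S_algD(1,7)[OF that] sums by (simp add: comp_def)
      qed (use True ne in \<open>auto simp: distinct_map inj_on_def\<close>)
    next
      case F1: False
      define nu where "nu = map (\<lambda>i. count (mset cs) (P0 i)) [0..<length ps]"
      define om where "om = map (\<lambda>i. count (mset cs) (P1 i)) [0..<length qs]"
      define xs where "xs = sort (points cs)"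
      have "mset cs = mset (nf_list nu om xs)"
      proof (rule multiset_eqI)
        fix c
        have X: "count (mset (map PX xs)) c = (case c of PX x \<Rightarrow> count (mset cs) c | _ \<Rightarrow> 0)"
        proof (cases c)
          case (PX x)
          have "count (mset (map PX ys)) (PX x) = count (mset ys) x" for ys by (induct ys) auto
          then show ?thesis using count_points[of cs x] PX by (simp add: xs_def)
        qed (auto simp: count_eq_zero_iff)
        have out: "count (mset cs) c = 0" if "c \<notin> pieces" using that less.prems by (auto simp: count_mset_0_iff)
        show "count (mset cs) c = count (mset (nf_list nu om xs)) c"
          unfolding nf_list_def mset_append count_union count_concat_replicate X
          using out by (cases c) (auto simp: nu_def om_def pieces_def sum.delta')
      qed
      then have "sim cs (nf_list nu om xs)" by (rule sim_mset)
      moreover have "is_nf nu om xs"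
      proof -
        obtain i where "i < length ps" "P0 i \<notin> set cs" using F0 by auto
        moreover obtain j where "j < length qs" "P1 j \<notin> set cs" using F1 by auto
        moreover have "set xs \<subseteq> {0..1}"
        proof
          fix x assume "x \<in> set xs"
          then have "count (mset (points cs)) x > 0" by (simp add: xs_def)
          then have "PX x \<in> set cs" by (simp add: count_points)
          then show "x \<in> {0..1}" using less.prems by (auto simp: pieces_def)
        qed
        ultimately show ?thesis
          unfolding is_nf_def by (auto simp: nu_def om_def xs_def count_mset_0_iff)
      qed
      ultimately show ?thesis by blast
    qed
  qed
qed

lemma rep_normal_form:
  assumes "is_rep n \<rho>"
  obtains nu om xs U where "is_nf nu om xs" "tdim (nf_list nu om xs) = n" "unitary_mat n U"
    "\<And>f. f \<in> A \<Longrightarrow> \<rho> f = mat_adjoint U * D (nf_list nu om xs) f * U"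
proof -
  obtain cs U where cs: "set cs \<subseteq> pieces" "tdim cs = n" and U: "unitary_mat n U"
    and \<rho>: "\<And>f. f \<in> A \<Longrightarrow> \<rho> f = mat_adjoint U * D cs f * U"
    using rep_decomposition[OF assms] by blast
  obtain nu om xs where nf: "is_nf nu om xs" and s: "sim cs (nf_list nu om xs)"
    using normal_form[OF cs(1)] by blast
  obtain P where P: "perm_matrix n P" "\<And>f. f \<in> A \<Longrightarrow> D cs f = mat_adjoint P * D (nf_list nu om xs) f * P"
    using sim_perm[OF s] cs(2) by blast
  have t: "tdim (nf_list nu om xs) = n" using s cs(2) by (simp add: sim_def)
  have "\<rho> f = mat_adjoint (P * U) * D (nf_list nu om xs) f * (P * U)" if f: "f \<in> A" for f
    using \<rho>[OF f] P(2)[OF f] conj_mult[of P n U "D (nf_list nu om xs) f"] D_carrier[OF f, of "nf_list nu om xs"] t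
      unitaryD(1)[OF U] unitaryD(1)[OF perm_matrix_unitary[OF P(1)]] by simp
  then show ?thesis using that[OF nf t unitary_mult[OF perm_matrix_unitary[OF P(1)] U]] by blast
qed

end

section \<open>Traces of normal forms\<close>

definition mat_trace :: "complex mat \<Rightarrow> complex" where
  "mat_trace M = (\<Sum>i<dim_row M. M $$ (i,i))"

lemma mat_trace_comm:
  assumes M: "M \<in> carrier_mat n k" and N: "N \<in> carrier_mat k n"
  shows "mat_trace (M * N) = mat_trace (N * M)"
proof -
  have "mat_trace (M * N) = (\<Sum>i<n. \<Sum>x<k. M $$ (i,x) * N $$ (x,i))"
    unfolding mat_trace_def using M by (auto simp: mult_index[OF M N] simp del: index_mult_mat(1) intro!: sum.cong)
  also have "\<dots> = (\<Sum>x<k. \<Sum>i<n. N $$ (x,i) * M $$ (i,x))"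
    by (subst sum.swap) (simp add: mult.commute)
  also have "\<dots> = mat_trace (N * M)"
    unfolding mat_trace_def using N by (auto simp: mult_index[OF N M] simp del: index_mult_mat(1) intro!: sum.cong)
  finally show ?thesis .
qed

lemma mat_trace_unitary_conj:
  assumes U: "unitary_mat n U" and M: "M \<in> carrier_mat n n"
  shows "mat_trace (mat_adjoint U * M * U) = mat_trace M"
proof -
  note c = unitaryD[OF U]
  have "mat_trace (mat_adjoint U * M * U) = mat_trace (U * (mat_adjoint U * M))"
    using c M by (intro mat_trace_comm[where n=n and k=n]) auto
  then show ?thesis using unitary_cancel(2)[OF U, of M] M by simp
qed

lemma mat_trace_dirsum:
  assumes "M \<in> carrier_mat n n" "N \<in> carrier_mat k k"
  shows "mat_trace (dirsum M N) = mat_trace M + mat_trace N"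
proof -
  have split: "(\<Sum>i<n + l. h i) = (\<Sum>i<n. h i) + (\<Sum>i<l. h (n + i))" for h :: "nat \<Rightarrow> complex" and l
    by (induct l) (simp_all add: add.assoc)
  show ?thesis using assms by (simp add: mat_trace_def split dirsum_index)
qed

text \<open>Counting by ramp functions: if entry k rose by \<open>e\<close>, at least n - k entries
  would contribute 1 to the sum of \<open>h1\<close>, while at the base point at most n - k - 1
  entries contribute at all. The continuous sum cannot change by 1 nearby. Falling entries are
  excluded in the same way by \<open>h2\<close>.\<close>

lemma sorted_lists_continuous:
  fixes xs :: "real \<Rightarrow> real list"
  assumes srt: "\<And>t. t \<in> S \<Longrightarrow> sorted (xs t)" and len: "\<And>t. t \<in> S \<Longrightarrow> length (xs t) = n"
    and cont: "\<And>h::real \<Rightarrow> real. continuous_on UNIV h \<Longrightarrow> continuous_on S (\<lambda>t. \<Sum>x\<leftarrow>xs t. h x)"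
    and k: "k < n"
  shows "continuous_on S (\<lambda>t. xs t ! k)"
  unfolding continuous_on_iff
proof (intro ballI allI impI)
  fix t0 and e :: real assume t0: "t0 \<in> S" and e: "0 < e"
  define c where "c = xs t0 ! k"
  \<comment> \<open>Equal to 0 up to the old value \<open>c\<close> and to 1 from
    \<open>c + e\<close> on; \<open>h2\<close> is its mirror image.\<close>
  define h1 where "h1 y = max 0 (min 1 ((y - c) / e))" for y
  define h2 where "h2 y = max 0 (min 1 ((c - y) / e))" for y
  have hc: "continuous_on UNIV h1" "continuous_on UNIV h2" unfolding h1_def h2_def using e by (intro continuous_intros; simp)+
  have sum_nth: "(\<Sum>x\<leftarrow>xs t. h x) = (\<Sum>j<n. h (xs t ! j))" if "t \<in> S" for t and h :: "real \<Rightarrow> real"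
    using len[OF that] by (simp add: sum_list_sum_nth atLeast0LessThan)
  have mono: "xs t ! i \<le> xs t ! j" if "t \<in> S" "i \<le> j" "j < n" for t i j
    using srt[OF that(1)] len[OF that(1)] that by (simp add: sorted_iff_nth_mono)
  obtain d1 where d1: "d1 > 0" "\<And>t. t \<in> S \<Longrightarrow> dist t t0 < d1 \<Longrightarrow> dist (\<Sum>x\<leftarrow>xs t. h1 x) (\<Sum>x\<leftarrow>xs t0. h1 x) < 1"
    using cont[OF hc(1), unfolded continuous_on_iff, rule_format, OF t0, of 1] by auto
  obtain d2 where d2: "d2 > 0" "\<And>t. t \<in> S \<Longrightarrow> dist t t0 < d2 \<Longrightarrow> dist (\<Sum>x\<leftarrow>xs t. h2 x) (\<Sum>x\<leftarrow>xs t0. h2 x) < 1"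
    using cont[OF hc(2), unfolded continuous_on_iff, rule_format, OF t0, of 1] by auto
  have h01: "0 \<le> h1 y" "h1 y \<le> 1" "0 \<le> h2 y" "h2 y \<le> 1" for y by (auto simp: h1_def h2_def)
  have up: "(\<Sum>x\<leftarrow>xs t0. h1 x) \<le> real (n - Suc k)"
  proof -
    have "h1 (xs t0 ! j) = 0" if "j \<le> k" for j
      using mono[OF t0 that k] e by (auto simp: h1_def c_def divide_nonpos_pos)
    then have "(\<Sum>j<n. h1 (xs t0 ! j)) = (\<Sum>j\<in>{k<..<n}. h1 (xs t0 ! j))"
      by (intro sum.mono_neutral_right) auto
    also have "\<dots> \<le> (\<Sum>j\<in>{k<..<n}. 1)" using h01 by (intro sum_mono) auto
    finally show ?thesis using sum_nth[OF t0] by simp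
  qed
  have lo: "(\<Sum>x\<leftarrow>xs t0. h2 x) \<le> real k"
  proof -
    have "h2 (xs t0 ! j) = 0" if "k \<le> j" "j < n" for j
      using mono[OF t0 that] e by (auto simp: h2_def c_def divide_nonpos_pos)
    then have "(\<Sum>j<n. h2 (xs t0 ! j)) = (\<Sum>j<k. h2 (xs t0 ! j))"
      using k by (intro sum.mono_neutral_right) auto
    also have "\<dots> \<le> (\<Sum>j<k. 1)" using h01 by (intro sum_mono) auto
    finally show ?thesis using sum_nth[OF t0] by simp
  qed
  show "\<exists>d>0. \<forall>t\<in>S. dist t t0 < d \<longrightarrow> dist (xs t ! k) (xs t0 ! k) < e"
  proof (intro exI[of _ "min d1 d2"] conjI ballI impI)
    show "0 < min d1 d2" using d1 d2 by simp
    fix t assume t: "t \<in> S" and d: "dist t t0 < min d1 d2"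
    show "dist (xs t ! k) (xs t0 ! k) < e"
    proof (rule ccontr)
      assume "\<not> ?thesis"
      then consider "xs t ! k \<ge> c + e" | "xs t ! k \<le> c - e" by (fastforce simp: c_def dist_real_def)
      then show False
      proof cases
        case 1
        have "real (n - k) = (\<Sum>j\<in>{k..<n}. 1)" by simp
        also have "\<dots> \<le> (\<Sum>j\<in>{k..<n}. h1 (xs t ! j))"
        proof (rule sum_mono)
          fix j assume "j \<in> {k..<n}"
          then have "c + e \<le> xs t ! j" using mono[OF t, of k j] 1 by auto
          then show "1 \<le> h1 (xs t ! j)" using e by (simp add: h1_def field_simps)
        qed
        also have "\<dots> \<le> (\<Sum>j<n. h1 (xs t ! j))" using h01 by (intro sum_mono2) auto
        finally have "real (n - k) \<le> (\<Sum>x\<leftarrow>xs t. h1 x)" using sum_nth[OF t] by simp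
        moreover have "real (n - k) = real (n - Suc k) + 1" using k by simp
        ultimately show False using up d1(2)[OF t] d by (simp add: dist_real_def)
      next
        case 2
        have "real (Suc k) = (\<Sum>j\<in>{..k}. 1)" by simp
        also have "\<dots> \<le> (\<Sum>j\<in>{..k}. h2 (xs t ! j))"
        proof (rule sum_mono)
          fix j assume "j \<in> {..k}"
          then have "xs t ! j \<le> c - e" using mono[OF t, of j k] 2 k by auto
          then show "1 \<le> h2 (xs t ! j)" using e by (simp add: h2_def field_simps)
        qed
        also have "\<dots> \<le> (\<Sum>j<n. h2 (xs t ! j))" using h01 k by (intro sum_mono2) auto
        finally have "real (Suc k) \<le> (\<Sum>x\<leftarrow>xs t. h2 x)" using sum_nth[OF t] by simp
        then show False using lo d2(2)[OF t] d by (simp add: dist_real_def)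
      qed
    qed
  qed
qed

lemma continuous_int_constant:
  fixes h :: "real \<Rightarrow> int"
  assumes "continuous_on {0..1} (\<lambda>t. complex_of_int (h t))" "s \<in> {0..1}" "t \<in> {0..1}"
  shows "h s = h t"
proof -
  have "(\<lambda>t. complex_of_int (h t)) constant_on {0..1}"
  proof (rule continuous_discrete_range_constant)
    fix x :: real assume "x \<in> {0..1}"
    have "1 \<le> norm (complex_of_int (h y) - complex_of_int (h x))" if "complex_of_int (h y) \<noteq> complex_of_int (h x)" for y
    proof -
      have "h y \<noteq> h x" using that by auto
      then have "1 \<le> \<bar>real_of_int (h y - h x)\<bar>" by linarith
      then show ?thesis by (simp only: of_int_diff[symmetric] norm_of_int)
    qed
    then show "\<exists>e>0. \<forall>y. y \<in> {0..1} \<and> complex_of_int (h y) \<noteq> complex_of_int (h x) \<longrightarrow> e \<le> norm (complex_of_int (h y) - complex_of_int (h x))"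
      by (intro exI[of _ 1]) auto
  qed (use assms(1) in auto)
  then have "complex_of_int (h s) = complex_of_int (h t)" using assms(2,3) unfolding constant_on_def by metis
  then show ?thesis by simp
qed

text \<open>Differences of multiplicities are constant in \<open>t\<close>, and the vanishing component then pins the multiplicities down.\<close>

lemma multiplicities_constant:
  fixes nu :: "real \<Rightarrow> nat list"
  assumes len: "\<And>t. t \<in> {0..1} \<Longrightarrow> length (nu t) = r" and zero: "\<And>t. t \<in> {0..1} \<Longrightarrow> \<exists>i<r. nu t ! i = 0"
    and diff: "\<And>i j. i < r \<Longrightarrow> j < r \<Longrightarrow> continuous_on {0..1} (\<lambda>t. of_nat (nu t ! i) - of_nat (nu t ! j) :: complex)"
    and t: "t \<in> {0..1}"
  shows "nu t = nu 0"
proof -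
  have d: "int (nu t ! i) - int (nu t ! j) = int (nu 0 ! i) - int (nu 0 ! j)" if "i < r" "j < r" for i j
    using diff[OF that] t by (intro continuous_int_constant[of "\<lambda>t. int (nu t ! i) - int (nu t ! j)"]) auto
  obtain a where a: "a < r" "nu t ! a = 0" using zero[OF t] by blast
  obtain b where b: "b < r" "nu 0 ! b = 0" using zero[of 0] by auto
  have "nu 0 ! a = 0" using d[OF a(1) b(1)] a b by linarith
  then have "nu t ! i = nu 0 ! i" if "i < r" for i using d[OF that a(1)] a(2) by linarith
  then show ?thesis using len[OF t] len[of 0] by (intro nth_equalityI) auto
qed

context splitting_data
begin

lemma mat_trace_D: "f \<in> A \<Longrightarrow> mat_trace (D cs f) = (\<Sum>c\<leftarrow>cs. mat_trace (ev c f))"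
proof (induct cs)
  case Nil
  then show ?case by (simp add: mat_trace_def)
next
  case (Cons c cs)
  then show ?case unfolding D_Cons by (subst mat_trace_dirsum[OF ev_carrier D_carrier]) auto
qed

lemma sum_list_concat_replicate:
  "(\<Sum>c\<leftarrow>concat (map (\<lambda>i. replicate (h i) (g i)) [0..<r]). T c) = (\<Sum>i<r. of_nat (h i) * (T (g i) :: complex))"
  by (induct r) (auto simp: sum_list_replicate)

lemma mat_trace_nf:
  assumes "f \<in> A"
  shows "mat_trace (D (nf_list nu om xs) f) = (\<Sum>i<length ps. of_nat (nu ! i) * mat_trace (blk ps i (f 0)))
    + (\<Sum>j<length qs. of_nat (om ! j) * mat_trace (blk qs j (f 1))) + (\<Sum>x\<leftarrow>xs. mat_trace (f x))"
proof -
  have "mat_trace (D (nf_list nu om xs) f) = (\<Sum>c\<leftarrow>nf_list nu om xs. mat_trace (ev c f))" by (rule mat_trace_D[OF assms])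
  also have "\<dots> = (\<Sum>i<length ps. of_nat (nu ! i) * mat_trace (blk ps i (f 0)))
    + (\<Sum>j<length qs. of_nat (om ! j) * mat_trace (blk qs j (f 1))) + (\<Sum>x\<leftarrow>xs. mat_trace (f x))"
    unfolding nf_list_def map_append sum_list_append sum_list_concat_replicate
    by (simp add: comp_def add.assoc)
  finally show ?thesis .
qed

lemma mat_trace_munit:
  assumes "a < m"
  shows "mat_trace (munit m c a a t) = c (clamp01 t)"
proof -
  have "mat_trace (munit m c a a t) = (\<Sum>i<m. if i = a then c (clamp01 t) else 0)"
    unfolding mat_trace_def by (auto simp: munit_index intro!: sum.cong)
  then show ?thesis using assms by simp
qed

text \<open>A unit at the first index of a block has its trace in that block alone. Evaluating
  traces on such elements therefore isolates one multiplicity.\<close>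

lemma mat_trace_blk_munit:
  assumes "sum_list rs = m" "i < length rs" "k < length rs" "0 < rs ! i"
  shows "mat_trace (blk rs k (munit m c (blk_start rs i) (blk_start rs i) t)) = (if k = i then c (clamp01 t) else 0)"
proof -
  let ?s = "blk_start rs k" and ?a = "blk_start rs i"
  have le: "?s + rs ! k \<le> m" using blk_start_le[OF assms(3)] assms(1) by simp
  have "mat_trace (blk rs k (munit m c ?a ?a t)) = (\<Sum>j<rs ! k. if ?s + j = ?a then c (clamp01 t) else 0)"
    unfolding mat_trace_def using le by (auto simp: blk_def munit_index intro!: sum.cong)
  also have "\<dots> = (if k = i then c (clamp01 t) else 0)"
  proof (cases "k = i")
    case True
    then have "(\<Sum>j<rs ! k. if ?s + j = ?a then c (clamp01 t) else 0) = (\<Sum>j<rs ! k. if j = 0 then c (clamp01 t) else 0)"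
      by (intro sum.cong) auto
    then show ?thesis using True assms(4) by simp
  next
    case False
    have "?s + j \<noteq> ?a" if "j < rs ! k" for j
    proof
      assume "?s + j = ?a"
      then have "k = i" using block_unique[of rs k ?a i] assms(2-4) that by (simp add: blk_start_Suc)
      then show False using False by simp
    qed
    then show ?thesis using False by (auto intro!: sum.neutral)
  qed
  finally show ?thesis .
qed

lemma mat_trace_blk_munit_zero:
  assumes "sum_list rs = m" "k < length rs" "c (clamp01 t) = 0"
  shows "mat_trace (blk rs k (munit m c a b t)) = 0"
proof -
  have "munit m c a b t $$ (blk_start rs k + i, blk_start rs k + i) = 0" if "i < rs ! k" for i
    using that blk_start_le[OF assms(2)] assms(1,3) by (subst munit_index) auto
  then show ?thesis by (simp add: mat_trace_def blk_def)
qed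

lemma mat_trace_scal: "mat_trace (scal m k t) = of_nat m * k (clamp01 t)"
  by (simp add: mat_trace_def scal_index)

text \<open>The chosen data carry no continuity, only the traces do. On a weighted diagonal unit the
  trace is one multiplicity plus a sum over the points that does not depend on the chosen block, so
  differences of multiplicities are continuous. The dimension then fixes the number of points, and
  traces of scalar functions control all continuous sums over the points.\<close>

lemma normal_form_family:
  fixes nu om :: "real \<Rightarrow> nat list" and xs :: "real \<Rightarrow> real list"
  assumes nf: "\<And>t. t \<in> {0..1} \<Longrightarrow> is_nf (nu t) (om t) (xs t)"
    and dim: "\<And>t. t \<in> {0..1} \<Longrightarrow> tdim (nf_list (nu t) (om t) (xs t)) = n"
    and cont: "\<And>f. f \<in> A \<Longrightarrow> continuous_on {0..1} (\<lambda>t. mat_trace (D (nf_list (nu t) (om t) (xs t)) f))"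
  shows "t \<in> {0..1} \<Longrightarrow> nu t = nu 0" "t \<in> {0..1} \<Longrightarrow> om t = om 0" "t \<in> {0..1} \<Longrightarrow> length (xs t) = length (xs 0)"
    "k < length (xs 0) \<Longrightarrow> continuous_on {0..1} (\<lambda>t. xs t ! k)"
proof -
  have start: "blk_start rs i < sum_list rs" if "i < length rs" "0 < rs ! i" for rs i
    using blk_start_le[OF that(1)] that(2) by simp
  have nuc: "nu t = nu 0" if t: "t \<in> {0..1}" for t
  proof (rule multiplicities_constant[OF _ _ _ t])
    show "\<And>t. t \<in> {0..1} \<Longrightarrow> length (nu t) = length ps" "\<And>t. t \<in> {0..1} \<Longrightarrow> \<exists>i<length ps. nu t ! i = 0"
      using nf unfolding is_nf_def by blast+
    fix i j assume i: "i < length ps" and j: "j < length ps"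
    \<comment> \<open>The weight vanishes at 1, which removes all contributions of \<open>om\<close>
      from the trace.\<close>
    let ?e = "\<lambda>i. munit m (\<lambda>t. 1 - of_real t) (blk_start ps i) (blk_start ps i)"
    have eA: "?e i \<in> A" if "i < length ps" for i
      using start[OF that ppos[OF that]] sums(1) by (intro closed) (auto intro!: continuous_intros same_block_refl)
    have tr: "mat_trace (D (nf_list (nu t) (om t) (xs t)) (?e i)) = of_nat (nu t ! i) + (\<Sum>x\<leftarrow>xs t. 1 - of_real (clamp01 x))"
      if i: "i < length ps" for i t
    proof -
      have s: "blk_start ps i < m" using start[OF i ppos[OF i]] sums by simp
      have "(\<Sum>j<length qs. of_nat (om t ! j) * mat_trace (blk qs j (?e i 1))) = 0"
        using sums(2) by (intro sum.neutral) (simp add: mat_trace_blk_munit_zero)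
      moreover have "(\<Sum>k<length ps. of_nat (nu t ! k) * mat_trace (blk ps k (?e i 0))) = (\<Sum>k<length ps. if k = i then of_nat (nu t ! k) else 0)"
        using mat_trace_blk_munit[OF sums(1) i _ ppos[OF i]] by (intro sum.cong) auto
      ultimately show ?thesis unfolding mat_trace_nf[OF eA[OF i]] using s i by (simp add: mat_trace_munit)
    qed
    have "continuous_on {0..1} (\<lambda>t. mat_trace (D (nf_list (nu t) (om t) (xs t)) (?e i)) - mat_trace (D (nf_list (nu t) (om t) (xs t)) (?e j)))"
      using cont[OF eA[OF i]] cont[OF eA[OF j]] by (rule continuous_on_diff)
    then show "continuous_on {0..1} (\<lambda>t. of_nat (nu t ! i) - of_nat (nu t ! j) :: complex)"
      by (simp add: tr i j)
  qed
  have omc: "om t = om 0" if t: "t \<in> {0..1}" for t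
  proof (rule multiplicities_constant[OF _ _ _ t])
    show "\<And>t. t \<in> {0..1} \<Longrightarrow> length (om t) = length qs" "\<And>t. t \<in> {0..1} \<Longrightarrow> \<exists>i<length qs. om t ! i = 0"
      using nf unfolding is_nf_def by blast+
    fix i j assume i: "i < length qs" and j: "j < length qs"
    let ?e = "\<lambda>i. munit m (\<lambda>t. of_real t) (blk_start qs i) (blk_start qs i)"
    have eA: "?e i \<in> A" if "i < length qs" for i
      using start[OF that qpos[OF that]] sums(2) by (intro closed) (auto intro!: continuous_intros same_block_refl)
    have tr: "mat_trace (D (nf_list (nu t) (om t) (xs t)) (?e i)) = of_nat (om t ! i) + (\<Sum>x\<leftarrow>xs t. of_real (clamp01 x))"
      if i: "i < length qs" for i t
    proof -
      have s: "blk_start qs i < m" using start[OF i qpos[OF i]] sums by simp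
      have "(\<Sum>j<length ps. of_nat (nu t ! j) * mat_trace (blk ps j (?e i 0))) = 0"
        using sums(1) by (intro sum.neutral) (simp add: mat_trace_blk_munit_zero)
      moreover have "(\<Sum>k<length qs. of_nat (om t ! k) * mat_trace (blk qs k (?e i 1))) = (\<Sum>k<length qs. if k = i then of_nat (om t ! k) else 0)"
        using mat_trace_blk_munit[OF sums(2) i _ qpos[OF i]] by (intro sum.cong) auto
      ultimately show ?thesis unfolding mat_trace_nf[OF eA[OF i]] using s i by (simp add: mat_trace_munit)
    qed
    have "continuous_on {0..1} (\<lambda>t. mat_trace (D (nf_list (nu t) (om t) (xs t)) (?e i)) - mat_trace (D (nf_list (nu t) (om t) (xs t)) (?e j)))"
      using cont[OF eA[OF i]] cont[OF eA[OF j]] by (rule continuous_on_diff)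
    then show "continuous_on {0..1} (\<lambda>t. of_nat (om t ! i) - of_nat (om t ! j) :: complex)"
      by (simp add: tr i j)
  qed
  have zero01: "(0::real) \<in> {0..1}" by simp
  have len: "length (xs t) = length (xs 0)" if t: "t \<in> {0..1}" for t
  proof -
    have "length (xs t) * m = length (xs 0) * m"
      using dim[OF t] dim[OF zero01] unfolding tdim_nf_list nuc[OF t] omc[OF t] by linarith
    then show ?thesis using m_pos by simp
  qed
  have "continuous_on {0..1} (\<lambda>t. xs t ! k)" if k: "k < length (xs 0)" for k
  proof (rule sorted_lists_continuous[OF _ len _ k])
    show "\<And>t. t \<in> {0..1} \<Longrightarrow> sorted (xs t)" using nf by (auto simp: is_nf_def)
    fix h :: "real \<Rightarrow> real" assume h: "continuous_on UNIV h"
    let ?f = "scal m (\<lambda>t. of_real (h t))"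
    have fA: "?f \<in> A" using h by (intro closed continuous_intros) (auto intro: continuous_on_subset)
    \<comment> \<open>The contribution of the endpoint blocks, independent of \<open>t\<close> once
      the multiplicities are known to be constant.\<close>
    define K where "K = (\<Sum>i<length ps. of_nat (nu 0 ! i) * mat_trace (blk ps i (?f 0)))
      + (\<Sum>j<length qs. of_nat (om 0 ! j) * mat_trace (blk qs j (?f 1)))"
    have "(\<Sum>x\<leftarrow>xs t. h x) = Re ((mat_trace (D (nf_list (nu t) (om t) (xs t)) ?f) - K) / of_nat m)" if t: "t \<in> {0..1}" for t
    proof -
      have "mat_trace (D (nf_list (nu t) (om t) (xs t)) ?f) - K = (\<Sum>x\<leftarrow>xs t. of_nat m * of_real (h (clamp01 x)))"
        unfolding mat_trace_nf[OF fA] K_def nuc[OF t] omc[OF t] by (simp add: mat_trace_scal)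
      also have "\<dots> = (\<Sum>x\<leftarrow>xs t. of_nat m * of_real (h x))"
        using nf[OF t] by (intro arg_cong[of _ _ sum_list] map_cong) (auto simp: is_nf_def)
      also have "(\<Sum>x\<leftarrow>ys. of_nat m * of_real (h x)) = of_nat m * complex_of_real (\<Sum>x\<leftarrow>ys. h x)" for ys
        by (induct ys) (auto simp: algebra_simps)
      finally show ?thesis using m_pos by simp
    qed
    moreover have "continuous_on {0..1} (\<lambda>t. Re ((mat_trace (D (nf_list (nu t) (om t) (xs t)) ?f) - K) / of_nat m))"
      using m_pos by (intro continuous_intros cont fA) auto
    ultimately show "continuous_on {0..1} (\<lambda>t. \<Sum>x\<leftarrow>xs t. h x)" by (subst continuous_on_cong) auto
  qed
  note xsc = this
  show "t \<in> {0..1} \<Longrightarrow> nu t = nu 0" by (rule nuc)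
  show "t \<in> {0..1} \<Longrightarrow> om t = om 0" by (rule omc)
  show "t \<in> {0..1} \<Longrightarrow> length (xs t) = length (xs 0)" by (rule len)
  show "k < length (xs 0) \<Longrightarrow> continuous_on {0..1} (\<lambda>t. xs t ! k)" by (rule xsc)
qed

end

section \<open>Paths of unitaries\<close>

text \<open>The estimates use the maximum of the entries. A product of two matrices then costs a
  factor n, and the operator norm is recovered at the very end.\<close>

definition entry_bounded :: "nat \<Rightarrow> real \<Rightarrow> complex mat \<Rightarrow> bool" where
  "entry_bounded n e A \<longleftrightarrow> (\<forall>i<n. \<forall>j<n. cmod (A $$ (i,j)) \<le> e)"

lemma entry_bounded_mult:
  assumes A: "A \<in> carrier_mat n n" "entry_bounded n a A" and B: "B \<in> carrier_mat n n" "entry_bounded n b B" and a: "0 \<le> a"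
  shows "entry_bounded n (real n * (a * b)) (A * B)"
  unfolding entry_bounded_def
proof (intro allI impI)
  fix i j assume ij: "i < n" "j < n"
  have "cmod ((A * B) $$ (i,j)) = cmod (\<Sum>x<n. A $$ (i,x) * B $$ (x,j))"
    by (simp only: mult_index[OF A(1) B(1) ij])
  also have "\<dots> \<le> (\<Sum>x<n. a * b)"
    using A(2) B(2) ij a unfolding entry_bounded_def
    by (intro sum_norm_le) (auto simp: norm_mult intro!: mult_mono)
  finally show "cmod ((A * B) $$ (i,j)) \<le> real n * (a * b)" by simp
qed

lemma entry_bounded_mono: "entry_bounded n a A \<Longrightarrow> a \<le> b \<Longrightarrow> entry_bounded n b A"
  unfolding entry_bounded_def by (meson order_trans)

lemma entry_bounded_unitary:
  assumes U: "unitary_mat n U"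
  shows "entry_bounded n 1 U"
  unfolding entry_bounded_def
proof (intro allI impI)
  fix i j assume ij: "i < n" "j < n"
  note c = unitaryD[OF U]
  have "(mat_adjoint U * U) $$ (j,j) = 1" using c ij by simp
  then have "1 = (\<Sum>x<n. mat_adjoint U $$ (j,x) * U $$ (x,j))"
    by (simp only: mult_index[OF c(2,1) ij(2,2)])
  also have "\<dots> = complex_of_real (\<Sum>x<n. (cmod (U $$ (x,j)))\<^sup>2)"
    using ij c(1) unfolding of_real_sum
    by (intro sum.cong) (auto simp: complex_norm_square mult.commute simp del: of_real_power)
  finally have "(\<Sum>x<n. (cmod (U $$ (x,j)))\<^sup>2) = 1" by (metis of_real_1 of_real_eq_iff)
  moreover have "(cmod (U $$ (i,j)))\<^sup>2 \<le> (\<Sum>x<n. (cmod (U $$ (x,j)))\<^sup>2)"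
    using ij by (intro member_le_sum) auto
  ultimately have "(cmod (U $$ (i,j)))\<^sup>2 \<le> 1\<^sup>2" by simp
  then show "cmod (U $$ (i,j)) \<le> 1" by (rule power2_le_imp_le) simp
qed

section \<open>Spectral theorem and functional calculus for one unitary matrix\<close>

definition diag_of :: "complex list \<Rightarrow> complex mat" where
  "diag_of cs = mat (length cs) (length cs) (\<lambda>(i,j). if i = j then cs ! i else 0)"

lemma diag_of_carrier [simp]: "diag_of cs \<in> carrier_mat (length cs) (length cs)"
  "dim_row (diag_of cs) = length cs" "dim_col (diag_of cs) = length cs"
  by (simp_all add: diag_of_def)

lemma diag_of_index: "i < length cs \<Longrightarrow> j < length cs \<Longrightarrow> diag_of cs $$ (i,j) = (if i = j then cs ! i else 0)"
  by (simp add: diag_of_def)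

lemma diag_of_diag_block: "diag_block_mat (map (\<lambda>c. mat 1 1 (\<lambda>_. c)) cs) = diag_of cs"
proof (induct cs)
  case Nil
  show ?case by (rule eq_matI) auto
next
  case (Cons c cs)
  have "dirsum (mat 1 1 (\<lambda>_. c)) (diag_of cs) = diag_of (c # cs)"
    by (rule eq_matI) (auto simp: dirsum_index diag_of_index nth_Cons')
  then show ?case using Cons by (simp add: diag_block_mat_Cons del: diag_block_mat.simps(2))
qed

lemma mult_diag_of_index:
  assumes "M \<in> carrier_mat n n" "length cs = n" "i < n" "j < n"
  shows "(M * diag_of cs) $$ (i,j) = M $$ (i,j) * cs ! j" "(diag_of cs * M) $$ (i,j) = cs ! i * M $$ (i,j)"
proof -
  have d: "diag_of cs \<in> carrier_mat n n" using assms by auto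
  have "(M * diag_of cs) $$ (i,j) = (\<Sum>x<n. M $$ (i,x) * diag_of cs $$ (x,j))" by (rule mult_index[OF assms(1) d assms(3,4)])
  also have "\<dots> = (\<Sum>x<n. if x = j then M $$ (i,j) * cs ! j else 0)"
    using assms by (intro sum.cong) (auto simp: diag_of_index)
  finally show "(M * diag_of cs) $$ (i,j) = M $$ (i,j) * cs ! j" using assms by simp
  have "(diag_of cs * M) $$ (i,j) = (\<Sum>x<n. diag_of cs $$ (i,x) * M $$ (x,j))" by (rule mult_index[OF d assms(1,3,4)])
  also have "\<dots> = (\<Sum>x<n. if x = i then cs ! i * M $$ (i,j) else 0)"
    using assms by (intro sum.cong) (auto simp: diag_of_index)
  finally show "(diag_of cs * M) $$ (i,j) = cs ! i * M $$ (i,j)" using assms by simp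
qed

lemma normsq_smult:
  assumes "v \<in> carrier_mat n 1"
  shows "normsq (c \<cdot>\<^sub>m v) = (cmod c)\<^sup>2 * normsq v"
  using assms by (auto simp: normsq_def sum_distrib_left norm_mult power_mult_distrib intro!: sum.cong)

text \<open>An instance of the greedy splitting over the one-element type \<open>unit\<close>: the
  pieces are scalars of modulus 1. An eigenvector of a unitary is also an eigenvector of its
  adjoint, with the conjugate eigenvalue, so its span is reducing.\<close>

lemma unitary_diagonalization:
  assumes "unitary_mat n Z"
  obtains cs U where "length cs = n" "\<And>c. c \<in> set cs \<Longrightarrow> cmod c = 1" "unitary_mat n U"
    "Z = mat_adjoint U * diag_of cs * U"
proof -
  have "\<exists>cs U. set cs \<subseteq> {c. cmod c = 1} \<and> sum_list (map (\<lambda>_. 1) cs) = n \<and> unitary_mat n U \<and>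
     (\<forall>f\<in>(UNIV :: unit set). Z = mat_adjoint U * diag_block_mat (map (\<lambda>c. mat 1 1 (\<lambda>_. c)) cs) * U)"
  proof (rule orthogonal_decomposition[where Rep = "\<lambda>n \<rho>. unitary_mat n (\<rho> ())" and F = "UNIV :: unit set"
        and C = "{c. cmod c = 1}" and r = "\<lambda>c _. mat 1 1 (\<lambda>_. c)" and d = "\<lambda>_. 1" and \<rho> = "\<lambda>_. Z"])
    show "unitary_mat n Z" by fact
  next
    fix n and \<rho> :: "unit \<Rightarrow> complex mat" assume U: "unitary_mat n (\<rho> ())" and n: "0 < n"
    let ?Z = "\<rho> ()"
    note c = unitaryD[OF U]
    obtain x v where v: "v \<in> carrier_mat n 1" "v \<noteq> 0\<^sub>m n 1" and ev: "?Z * v = x \<cdot>\<^sub>m v"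
      using eigenvector_column[OF c(1) n] by blast
    have p: "normsq v > 0" by (rule normsq_pos[OF v])
    have Zv: "mat_adjoint ?Z * (?Z * v) = v" using unitary_cancel(1)[OF U] v by simp
    have "normsq (x \<cdot>\<^sub>m v) = (cmod x)\<^sup>2 * normsq v" by (rule normsq_smult[OF v(1)])
    moreover have "complex_of_real (normsq (x \<cdot>\<^sub>m v)) = ip (?Z * v) (?Z * v)"
      using ip_self[of "x \<cdot>\<^sub>m v" n] v(1) ev by simp
    moreover have "ip (?Z * v) (?Z * v) = ip v v"
    proof -
      have "ip (mat_adjoint (mat_adjoint ?Z) * v) (?Z * v) = ip v (mat_adjoint ?Z * (?Z * v))"
        using c v by (intro ip_adj[symmetric, of _ n _ n]) (auto simp: ev)
      then show ?thesis using Zv by simp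
    qed
    ultimately have "(cmod x)\<^sup>2 * normsq v = normsq v" using ip_self[OF v(1)] by (metis of_real_eq_iff)
    then have x: "cmod x = 1" using p by (simp add: power2_eq_1_iff) (use norm_ge_zero[of x] in linarith)
    have xx: "cnj x * x = 1" using x complex_norm_square[of x] by (simp add: mult.commute)
    define T where "T = complex_of_real (1 / sqrt (normsq v)) \<cdot>\<^sub>m v"
    have T: "T \<in> carrier_mat n 1" using v by (simp add: T_def)
    have "mat_adjoint T * T = 1\<^sub>m 1"
    proof (rule eq_matI)
      fix i j assume "i < dim_row (1\<^sub>m 1 :: complex mat)" "j < dim_col (1\<^sub>m 1 :: complex mat)"
      then have ij: "i = 0" "j = 0" by auto
      have "(mat_adjoint T * T) $$ (0,0) = of_real (normsq T)" by (rule normsq_eq[OF T])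
      also have "normsq T = (1 / sqrt (normsq v))\<^sup>2 * normsq v"
        using p by (simp add: T_def normsq_smult[OF v(1)] norm_divide)
      also have "\<dots> = 1" using p by (simp add: power_divide)
      finally show "(mat_adjoint T * T) $$ (i,j) = 1\<^sub>m 1 $$ (i,j)" by (simp add: ij)
    qed (use T in auto)
    moreover have sc: "T * mat 1 1 (\<lambda>_. y) = y \<cdot>\<^sub>m T" for y
      using T by (intro eq_matI) (auto simp: scalar_prod_def)
    moreover have ZT: "?Z * T = x \<cdot>\<^sub>m T"
      using mult_smult_distrib[OF c(1) v(1)] v(1) by (auto simp: T_def ev intro!: eq_matI)
    moreover have "mat_adjoint ?Z * T = cnj x \<cdot>\<^sub>m T"
    proof -
      have "T = mat_adjoint ?Z * (x \<cdot>\<^sub>m T)" using unitary_cancel(1)[OF U, of T] T ZT by simp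
      then have e: "T = x \<cdot>\<^sub>m (mat_adjoint ?Z * T)" using mult_smult_distrib[OF c(2) T] by simp
      have "cnj x \<cdot>\<^sub>m T = cnj x \<cdot>\<^sub>m (x \<cdot>\<^sub>m (mat_adjoint ?Z * T))" using e by simp
      also have "\<dots> = mat_adjoint ?Z * T"
        using xx by (intro eq_matI) (simp_all add: mult.assoc[symmetric] del: index_mult_mat(1))
      finally show ?thesis by simp
    qed
    moreover have "mat_adjoint (mat 1 1 (\<lambda>_. x)) = mat 1 1 (\<lambda>_. cnj x)" by (rule eq_matI) auto
    ultimately show "\<exists>c\<in>{c. cmod c = 1}. \<exists>T. T \<in> carrier_mat n 1 \<and> mat_adjoint T * T = 1\<^sub>m 1 \<and>
      (\<forall>f\<in>UNIV. \<rho> f * T = T * mat 1 1 (\<lambda>_. c) \<and> mat_adjoint (\<rho> f) * T = T * mat_adjoint (mat 1 1 (\<lambda>_. c)))"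
      using x T by (intro bexI[of _ x] exI[of _ T]) (simp_all add: unit_eq)
  next
    fix p k and \<rho> B E :: "unit \<Rightarrow> complex mat" and V
    assume \<rho>: "unitary_mat (p + k) (\<rho> ())" and V: "unitary_mat (p + k) V"
      and dec: "\<And>f. f \<in> UNIV \<Longrightarrow> B f \<in> carrier_mat p p \<and> E f \<in> carrier_mat k k \<and> \<rho> f = V * dirsum (B f) (E f) * mat_adjoint V"
    have c: "B () \<in> carrier_mat p p" "E () \<in> carrier_mat k k" using dec by auto
    have "dirsum (B ()) (E ()) = mat_adjoint V * \<rho> () * V"
      using conj_unitary_inv(2)[OF V, of "dirsum (B ()) (E ())"] dec[of "()"] by simp
    then have "unitary_mat (p + k) (dirsum (B ()) (E ()))"
      using \<rho> V unitary_mult unitary_adj by metis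
    then have "mat_adjoint (dirsum (B ()) (E ())) * dirsum (B ()) (E ()) = 1\<^sub>m (p + k)" by (rule unitaryD)
    then have "dirsum (mat_adjoint (B ()) * B ()) (mat_adjoint (E ()) * E ()) = dirsum (1\<^sub>m p) (1\<^sub>m k)"
      using c by (simp add: dirsum_adj dirsum_mult dirsum_one)
    then have "mat_adjoint (E ()) * E () = 1\<^sub>m k"
      by (rule dirsum_right_inj) (use c in auto)
    then show "unitary_mat k (E ())" using c by (intro unitaryI)
  qed (auto dest: unitaryD)
  from this[unfolded diag_of_diag_block] obtain cs U where "set cs \<subseteq> {c. cmod c = 1}"
    "sum_list (map (\<lambda>_. 1) cs) = n" "unitary_mat n U" "Z = mat_adjoint U * diag_of cs * U" by blast
  then show ?thesis using that[of cs U] by (auto simp: sum_list_triv)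
qed

text \<open>The squared chord from 1 to the point of angle a is 2 - 2 cos a, which increases with
  the absolute value of a up to pi. Shrinking the principal angle therefore cannot increase the
  distance to 1.\<close>

lemma cis_Arg_bound:
  assumes c: "cmod c = 1" and s: "0 \<le> s" "s \<le> 1"
  shows "cmod (cis (s * Arg c) - 1) \<le> cmod (c - 1)"
proof -
  have sq: "(cmod (cis a - 1))\<^sup>2 = 2 - 2 * cos a" for a
  proof -
    have "(cmod (cis a - 1))\<^sup>2 = (cos a - 1)\<^sup>2 + (sin a)\<^sup>2" by (simp add: cmod_power2)
    also have "\<dots> = (cos a)\<^sup>2 + (sin a)\<^sup>2 + 1 - 2 * cos a" by (simp add: power2_diff)
    finally show ?thesis by simp
  qed
  have "c = cis (Arg c)" using c cis_Arg[of c] by (cases "c = 0") (auto simp: sgn_eq)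
  then have "(cmod (c - 1))\<^sup>2 = 2 - 2 * cos \<bar>Arg c\<bar>" using sq[of "Arg c"] by simp
  moreover have "(cmod (cis (s * Arg c) - 1))\<^sup>2 = 2 - 2 * cos (s * \<bar>Arg c\<bar>)"
    using sq[of "s * Arg c"] cos_abs_real[of "s * Arg c"] s by (simp add: abs_mult)
  moreover have "cos \<bar>Arg c\<bar> \<le> cos (s * \<bar>Arg c\<bar>)"
  proof (rule cos_monotone_0_pi_le)
    show "s * \<bar>Arg c\<bar> \<le> \<bar>Arg c\<bar>" using s mult_right_mono[of s 1 "\<bar>Arg c\<bar>"] by simp
    show "\<bar>Arg c\<bar> \<le> pi" using Arg_bounded[of c] by linarith
  qed (use s in simp)
  ultimately have "(cmod (cis (s * Arg c) - 1))\<^sup>2 \<le> (cmod (c - 1))\<^sup>2" by linarith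
  then show ?thesis by (rule power2_le_imp_le) simp
qed

lemma conj_minus_one:
  assumes U: "unitary_mat n U" and B: "B \<in> carrier_mat n n"
  shows "mat_adjoint U * (B - 1\<^sub>m n) * U = mat_adjoint U * B * U - 1\<^sub>m n"
proof -
  note c = unitaryD[OF U]
  have "mat_adjoint U * (B - 1\<^sub>m n) = mat_adjoint U * B - mat_adjoint U"
    using mult_minus_distrib_mat[OF c(2) B one_carrier_mat] c by simp
  then have "mat_adjoint U * (B - 1\<^sub>m n) * U = (mat_adjoint U * B - mat_adjoint U) * U" by simp
  also have "\<dots> = mat_adjoint U * B * U - mat_adjoint U * U"
    by (rule minus_mult_distrib_mat[OF mult_carrier_mat[OF c(2) B] c(2) c(1)])
  finally show ?thesis using c by simp
qed

text \<open>The fourth line lets short connections stay near their start; the last one keeps the arc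
  among the unitaries that conjugate \<open>M\<close> into \<open>N\<close> whenever both ends do.
  The latter makes the fibres of intertwiners path connected.\<close>

definition unitary_arc :: "nat \<Rightarrow> complex mat \<Rightarrow> complex mat \<Rightarrow> (real \<Rightarrow> complex mat) \<Rightarrow> bool" where
  "unitary_arc n X Y \<gamma> \<longleftrightarrow> (\<forall>s. unitary_mat n (\<gamma> s)) \<and> (\<forall>i<n. \<forall>j<n. continuous_on UNIV (\<lambda>s. \<gamma> s $$ (i,j)))
     \<and> \<gamma> 0 = X \<and> \<gamma> 1 = Y
     \<and> (\<forall>s e. 0 \<le> s \<longrightarrow> s \<le> 1 \<longrightarrow> 0 \<le> e \<longrightarrow> entry_bounded n e (Y - X) \<longrightarrow> entry_bounded n (real n ^ 6 * e) (\<gamma> s - X))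
     \<and> (\<forall>s M N. M \<in> carrier_mat n n \<longrightarrow> mat_adjoint X * M * X = N \<longrightarrow> mat_adjoint Y * M * Y = N \<longrightarrow>
       mat_adjoint (\<gamma> s) * M * \<gamma> s = N)"

text \<open>Functional calculus: \<open>Z = Y X\<^sup>*\<close> is joined to 1 by \<open>Z\<^sup>s\<close>, which commutes with everything commuting with \<open>Z\<close>.\<close>

lemma unitary_path:
  assumes X: "unitary_mat n X" and Y: "unitary_mat n Y"
  obtains \<gamma> where "unitary_arc n X Y \<gamma>"
proof -
  note Xc = unitaryD[OF X] and Yc = unitaryD[OF Y]
  define Z where "Z = Y * mat_adjoint X"
  have Z: "unitary_mat n Z" unfolding Z_def using X Y by (intro unitary_mult unitary_adj)
  obtain cs U where cs: "length cs = n" "\<And>c. c \<in> set cs \<Longrightarrow> cmod c = 1" and U: "unitary_mat n U"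
    and ZU: "Z = mat_adjoint U * diag_of cs * U"
    using unitary_diagonalization[OF Z] by blast
  note Uc = unitaryD[OF U]
  define G where "G s = diag_of (map (\<lambda>c. cis (s * Arg c)) cs)" for s
  have Gc: "G s \<in> carrier_mat n n" for s using cs(1) diag_of_carrier(1)[of "map (\<lambda>c. cis (s * Arg c)) cs"] by (simp add: G_def)
  have Gi: "G s $$ (i,j) = (if i = j then cis (s * Arg (cs ! i)) else 0)" if "i < n" "j < n" for s i j
    using that cs(1) by (simp add: G_def diag_of_index)
  have Gu: "unitary_mat n (G s)" for s
  proof (rule unitaryI[OF Gc])
    show "mat_adjoint (G s) * G s = 1\<^sub>m n"
    proof (rule eq_matI)
      fix i j assume "i < dim_row (1\<^sub>m n :: complex mat)" "j < dim_col (1\<^sub>m n :: complex mat)"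
      then have ij: "i < n" "j < n" by auto
      have "(mat_adjoint (G s) * G s) $$ (i,j) = mat_adjoint (G s) $$ (i,j) * cis (s * Arg (cs ! j))"
        using mult_diag_of_index(1)[OF adj_carrier[OF Gc[of s]], of "map (\<lambda>c. cis (s * Arg c)) cs" i j] ij cs(1)
        by (simp add: G_def del: index_mult_mat adj_index)
      also have "\<dots> = (if i = j then 1 else 0)"
        using ij Gc[of s] Gi[of j i s] by (auto simp: cis_cnj cis_mult)
      finally show "(mat_adjoint (G s) * G s) $$ (i,j) = 1\<^sub>m n $$ (i,j)" using ij by simp
    qed (use Gc[of s] in auto)
  qed
  define Zs where "Zs s = mat_adjoint U * G s * U" for s
  have Zu: "unitary_mat n (Zs s)" for s
    unfolding Zs_def using U Gu[of s] by (intro unitary_mult unitary_adj)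
  note Zc = unitaryD[OF Zu]
  define \<gamma> where "\<gamma> s = Zs s * X" for s
  have \<gamma>u: "unitary_mat n (\<gamma> s)" for s unfolding \<gamma>_def using Zu X by (rule unitary_mult)
  have cont: "continuous_on UNIV (\<lambda>s. \<gamma> s $$ (i,j))" if ij: "i < n" "j < n" for i j
  proof -
    have "continuous_on UNIV (\<lambda>s. G s $$ (x,y))" if "x < n" "y < n" for x y
      unfolding Gi[OF that] by (cases "x = y") (auto intro!: continuous_intros)
    then have "continuous_on UNIV (\<lambda>s. (mat_adjoint U * G s) $$ (x,y))" if "x < n" "y < n" for x y
      unfolding mult_index[OF Uc(2) Gc that] using that by (intro continuous_intros) auto
    then have "continuous_on UNIV (\<lambda>s. Zs s $$ (x,y))" if "x < n" "y < n" for x y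
      unfolding Zs_def mult_index[OF mult_carrier_mat[OF Uc(2) Gc] Uc(1) that] using that by (intro continuous_intros) auto
    then show ?thesis
      unfolding \<gamma>_def mult_index[OF Zc(1) Xc(1) ij] using ij by (intro continuous_intros) auto
  qed
  have g0: "\<gamma> 0 = X"
  proof -
    have "G 0 = 1\<^sub>m n" using Gc[of 0] by (intro eq_matI) (auto simp: Gi)
    then show ?thesis using Uc Xc by (simp add: \<gamma>_def Zs_def)
  qed
  have g1: "\<gamma> 1 = Y"
  proof -
    have "cis (Arg (cs ! i)) = cs ! i" if "i < n" for i
    proof -
      have "cmod (cs ! i) = 1" using cs that by simp
      then show ?thesis using cis_Arg[of "cs ! i"] by (cases "cs ! i = 0") (auto simp: sgn_eq)
    qed
    then have "G 1 = diag_of cs" using Gc[of 1] cs(1) by (intro eq_matI) (auto simp: Gi diag_of_index)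
    then have "\<gamma> 1 = Z * X" by (simp add: \<gamma>_def Zs_def ZU)
    then show ?thesis unfolding Z_def using unitary_cancel_right(1)[OF X] Yc by simp
  qed
  \<comment> \<open>The sixth power counts matrix products: one from \<open>Y - X\<close> to
    \<open>Z - 1\<^sub>m n\<close>, two for passing to the eigenbasis, two for returning, and one
    for multiplying by \<open>X\<close>.\<close>
  have bd: "entry_bounded n (real n ^ 6 * e) (\<gamma> s - X)" if s: "0 \<le> s" "s \<le> 1" and e: "0 \<le> e" "entry_bounded n e (Y - X)" for s e
  proof -
    let ?n = "real n"
    have "(Y - X) * mat_adjoint X = Z - 1\<^sub>m n"
      unfolding Z_def using minus_mult_distrib_mat[OF Yc(1) Xc(1) Xc(2)] Xc(4) by simp
    then have 1: "entry_bounded n (?n * (e * 1)) (Z - 1\<^sub>m n)"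
      using entry_bounded_mult[OF minus_carrier_mat[OF Xc(1)] e(2) Xc(2) entry_bounded_unitary[OF unitary_adj[OF X]] e(1)] by simp
    have dZ: "diag_of cs = U * Z * mat_adjoint U"
      using conj_unitary_inv(1)[OF U, of "diag_of cs"] cs(1) diag_of_carrier(1)[of cs] by (simp add: ZU)
    have "U * (Z - 1\<^sub>m n) * mat_adjoint U = diag_of cs - 1\<^sub>m n"
      using conj_minus_one[OF unitary_adj[OF U], of Z] unitaryD(1)[OF Z] by (simp add: dZ)
    moreover have Z1: "Z - 1\<^sub>m n \<in> carrier_mat n n" using unitaryD(1)[OF Z] by auto
    moreover have "entry_bounded n (?n * (1 * (?n * (e * 1)))) (U * (Z - 1\<^sub>m n))"
      by (rule entry_bounded_mult[OF Uc(1) entry_bounded_unitary[OF U] Z1 1]) simp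
    ultimately have 2: "entry_bounded n (?n * (?n * (1 * (?n * (e * 1))) * 1)) (diag_of cs - 1\<^sub>m n)"
      using entry_bounded_mult[OF mult_carrier_mat[OF Uc(1) Z1] _ Uc(2) entry_bounded_unitary[OF unitary_adj[OF U]]] e(1) by fastforce
    have "entry_bounded n (?n ^ 3 * e) (G s - 1\<^sub>m n)"
      unfolding entry_bounded_def
    proof (intro allI impI)
      fix i j assume ij: "i < n" "j < n"
      show "cmod ((G s - 1\<^sub>m n) $$ (i,j)) \<le> ?n ^ 3 * e"
      proof (cases "i = j")
        case True
        have "cmod ((diag_of cs - 1\<^sub>m n) $$ (i,i)) \<le> ?n * (?n * (1 * (?n * (e * 1))) * 1)"
          using 2 ij unfolding entry_bounded_def by blast
        then have "cmod (cs ! i - 1) \<le> ?n ^ 3 * e" using ij cs(1) by (simp add: diag_of_index power3_eq_cube mult_ac)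
        moreover have "cmod (cis (s * Arg (cs ! i)) - 1) \<le> cmod (cs ! i - 1)"
          using cs ij s by (intro cis_Arg_bound) auto
        ultimately show ?thesis using ij True Gc[of s] by (simp add: Gi)
      qed (use ij Gc[of s] e(1) in \<open>simp add: Gi\<close>)
    qed
    note 3 = this
    have G1: "G s - 1\<^sub>m n \<in> carrier_mat n n" using Gc by auto
    have 4: "entry_bounded n (?n * (1 * (?n ^ 3 * e))) (mat_adjoint U * (G s - 1\<^sub>m n))"
      by (rule entry_bounded_mult[OF Uc(2) entry_bounded_unitary[OF unitary_adj[OF U]] G1 3]) simp
    have "entry_bounded n (?n * (?n * (1 * (?n ^ 3 * e)) * 1)) (mat_adjoint U * (G s - 1\<^sub>m n) * U)"
      by (rule entry_bounded_mult[OF mult_carrier_mat[OF Uc(2) G1] 4 Uc(1) entry_bounded_unitary[OF U]]) (use e in simp)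
    then have 5: "entry_bounded n (?n * (?n * (1 * (?n ^ 3 * e)) * 1)) (Zs s - 1\<^sub>m n)"
      unfolding Zs_def using conj_minus_one[OF U Gc] by simp
    have Z2: "Zs s - 1\<^sub>m n \<in> carrier_mat n n" using Zc by auto
    have "entry_bounded n (?n * (?n * (?n * (1 * (?n ^ 3 * e)) * 1) * 1)) ((Zs s - 1\<^sub>m n) * X)"
      by (rule entry_bounded_mult[OF Z2 5 Xc(1) entry_bounded_unitary[OF X]]) (use e in simp)
    moreover have "(Zs s - 1\<^sub>m n) * X = \<gamma> s - X"
      unfolding \<gamma>_def using minus_mult_distrib_mat[OF Zc(1) one_carrier_mat Xc(1)] Xc(1) by simp
    moreover have "?n * (?n * (?n * (1 * (?n ^ 3 * e)) * 1) * 1) = ?n ^ 6 * e"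
      by (simp add: power_def eval_nat_numeral mult_ac)
    ultimately show ?thesis by metis
  qed
  have inter: "mat_adjoint (\<gamma> s) * M * \<gamma> s = N"
    if M: "M \<in> carrier_mat n n" and XN: "mat_adjoint X * M * X = N" and YN: "mat_adjoint Y * M * Y = N" for s M N
  proof -
    have "M = X * N * mat_adjoint X" using conj_unitary_inv(1)[OF X M] XN by simp
    then have "M = X * (mat_adjoint Y * M * Y) * mat_adjoint X" using YN by simp
    \<comment> \<open>Two intertwiners of the same pair differ by a unitary commuting with
      \<open>M\<close>.\<close>
    then have ZMZ: "M = mat_adjoint Z * M * Z"
      unfolding Z_def using M Xc(1) Yc(1) by (simp add: mat_assoc adj_mult_dim)
    then have "Z * M = Z * (mat_adjoint Z * M * Z)" by simp
    also have "\<dots> = M * Z"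
      using M unitaryD(1)[OF Z] by (simp add: mat_assoc unitary_cancel[OF Z])
    finally have ZM: "Z * M = M * Z" .
    define M' where "M' = U * M * mat_adjoint U"
    have M': "M' \<in> carrier_mat n n" using Uc(1) M by (intro carrier_matI) (simp_all add: M'_def)
    have MM: "M = mat_adjoint U * M' * U" unfolding M'_def using conj_unitary_inv(2)[OF U M] by simp
    have dc: "diag_of cs \<in> carrier_mat n n" using cs(1) diag_of_carrier(1)[of cs] by simp
    have "diag_of cs * M' = U * (Z * M) * mat_adjoint U"
      unfolding ZU MM using cs(1) M' Uc(1) by (simp add: mat_assoc unitary_cancel[OF U] Uc(4))
    also have "\<dots> = M' * diag_of cs"
      unfolding ZM unfolding ZU MM using cs(1) M' Uc(1) by (simp add: mat_assoc unitary_cancel[OF U] Uc(4))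
    finally have comm: "diag_of cs * M' = M' * diag_of cs" .
    \<comment> \<open>In the eigenbasis, \<open>M'\<close> has no entries between different
      eigenvalues, and the entries of \<open>G s\<close> depend on the eigenvalue only.\<close>
    have "G s * M' = M' * G s"
    proof (rule eq_matI)
      fix i j assume "i < dim_row (M' * G s)" "j < dim_col (M' * G s)"
      then have ij: "i < n" "j < n" using M' Gc[of s] by auto
      have "cs ! i * M' $$ (i,j) = M' $$ (i,j) * cs ! j"
        using mult_diag_of_index[OF M' cs(1) ij] unfolding comm by metis
      then have "cs ! i = cs ! j \<or> M' $$ (i,j) = 0" by (auto simp: mult.commute)
      then show "(G s * M') $$ (i,j) = (M' * G s) $$ (i,j)"
        using mult_diag_of_index[OF M' _ ij, of "map (\<lambda>c. cis (s * Arg c)) cs"] cs(1) ij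
        by (auto simp: G_def simp del: index_mult_mat)
    qed (use M' Gc[of s] in auto)
    moreover have "Zs s * M = mat_adjoint U * (G s * M') * U" "M * Zs s = mat_adjoint U * (M' * G s) * U"
      unfolding Zs_def MM using M' Gc[of s] Uc(1) by (simp_all add: mat_assoc unitary_cancel[OF U])
    ultimately have "Zs s * M = M * Zs s" by simp
    then have "mat_adjoint (Zs s) * M * Zs s = mat_adjoint (Zs s) * (Zs s * M)"
      using M Zc(1)[of s] by (simp add: mat_assoc)
    also have "\<dots> = M" using unitary_cancel(1)[OF Zu] M by simp
    finally have "mat_adjoint X * (mat_adjoint (Zs s) * M * Zs s) * X = N" using XN by simp
    then show ?thesis unfolding \<gamma>_def using conj_mult[OF Zc(1) Xc(1) M] by simp
  qed
  have "unitary_arc n X Y \<gamma>"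
    unfolding unitary_arc_def using \<gamma>u cont g0 g1 bd inter by blast
  then show ?thesis by (rule that)
qed

section \<open>Selecting intertwiners continuously\<close>

text \<open>Bolzano-Weierstrass for finitely many coordinates, refining the subsequence once per
  coordinate; it expresses sequential compactness of a bounded set of matrices entry by
  entry.\<close>

lemma finite_convergent_subsequence:
  fixes w :: "nat \<Rightarrow> 'a \<Rightarrow> complex"
  assumes "finite S" "\<And>k x. x \<in> S \<Longrightarrow> cmod (w k x) \<le> B"
  shows "\<exists>r l. strict_mono r \<and> (\<forall>x\<in>S. (\<lambda>k. w (r k) x) \<longlonglongrightarrow> l x)"
  using assms
proof (induct S)
  case empty
  show ?case by (intro exI[of _ id]) (auto simp: strict_mono_def)
next
  case (insert x S)
  then obtain r l where r: "strict_mono r" and l: "\<And>y. y \<in> S \<Longrightarrow> (\<lambda>k. w (r k) y) \<longlonglongrightarrow> l y" by blast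
  have "compact (cball (0::complex) B)" by simp
  moreover have "\<forall>k. w (r k) x \<in> cball 0 B" using insert.prems by simp
  ultimately obtain c q where q: "strict_mono q" "((\<lambda>k. w (r k) x) \<circ> q) \<longlonglongrightarrow> c"
    unfolding compact_def by metis
  have "(\<lambda>k. w ((r \<circ> q) k) y) \<longlonglongrightarrow> (l(x := c)) y" if "y \<in> insert x S" for y
  proof (cases "y = x")
    case True
    then show ?thesis using q(2) by (simp add: comp_def)
  next
    case False
    then have "(\<lambda>k. w (r k) y) \<longlonglongrightarrow> l y" using l that by simp
    then show ?thesis using LIMSEQ_subseq_LIMSEQ[OF _ q(1)] False by (force simp: comp_def)
  qed
  then show ?case using strict_mono_o[OF r q(1)] by blast
qed

lemma finite_uniform_modulus:
  fixes h :: "'a \<Rightarrow> real \<Rightarrow> complex"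
  assumes "finite S" "\<And>p. p \<in> S \<Longrightarrow> continuous_on {0..1} (h p)" "0 < e"
  shows "\<exists>d>0. \<forall>p\<in>S. \<forall>s\<in>{0..1}. \<forall>t\<in>{0..1}. \<bar>t - s\<bar> < d \<longrightarrow> cmod (h p t - h p s) < e"
  using assms(1,2)
proof (induct S)
  case empty
  show ?case by (intro exI[of _ 1]) auto
next
  case (insert q S)
  then obtain d where d: "d > 0" "\<And>p s t. p \<in> S \<Longrightarrow> s \<in> {0..1} \<Longrightarrow> t \<in> {0..1} \<Longrightarrow> \<bar>t - s\<bar> < d \<Longrightarrow> cmod (h p t - h p s) < e"
    by (metis insertCI)
  have "uniformly_continuous_on {0..1} (h q)"
    using insert.prems by (intro compact_uniformly_continuous) auto
  then obtain d' where d': "d' > 0" "\<And>s t. s \<in> {0..1} \<Longrightarrow> t \<in> {0..1} \<Longrightarrow> \<bar>t - s\<bar> < d' \<Longrightarrow> cmod (h q t - h q s) < e"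
    unfolding uniformly_continuous_on_def dist_norm real_norm_def using assms(3) by metis
  show ?case using d d' by (intro exI[of _ "min d d'"]) auto
qed

lemma finite_uniform_bound:
  fixes h :: "'a \<Rightarrow> real \<Rightarrow> complex"
  assumes "finite S" "\<And>p. p \<in> S \<Longrightarrow> continuous_on {0..1} (h p)"
  shows "\<exists>C\<ge>0. \<forall>p\<in>S. \<forall>t\<in>{0..1}. cmod (h p t) \<le> C"
  using assms
proof (induct S)
  case empty
  show ?case by (intro exI[of _ 0]) auto
next
  case (insert q S)
  then obtain C where C: "C \<ge> 0" "\<And>p t. p \<in> S \<Longrightarrow> t \<in> {0..1} \<Longrightarrow> cmod (h p t) \<le> C" by (metis insertCI)
  have "compact (h q ` {0..1})" using insert.prems by (intro compact_continuous_image) auto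
  then obtain C' where C': "\<And>t. t \<in> {0..1} \<Longrightarrow> cmod (h q t) \<le> C'"
    by (meson bounded_iff compact_imp_bounded imageI)
  have "\<forall>p\<in>insert q S. \<forall>t\<in>{0..1}. cmod (h p t) \<le> max C C'"
    using C(2) C' by (auto simp: le_max_iff_disj)
  then show ?case using C(1) by (intro exI[of _ "max C C'"]) auto
qed

lemma conj_index:
  assumes W: "W \<in> carrier_mat n n" and M: "M \<in> carrier_mat n n" and ij: "i < n" "j < n"
  shows "(mat_adjoint W * M * W) $$ (i,j) = (\<Sum>y<n. (\<Sum>x<n. cnj (W $$ (x,i)) * M $$ (x,y)) * W $$ (y,j))"
proof -
  have "(mat_adjoint W * M * W) $$ (i,j) = (\<Sum>y<n. (mat_adjoint W * M) $$ (i,y) * W $$ (y,j))"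
    by (rule mult_index[OF mult_carrier_mat[OF adj_carrier[OF W] M] W ij])
  also have "\<dots> = (\<Sum>y<n. (\<Sum>x<n. cnj (W $$ (x,i)) * M $$ (x,y)) * W $$ (y,j))"
  proof (intro sum.cong refl)
    fix y assume y: "y \<in> {..<n}"
    have "(mat_adjoint W * M) $$ (i,y) = (\<Sum>x<n. mat_adjoint W $$ (i,x) * M $$ (x,y))"
      using y by (intro mult_index[OF adj_carrier[OF W] M ij(1)]) auto
    also have "\<dots> = (\<Sum>x<n. cnj (W $$ (x,i)) * M $$ (x,y))" using W ij by (intro sum.cong) auto
    finally show "(mat_adjoint W * M) $$ (i,y) * W $$ (y,j) = (\<Sum>x<n. cnj (W $$ (x,i)) * M $$ (x,y)) * W $$ (y,j)" by simp
  qed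
  finally show ?thesis .
qed

text \<open>Continuity is entrywise and the constraint may depend on time. Paths under a constant
  constraint can be reparametrised freely before they are inserted into a timed one.\<close>

definition mpath :: "nat \<Rightarrow> (real \<Rightarrow> complex mat \<Rightarrow> bool) \<Rightarrow> real \<Rightarrow> real \<Rightarrow> complex mat \<Rightarrow> complex mat \<Rightarrow> bool" where
  "mpath n G a b X Y \<longleftrightarrow> (\<exists>W. (\<forall>t\<in>{a..b}. G t (W t)) \<and>
     (\<forall>i<n. \<forall>j<n. continuous_on {a..b} (\<lambda>t. W t $$ (i,j))) \<and> W a = X \<and> W b = Y)"

lemma mpath_join:
  assumes "mpath n G a b X Y" "mpath n G b c Y Z" "a \<le> b" "b \<le> c"
  shows "mpath n G a c X Z"
proof -
  obtain V where V: "\<forall>t\<in>{a..b}. G t (V t)" "\<And>i j. i < n \<Longrightarrow> j < n \<Longrightarrow> continuous_on {a..b} (\<lambda>t. V t $$ (i,j))" "V a = X" "V b = Y"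
    using assms(1) unfolding mpath_def by blast
  obtain W where W: "\<forall>t\<in>{b..c}. G t (W t)" "\<And>i j. i < n \<Longrightarrow> j < n \<Longrightarrow> continuous_on {b..c} (\<lambda>t. W t $$ (i,j))" "W b = Y" "W c = Z"
    using assms(2) unfolding mpath_def by blast
  let ?U = "\<lambda>t. if t \<le> b then V t else W t"
  have "continuous_on {a..c} (\<lambda>t. ?U t $$ (i,j))" if ij: "i < n" "j < n" for i j
  proof -
    have "continuous_on {a..c} (\<lambda>t. if t \<le> b then V t $$ (i,j) else W t $$ (i,j))"
    proof (rule continuous_on_cases_le)
      show "continuous_on {t \<in> {a..c}. t \<le> b} (\<lambda>t. V t $$ (i,j))"
        by (rule continuous_on_subset[OF V(2)[OF ij]]) auto
      show "continuous_on {t \<in> {a..c}. b \<le> t} (\<lambda>t. W t $$ (i,j))"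
        by (rule continuous_on_subset[OF W(2)[OF ij]]) auto
    qed (auto simp: V W intro: continuous_intros)
    moreover have e: "?U t $$ (i,j) = (if t \<le> b then V t $$ (i,j) else W t $$ (i,j))" for t by simp
    ultimately show ?thesis unfolding e by blast
  qed
  moreover have "\<forall>t\<in>{a..c}. G t (?U t)" using V(1) W(1) by auto
  moreover have "?U a = X" using V(3) assms(3) by simp
  moreover have "?U c = Z" using V(4) W(3,4) assms(4) by auto
  ultimately show ?thesis unfolding mpath_def by (intro exI[of _ ?U]) blast
qed

text \<open>The change of time is affine. The target interval must be nondegenerate, because a path
  has to be traversed within it.\<close>

lemma mpath_affine:
  assumes p: "mpath n (\<lambda>_. G) a b X Y" and ab: "a \<le> b" and cd: "c < d"
    and G: "\<And>t W. t \<in> {c..d} \<Longrightarrow> G W \<Longrightarrow> H t W"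
  shows "mpath n H c d X Y"
proof -
  obtain V where V: "\<And>t. t \<in> {a..b} \<Longrightarrow> G (V t)" "\<And>i j. i < n \<Longrightarrow> j < n \<Longrightarrow> continuous_on {a..b} (\<lambda>t. V t $$ (i,j))" "V a = X" "V b = Y"
    using p unfolding mpath_def by blast
  define u where "u t = a + (b - a) * ((t - c) / (d - c))" for t
  have u: "u t \<in> {a..b}" if "t \<in> {c..d}" for t
  proof -
    have l: "0 \<le> (t - c) / (d - c)" "(t - c) / (d - c) \<le> 1" using that cd by (auto simp: divide_le_eq)
    have "(b - a) * ((t - c) / (d - c)) \<le> (b - a) * 1" using l ab by (intro mult_left_mono) auto
    moreover have "0 \<le> (b - a) * ((t - c) / (d - c))" using l ab by (intro mult_nonneg_nonneg) auto
    ultimately show ?thesis by (simp add: u_def)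
  qed
  have uc: "continuous_on {c..d} u" unfolding u_def using cd by (intro continuous_intros) auto
  have "continuous_on {c..d} (\<lambda>t. V (u t) $$ (i,j))" if "i < n" "j < n" for i j
    by (rule continuous_on_compose2[OF V(2)[OF that] uc]) (use u in blast)
  moreover have "\<forall>t\<in>{c..d}. H t (V (u t))" using G V(1) u by blast
  moreover have "V (u c) = X" "V (u d) = Y" using V(3,4) cd by (simp_all add: u_def)
  ultimately show ?thesis unfolding mpath_def by (intro exI[of _ "\<lambda>t. V (u t)"]) blast
qed

lemma mpath_sym:
  assumes "mpath n (\<lambda>_. G) 0 1 X Y"
  shows "mpath n (\<lambda>_. G) 0 1 Y X"
proof -
  obtain V :: "real \<Rightarrow> complex mat" where V: "\<And>t. t \<in> {0..1} \<Longrightarrow> G (V t)" "\<And>i j. i < n \<Longrightarrow> j < n \<Longrightarrow> continuous_on {0..1} (\<lambda>t. V t $$ (i,j))" "V 0 = X" "V 1 = Y"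
    using assms unfolding mpath_def by blast
  have "continuous_on {0..1} (\<lambda>t. V (1 - t) $$ (i,j))" if "i < n" "j < n" for i j
    by (rule continuous_on_compose2[OF V(2)[OF that]]) (auto intro!: continuous_intros)
  then show ?thesis unfolding mpath_def using V by (intro exI[of _ "\<lambda>t. V (1 - t)"]) auto
qed

locale intertwining =
  fixes n :: nat and F :: "'f set" and M N :: "'f \<Rightarrow> real \<Rightarrow> complex mat"
  assumes Mc: "\<And>f t. f \<in> F \<Longrightarrow> t \<in> {0..1} \<Longrightarrow> M f t \<in> carrier_mat n n"
    and Mcont: "\<And>f i j. f \<in> F \<Longrightarrow> i < n \<Longrightarrow> j < n \<Longrightarrow> continuous_on {0..1} (\<lambda>t. M f t $$ (i,j))"
    and Nc: "\<And>f t. f \<in> F \<Longrightarrow> t \<in> {0..1} \<Longrightarrow> N f t \<in> carrier_mat n n"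
    and Ncont: "\<And>f i j. f \<in> F \<Longrightarrow> i < n \<Longrightarrow> j < n \<Longrightarrow> continuous_on {0..1} (\<lambda>t. N f t $$ (i,j))"
begin

definition I :: "real \<Rightarrow> complex mat set" where
  "I t = {W. unitary_mat n W \<and> (\<forall>f\<in>F. mat_adjoint W * M f t * W = N f t)}"

text \<open>The unitaries over \<open>t\<close> in an \<open>e\<close>-neighbourhood of the graph of
  \<open>I\<close>. The tolerance in time matters as much as the one in space: it permits motion
  inside the fibre over a fixed \<open>s\<close> while \<open>t\<close> advances.\<close>

definition good :: "real \<Rightarrow> real \<Rightarrow> complex mat \<Rightarrow> bool" where
  "good e t W \<longleftrightarrow> unitary_mat n W \<and> (\<exists>s\<in>{0..1}. \<exists>Y\<in>I s. \<bar>t - s\<bar> < e \<and> entry_bounded n e (W - Y))"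

text \<open>The graph of \<open>I\<close> is closed in a compact space.\<close>

lemma upper_semicontinuous:
  assumes t0: "t0 \<in> {0..1}" and e: "0 < e"
  shows "\<exists>d>0. \<forall>t\<in>{0..1}. \<bar>t - t0\<bar> < d \<longrightarrow> (\<forall>W\<in>I t. \<exists>Y\<in>I t0. entry_bounded n e (W - Y))"
proof (rule ccontr)
  assume neg: "\<not> ?thesis"
  have "\<exists>t W. t \<in> {0..1} \<and> \<bar>t - t0\<bar> < inverse (real (Suc k)) \<and> W \<in> I t \<and> (\<forall>Y\<in>I t0. \<not> entry_bounded n e (W - Y))" for k
  proof -
    have "inverse (real (Suc k)) > 0" by simp
    then show ?thesis using neg by blast
  qed
  then obtain t W where t: "\<And>k. t k \<in> {0..1}" "\<And>k. \<bar>t k - t0\<bar> < inverse (real (Suc k))"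
    and W: "\<And>k. W k \<in> I (t k)" and far: "\<And>k Y. Y \<in> I t0 \<Longrightarrow> \<not> entry_bounded n e (W k - Y)"
    by metis
  have Wu: "unitary_mat n (W k)" for k using W by (simp add: I_def)
  have Wc: "W k \<in> carrier_mat n n" for k using unitaryD(1)[OF Wu] .
  let ?S = "{..<n} \<times> {..<n}"
  have "\<exists>r l. strict_mono r \<and> (\<forall>x\<in>?S. (\<lambda>k. W (r k) $$ x) \<longlonglongrightarrow> l x)"
    using entry_bounded_unitary[OF Wu] by (intro finite_convergent_subsequence[where B = 1]) (auto simp: entry_bounded_def)
  then obtain r l where r: "strict_mono r" and l: "\<And>i j. i < n \<Longrightarrow> j < n \<Longrightarrow> (\<lambda>k. W (r k) $$ (i,j)) \<longlonglongrightarrow> l (i,j)"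
    by auto
  define L where "L = mat n n l"
  have Lc: "L \<in> carrier_mat n n" by (simp add: L_def)
  have lL: "(\<lambda>k. W (r k) $$ (i,j)) \<longlonglongrightarrow> L $$ (i,j)" if "i < n" "j < n" for i j
    using l[OF that] that by (simp add: L_def)
  have "t \<longlonglongrightarrow> t0"
  proof (rule LIMSEQ_I)
    fix q :: real assume "0 < q"
    then obtain K where K: "inverse (real (Suc K)) < q" using reals_Archimedean by blast
    have "norm (t k - t0) < q" if "K \<le> k" for k
    proof -
      have "inverse (real (Suc k)) \<le> inverse (real (Suc K))" using that by simp
      then show ?thesis using t(2)[of k] K unfolding real_norm_def by linarith
    qed
    then show "\<exists>K. \<forall>k\<ge>K. norm (t k - t0) < q" by blast
  qed
  then have tr: "(\<lambda>k. t (r k)) \<longlonglongrightarrow> t0" using LIMSEQ_subseq_LIMSEQ[OF _ r] by (simp add: comp_def)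
  have lim: "(\<lambda>k. h (t (r k))) \<longlonglongrightarrow> h t0" if "continuous_on {0..1} h" for h :: "real \<Rightarrow> complex"
    using continuous_on_tendsto_compose[OF that tr t0] t(1) by simp
  have conj_lim: "(\<lambda>k. (mat_adjoint (W (r k)) * P k * W (r k)) $$ (i,j)) \<longlonglongrightarrow> (mat_adjoint L * Q * L) $$ (i,j)"
    if "\<And>k. P k \<in> carrier_mat n n" "Q \<in> carrier_mat n n" and ij: "i < n" "j < n"
      and "\<And>i j. i < n \<Longrightarrow> j < n \<Longrightarrow> (\<lambda>k. P k $$ (i,j)) \<longlonglongrightarrow> Q $$ (i,j)" for P Q i j
    unfolding conj_index[OF Wc that(1) ij] conj_index[OF Lc that(2) ij]
    using lL that(5) ij by (intro tendsto_intros) auto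
  \<comment> \<open>Unitarity and the intertwining equations are polynomial identities in the
    entries and their conjugates, so they pass to the limit.\<close>
  have "L \<in> I t0"
  proof -
    have "mat_adjoint L * 1\<^sub>m n * L = 1\<^sub>m n"
    proof (rule eq_matI)
      fix i j assume "i < dim_row (1\<^sub>m n :: complex mat)" "j < dim_col (1\<^sub>m n :: complex mat)"
      then have ij: "i < n" "j < n" by auto
      have "(\<lambda>k. (mat_adjoint (W (r k)) * 1\<^sub>m n * W (r k)) $$ (i,j)) \<longlonglongrightarrow> (mat_adjoint L * 1\<^sub>m n * L) $$ (i,j)"
        using ij by (intro conj_lim) auto
      moreover have "mat_adjoint (W (r k)) * 1\<^sub>m n * W (r k) = 1\<^sub>m n" for k
        using unitaryD[OF Wu[of "r k"]] by simp
      ultimately show "(mat_adjoint L * 1\<^sub>m n * L) $$ (i,j) = 1\<^sub>m n $$ (i,j)"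
        by (simp add: LIMSEQ_const_iff del: index_mult_mat)
    qed (use Lc in auto)
    then have "unitary_mat n L" using Lc by (intro unitaryI) auto
    moreover have "mat_adjoint L * M f t0 * L = N f t0" if f: "f \<in> F" for f
    proof (rule eq_matI)
      fix i j assume "i < dim_row (N f t0)" "j < dim_col (N f t0)"
      then have ij: "i < n" "j < n" using Nc[OF f t0] by auto
      have "(\<lambda>k. (mat_adjoint (W (r k)) * M f (t (r k)) * W (r k)) $$ (i,j)) \<longlonglongrightarrow> (mat_adjoint L * M f t0 * L) $$ (i,j)"
        using ij f t(1) t0 Mc lim[OF Mcont[OF f]] by (intro conj_lim) auto
      moreover have "mat_adjoint (W (r k)) * M f (t (r k)) * W (r k) = N f (t (r k))" for k
        using W f by (simp add: I_def)
      ultimately have "(\<lambda>k. N f (t (r k)) $$ (i,j)) \<longlonglongrightarrow> (mat_adjoint L * M f t0 * L) $$ (i,j)" by simp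
      then show "(mat_adjoint L * M f t0 * L) $$ (i,j) = N f t0 $$ (i,j)"
        using lim[OF Ncont[OF f ij]] LIMSEQ_unique by blast
    qed (use Nc[OF f t0] Lc in auto)
    ultimately show ?thesis by (simp add: I_def)
  qed
  then have far': "\<not> entry_bounded n e (W (r k) - L)" for k by (rule far)
  have "\<forall>\<^sub>F k in sequentially. \<forall>x\<in>?S. cmod (W (r k) $$ x - L $$ x) < e"
  proof (rule eventually_ball_finite)
    show "\<forall>x\<in>?S. \<forall>\<^sub>F k in sequentially. cmod (W (r k) $$ x - L $$ x) < e"
    proof
      fix x assume "x \<in> ?S"
      then obtain i j where x: "x = (i,j)" "i < n" "j < n" by auto
      show "\<forall>\<^sub>F k in sequentially. cmod (W (r k) $$ x - L $$ x) < e"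
        using lL[OF x(2,3)] e x(1) by (simp add: tendsto_iff dist_norm)
    qed
  qed simp
  from eventually_happens'[OF sequentially_bot this]
  obtain k where "\<forall>x\<in>?S. cmod (W (r k) $$ x - L $$ x) < e" by blast
  then have "entry_bounded n e (W (r k) - L)" using Wc[of "r k"] Lc by (force simp: entry_bounded_def)
  then show False using far' by blast
qed

text \<open>Bolzano's interval induction reduces the claim to short intervals around a point
  \<open>x\<close>. There both end matrices are close to the fibre over \<open>x\<close>: the path
  goes from the first one to that fibre, through the fibre, and out to the second one, all
  compressed into the short interval.\<close>

lemma intertwining_path:
  assumes ne: "\<And>t. t \<in> {0..1} \<Longrightarrow> I t \<noteq> {}" and e: "0 < e" and X: "X \<in> I 0" and Y: "Y \<in> I 1"
  shows "mpath n (good e) 0 1 X Y"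
proof -
  \<comment> \<open>The guard a < b is essential: in a degenerate interval two different
    intertwiners cannot be joined.\<close>
  define P where "P a b \<longleftrightarrow> (0 \<le> a \<and> a < b \<and> b \<le> 1 \<longrightarrow> (\<forall>X\<in>I a. \<forall>Y\<in>I b. mpath n (good e) a b X Y))" for a b
  have "(0::real) \<le> 1" by simp
  then have "P 0 1"
  proof (induct rule: Bolzano)
    fix a b c assume P: "P a b" "P b c" and le: "a \<le> b" "b \<le> c"
    show "P a c"
    proof (cases "a = b \<or> b = c")
      case True
      then show ?thesis using P by auto
    next
      case False
      then have lt: "a < b" "b < c" using le by auto
      show ?thesis unfolding P_def
      proof (intro impI ballI)
        fix X Y assume ac: "0 \<le> a \<and> a < c \<and> c \<le> 1" and X: "X \<in> I a" and Y: "Y \<in> I c"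
        obtain Z where Z: "Z \<in> I b" using ne[of b] ac lt by fastforce
        have "mpath n (good e) a b X Z" "mpath n (good e) b c Z Y"
          using P X Y Z ac lt unfolding P_def by auto
        then show "mpath n (good e) a c X Y" using le by (rule mpath_join)
      qed
    qed
  next
    fix x :: real assume x: "0 \<le> x" "x \<le> 1"
    \<comment> \<open>Compensates the loss of \<open>n ^ 6\<close> in the arc estimate; the added 1
      covers dimension zero.\<close>
    define e' where "e' = e / (real n ^ 6 + 1)"
    have n6: "real n ^ 6 + 1 > 0" by (simp add: add_nonneg_pos)
    have e': "0 < e'" using e n6 by (simp add: e'_def)
    have ee: "real n ^ 6 * e' \<le> e"
    proof -
      have "real n ^ 6 * e' \<le> (real n ^ 6 + 1) * e'" using e' by (simp add: mult_right_mono)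
      also have "\<dots> = e" using n6 by (simp add: e'_def)
      finally show ?thesis .
    qed
    obtain d where d: "d > 0" "\<And>t W. t \<in> {0..1} \<Longrightarrow> \<bar>t - x\<bar> < d \<Longrightarrow> W \<in> I t \<Longrightarrow> \<exists>Y\<in>I x. entry_bounded n e' (W - Y)"
      using upper_semicontinuous[of x e'] x e' by auto
    define G where "G W \<longleftrightarrow> unitary_mat n W \<and> (\<exists>Y\<in>I x. entry_bounded n e (W - Y))" for W
    have near: "\<exists>Y\<in>I x. mpath n (\<lambda>_. G) 0 1 Y W" if t: "t \<in> {0..1}" "\<bar>t - x\<bar> < d" and W: "W \<in> I t" for t W
    proof -
      obtain Y where Y: "Y \<in> I x" "entry_bounded n e' (W - Y)" using d(2)[OF t W] by blast
      have u: "unitary_mat n Y" "unitary_mat n W" using Y W by (auto simp: I_def)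
      obtain \<gamma> where arc: "unitary_arc n Y W \<gamma>" using unitary_path[OF u] .
      have \<gamma>: "\<And>s. unitary_mat n (\<gamma> s)" "\<And>i j. i < n \<Longrightarrow> j < n \<Longrightarrow> continuous_on UNIV (\<lambda>s. \<gamma> s $$ (i,j))"
        "\<gamma> 0 = Y" "\<gamma> 1 = W"
        using arc unfolding unitary_arc_def by blast+
      have "G (\<gamma> s)" if "s \<in> {0..1}" for s
      proof -
        have "entry_bounded n (real n ^ 6 * e') (\<gamma> s - Y)"
          using arc Y(2) e' that unfolding unitary_arc_def by simp
        then have "entry_bounded n e (\<gamma> s - Y)" using ee by (rule entry_bounded_mono)
        then show ?thesis using \<gamma>(1) Y(1) by (auto simp: G_def)
      qed
      then have "mpath n (\<lambda>_. G) 0 1 Y W"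
        using \<gamma>(2,3,4) unfolding mpath_def
        by (intro exI[of _ \<gamma>] conjI ballI allI impI) (auto intro: continuous_on_subset[OF _ subset_UNIV])
      then show ?thesis using Y(1) by blast
    qed
    have within: "mpath n (\<lambda>_. G) 0 1 Y Y'" if Y: "Y \<in> I x" "Y' \<in> I x" for Y Y'
    proof -
      have u: "unitary_mat n Y" "unitary_mat n Y'" using Y by (auto simp: I_def)
      obtain \<gamma> where arc: "unitary_arc n Y Y' \<gamma>" using unitary_path[OF u] .
      have \<gamma>: "\<And>s. unitary_mat n (\<gamma> s)" "\<And>i j. i < n \<Longrightarrow> j < n \<Longrightarrow> continuous_on UNIV (\<lambda>s. \<gamma> s $$ (i,j))"
        "\<gamma> 0 = Y" "\<gamma> 1 = Y'"
        using arc unfolding unitary_arc_def by blast+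
      have "\<gamma> s \<in> I x" for s
        using arc Y Mc[of _ x] x unfolding unitary_arc_def I_def by simp
      moreover have "entry_bounded n e (\<gamma> s - \<gamma> s)" for s using unitaryD(1)[OF \<gamma>(1)[of s]] e by (auto simp: entry_bounded_def)
      ultimately have "G (\<gamma> s)" for s using \<gamma>(1) by (auto simp: G_def)
      then show ?thesis
        using \<gamma>(2,3,4) unfolding mpath_def by (intro exI[of _ \<gamma>]) (auto intro: continuous_on_subset)
    qed
    show "\<exists>d>0. \<forall>a b. a \<le> x \<and> x \<le> b \<and> b - a < d \<longrightarrow> P a b"
    \<comment> \<open>Length below \<open>d\<close> brings both ends within reach of the fibre over
      \<open>x\<close>; length below \<open>e\<close> keeps all times of the interval within the
      tolerance of \<open>good\<close>.\<close>
    proof (intro exI[of _ "min d e"] conjI allI impI)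
      show "0 < min d e" using d e by simp
      fix a b assume ab: "a \<le> x \<and> x \<le> b \<and> b - a < min d e"
      show "P a b" unfolding P_def
      proof (intro impI ballI)
        fix X Z assume ab': "0 \<le> a \<and> a < b \<and> b \<le> 1" and X: "X \<in> I a" and Z: "Z \<in> I b"
        obtain Y where Y: "Y \<in> I x" "mpath n (\<lambda>_. G) 0 1 Y X" using near[of a X] X ab ab' x by auto
        obtain Y' where Y': "Y' \<in> I x" "mpath n (\<lambda>_. G) 0 1 Y' Z" using near[of b Z] Z ab ab' x by auto
        have 1: "mpath n (\<lambda>_. G) 0 1 X Y" by (rule mpath_sym[OF Y(2)])
        have 2: "mpath n (\<lambda>_. G) 1 2 Y Y'" by (rule mpath_affine[OF within[OF Y(1) Y'(1)]]) auto
        have 3: "mpath n (\<lambda>_. G) 2 3 Y' Z" by (rule mpath_affine[OF Y'(2)]) auto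
        have "mpath n (\<lambda>_. G) 0 3 X Z"
          by (rule mpath_join[OF mpath_join[OF 1 2] 3]) auto
        then show "mpath n (good e) a b X Z"
        proof (rule mpath_affine)
          fix t W assume t: "t \<in> {a..b}" and W: "G W"
          have "\<bar>t - x\<bar> < e" using t ab by auto
          then show "good e t W" using W x by (auto simp: good_def G_def)
        qed (use ab' in auto)
      qed
    qed
  qed
  then show ?thesis using X Y by (simp add: P_def)
qed

text \<open>A good \<open>W\<close> over \<open>t\<close> is compared with an exact intertwiner
  \<open>Y\<close> over a nearby \<open>s\<close>. The conjugates differ by the change of
  \<open>W\<close>, twice, and by the change of \<open>M\<close> from \<open>s\<close> to
  \<open>t\<close>; a last term moves \<open>N\<close> from \<open>s\<close> back to
  \<open>t\<close>.\<close>

lemma good_estimate: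
  assumes f: "f \<in> F" and eta: "0 < \<eta>"
  obtains e where "0 < e" "\<And>t W e'. t \<in> {0..1} \<Longrightarrow> e' \<le> e \<Longrightarrow> good e' t W \<Longrightarrow> entry_bounded n \<eta> (mat_adjoint W * M f t * W - N f t)"
proof -
  let ?S = "{..<n} \<times> {..<n}"
  have "\<exists>C\<ge>0. \<forall>p\<in>?S. \<forall>t\<in>{0..1}. cmod (M f t $$ p) \<le> C"
    using Mcont[OF f] by (intro finite_uniform_bound) auto
  then obtain C where C: "C \<ge> 0" "\<And>i j t. i < n \<Longrightarrow> j < n \<Longrightarrow> t \<in> {0..1} \<Longrightarrow> cmod (M f t $$ (i,j)) \<le> C" by force
  \<comment> \<open>Each of the \<open>real n ^ 2\<close> summands of a conjugated entry contributes
    at most \<open>2 * e1\<close>, and the modulus of \<open>N\<close> one more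
    \<open>e1\<close>.\<close>
  define e1 where "e1 = \<eta> / (real n ^ 2 + 1) / 2"
  have n2: "real n ^ 2 + 1 > 0" by (simp add: add_nonneg_pos)
  have e1: "e1 > 0" using eta n2 by (simp add: e1_def)
  have "\<exists>d>0. \<forall>p\<in>?S. \<forall>s\<in>{0..1}. \<forall>t\<in>{0..1}. \<bar>t - s\<bar> < d \<longrightarrow> cmod (M f t $$ p - M f s $$ p) < e1"
    using Mcont[OF f] e1 by (intro finite_uniform_modulus) auto
  then obtain d1 where d1: "d1 > 0" "\<And>i j s t. i < n \<Longrightarrow> j < n \<Longrightarrow> s \<in> {0..1} \<Longrightarrow> t \<in> {0..1} \<Longrightarrow> \<bar>t - s\<bar> < d1 \<Longrightarrow> cmod (M f t $$ (i,j) - M f s $$ (i,j)) < e1"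
    by force
  have "\<exists>d>0. \<forall>p\<in>?S. \<forall>s\<in>{0..1}. \<forall>t\<in>{0..1}. \<bar>t - s\<bar> < d \<longrightarrow> cmod (N f t $$ p - N f s $$ p) < e1"
    using Ncont[OF f] e1 by (intro finite_uniform_modulus) auto
  then obtain d2 where d2: "d2 > 0" "\<And>i j s t. i < n \<Longrightarrow> j < n \<Longrightarrow> s \<in> {0..1} \<Longrightarrow> t \<in> {0..1} \<Longrightarrow> \<bar>t - s\<bar> < d2 \<Longrightarrow> cmod (N f t $$ (i,j) - N f s $$ (i,j)) < e1"
    by force
  \<comment> \<open>The third bound makes the two terms carrying \<open>W - Y\<close>, of size
    \<open>C * e\<close> each, cost at most \<open>e1\<close> together.\<close>
  define e where "e = min (min d1 d2) (e1 / (2 * C + 1))"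
  have e: "0 < e" using d1 d2 e1 C(1) by (simp add: e_def)
  have eC: "2 * C * e \<le> e1"
  proof -
    have "e \<le> e1 / (2 * C + 1)" by (simp add: e_def)
    then have "(2 * C + 1) * e \<le> e1" using C(1) by (simp add: field_simps)
    moreover have "2 * C * e \<le> (2 * C + 1) * e" using e by (simp add: algebra_simps)
    ultimately show ?thesis by linarith
  qed
  show ?thesis
  proof (rule that[OF e])
    fix t W e' assume t: "t \<in> {0..1}" and ee: "e' \<le> e" and g: "good e' t W"
    then obtain s Y where s: "s \<in> {0..1}" and Y: "Y \<in> I s" and ts': "\<bar>t - s\<bar> < e'" and WY': "entry_bounded n e' (W - Y)"
      and Wu: "unitary_mat n W" unfolding good_def by blast
    have ts: "\<bar>t - s\<bar> < e" using ts' ee by linarith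
    have WY: "entry_bounded n e (W - Y)" using WY' ee by (rule entry_bounded_mono)
    have Yu: "unitary_mat n Y" and YN: "mat_adjoint Y * M f s * Y = N f s" using Y f by (auto simp: I_def)
    have Wc: "W \<in> carrier_mat n n" and Yc: "Y \<in> carrier_mat n n" using unitaryD(1) Wu Yu by auto
    have W1: "cmod (W $$ (i,j)) \<le> 1" and Y1: "cmod (Y $$ (i,j)) \<le> 1" and WY1: "cmod (W $$ (i,j) - Y $$ (i,j)) \<le> e" if "i < n" "j < n" for i j
      using entry_bounded_unitary[OF Wu] entry_bounded_unitary[OF Yu] WY that Wc Yc by (auto simp: entry_bounded_def)
    have tri: "cmod (a * b * c - a' * b' * c') \<le> e1 + 2 * C * e"
      if "cmod a \<le> 1" "cmod c \<le> 1" "cmod a' \<le> 1" "cmod (a - a') \<le> e" "cmod (c - c') \<le> e" "cmod b \<le> C" "cmod b' \<le> C" "cmod (b - b') \<le> e1" for a b c a' b' c' :: complex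
    proof -
      have "a * b * c - a' * b' * c' = (a - a') * b * c + a' * (b - b') * c + a' * b' * (c - c')" by (simp add: algebra_simps)
      then have "cmod (a * b * c - a' * b' * c') \<le> cmod (a - a') * cmod b * cmod c + cmod a' * cmod (b - b') * cmod c + cmod a' * cmod b' * cmod (c - c')"
        by (metis (no_types, lifting) norm_mult norm_triangle_le norm_triangle_mono order.refl)
      also have "\<dots> \<le> e * C * 1 + 1 * e1 * 1 + 1 * C * e"
        using that C(1) e e1 by (intro add_mono mult_mono mult_nonneg_nonneg) auto
      finally show ?thesis by (simp add: mult_ac)
    qed
    show "entry_bounded n \<eta> (mat_adjoint W * M f t * W - N f t)"
      unfolding entry_bounded_def
    proof (intro allI impI)
      fix i j assume ij: "i < n" "j < n"
      have "cmod ((mat_adjoint W * M f t * W) $$ (i,j) - (mat_adjoint Y * M f s * Y) $$ (i,j))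
        = cmod (\<Sum>y<n. \<Sum>x<n. cnj (W $$ (x,i)) * M f t $$ (x,y) * W $$ (y,j) - cnj (Y $$ (x,i)) * M f s $$ (x,y) * Y $$ (y,j))"
        unfolding conj_index[OF Wc Mc[OF f t] ij] conj_index[OF Yc Mc[OF f s] ij]
        by (simp add: sum_subtractf sum_distrib_right)
      also have "\<dots> \<le> (\<Sum>y<n. \<Sum>x<n. e1 + 2 * C * e)"
      proof (intro sum_norm_le tri)
        fix y x assume xy: "y \<in> {..<n}" "x \<in> {..<n}"
        show "cmod (cnj (W $$ (x,i)) - cnj (Y $$ (x,i))) \<le> e"
          using WY1[of x i] xy ij by (metis complex_cnj_diff complex_mod_cnj lessThan_iff)
        have "\<bar>t - s\<bar> < d1" using ts by (simp add: e_def)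
        then show "cmod (M f t $$ (x,y) - M f s $$ (x,y)) \<le> e1" using d1(2)[of x y s t] xy s t by simp
      qed (use W1 Y1 WY1 C(2) ij s t in auto)
      also have "\<dots> \<le> (\<Sum>y<n. \<Sum>x<n. 2 * e1)" using eC by (intro sum_mono) simp
      also have "\<dots> = real n ^ 2 * (2 * e1)" by (simp add: power2_eq_square)
      finally have A: "cmod ((mat_adjoint W * M f t * W) $$ (i,j) - N f s $$ (i,j)) \<le> real n ^ 2 * (2 * e1)"
        by (simp only: YN)
      have "\<bar>t - s\<bar> < d2" using ts by (simp add: e_def)
      then have "cmod (N f t $$ (i,j) - N f s $$ (i,j)) < e1" using d2(2) ij s t by simp
      then have "cmod ((mat_adjoint W * M f t * W) $$ (i,j) - N f t $$ (i,j)) \<le> real n ^ 2 * (2 * e1) + e1"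
        using A norm_triangle_ineq4[of "(mat_adjoint W * M f t * W) $$ (i,j) - N f s $$ (i,j)" "N f t $$ (i,j) - N f s $$ (i,j)"] by simp
      also have "\<dots> \<le> (real n ^ 2 + 1) * (2 * e1)" using e1 by (simp add: algebra_simps)
      also have "\<dots> = \<eta>"
      proof -
        have "x * (2 * (\<eta> / x / 2)) = \<eta>" if "x > 0" for x :: real using that by simp
        then show ?thesis unfolding e1_def using n2 by blast
      qed
      finally show "cmod ((mat_adjoint W * M f t * W - N f t) $$ (i,j)) \<le> \<eta>"
        using ij Nc[OF f t] Wc by (simp del: index_mult_mat(1))
    qed
  qed
qed

end

section \<open>Norms and the endpoints\<close>

text \<open>On the unit ball every coordinate of the image is at most n times the entry bound, and
  the Euclidean norm is at most the sum over n coordinates. The zero vector shows that the supremum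
  is over a nonempty set and is nonnegative.\<close>

lemma op_norm_bounds:
  assumes M: "M \<in> carrier_mat n n" and b: "entry_bounded n \<eta> M" and eta: "0 \<le> \<eta>"
  shows "0 \<le> op_norm M" "op_norm M \<le> (real n)\<^sup>2 * \<eta>"
proof -
  let ?S = "{cvec_norm (M *\<^sub>v v) | v. v \<in> carrier_vec (dim_col M) \<and> cvec_norm v \<le> 1}"
  have le: "x \<le> (real n)\<^sup>2 * \<eta>" if xS: "x \<in> ?S" for x
  proof -
    obtain v where v': "v \<in> carrier_vec (dim_col M)" "cvec_norm v \<le> 1" and x: "x = cvec_norm (M *\<^sub>v v)" using xS by blast
    have v: "v \<in> carrier_vec n" "cvec_norm v \<le> 1" using v' M by auto
    have vi: "cmod (vec_index v i) \<le> 1" if "i < n" for i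
    proof -
      have "(cmod (vec_index v i))\<^sup>2 \<le> (\<Sum>i<n. (cmod (vec_index v i))\<^sup>2)" using that by (intro member_le_sum) auto
      then have "cmod (vec_index v i) \<le> cvec_norm v"
        using v(1) by (auto simp: cvec_norm_def intro: real_le_rsqrt)
      then show ?thesis using v(2) by linarith
    qed
    have Mv: "cmod (vec_index (M *\<^sub>v v) i) \<le> real n * \<eta>" if i: "i < n" for i
    proof -
      have "vec_index (M *\<^sub>v v) i = (\<Sum>j<n. M $$ (i,j) * vec_index v j)"
        using i M v(1) by (simp add: scalar_prod_def atLeast0LessThan)
      also have "cmod \<dots> \<le> (\<Sum>j<n. \<eta> * 1)"
        using b i vi eta unfolding entry_bounded_def by (intro sum_norm_le, unfold norm_mult, intro mult_mono) auto
      finally show ?thesis by simp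
    qed
    have "cvec_norm (M *\<^sub>v v) \<le> (\<Sum>i<n. cmod (vec_index (M *\<^sub>v v) i))"
      using M L2_set_le_sum[of "{..<n}" "\<lambda>i. cmod (vec_index (M *\<^sub>v v) i)"] by (simp add: cvec_norm_def L2_set_def)
    also have "\<dots> \<le> (\<Sum>i<n. real n * \<eta>)" using Mv by (intro sum_mono) auto
    finally show ?thesis by (simp add: x power2_eq_square)
  qed
  have z: "0 \<in> ?S"
  proof -
    have "M *\<^sub>v 0\<^sub>v n = 0\<^sub>v n" using M by (intro eq_vecI) (auto simp: scalar_prod_def)
    then show ?thesis using M by (intro CollectI exI[of _ "0\<^sub>v n"]) (auto simp: cvec_norm_def)
  qed
  show "op_norm M \<le> (real n)\<^sup>2 * \<eta>" unfolding op_norm_def using z le by (intro cSup_least) auto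
  show "0 \<le> op_norm M" unfolding op_norm_def using z le by (intro cSup_upper bdd_aboveI) auto
qed

lemma fnorm_bound:
  assumes "\<And>t. t \<in> {0..1} \<Longrightarrow> f t \<in> carrier_mat n n" "\<And>t. t \<in> {0..1} \<Longrightarrow> entry_bounded n \<eta> (f t)" "0 \<le> \<eta>"
  shows "\<bar>fnorm f\<bar> \<le> (real n)\<^sup>2 * \<eta>"
proof -
  have b: "0 \<le> op_norm (f t)" "op_norm (f t) \<le> (real n)\<^sup>2 * \<eta>" if "t \<in> {0..1}" for t
    using op_norm_bounds[OF assms(1)[OF that] assms(2)[OF that] assms(3)] by auto
  have "fnorm f \<le> (real n)\<^sup>2 * \<eta>" unfolding fnorm_def using b by (intro cSUP_least) auto
  moreover have "op_norm (f 0) \<le> fnorm f" unfolding fnorm_def using b by (intro cSUP_upper bdd_aboveI2) auto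
  ultimately show ?thesis using b(1)[of 0] by auto
qed

lemma diag_block_continuous:
  fixes gs :: "(real \<Rightarrow> complex mat) list"
  assumes "\<And>g t. g \<in> set gs \<Longrightarrow> t \<in> S \<Longrightarrow> g t \<in> carrier_mat (d g) (d g)"
    and "\<And>g i j. g \<in> set gs \<Longrightarrow> i < d g \<Longrightarrow> j < d g \<Longrightarrow> continuous_on S (\<lambda>t. g t $$ (i,j))"
    and "i < sum_list (map d gs)" "j < sum_list (map d gs)"
  shows "continuous_on S (\<lambda>t. diag_block_mat (map (\<lambda>g. g t) gs) $$ (i,j))"
  using assms
proof (induct gs arbitrary: i j)
  case (Cons g gs)
  let ?n = "sum_list (map d gs)"
  have g: "g t \<in> carrier_mat (d g) (d g)" if "t \<in> S" for t using Cons.prems(1) that by simp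
  have D: "diag_block_mat (map (\<lambda>g. g t) gs) \<in> carrier_mat ?n ?n" if "t \<in> S" for t
    using diag_block_carrier[of gs "\<lambda>g. g t" d] Cons.prems(1) that by simp
  have ij: "i < d g + ?n" "j < d g + ?n" using Cons.prems(3,4) by auto
  have "diag_block_mat (map (\<lambda>g. g t) (g # gs)) $$ (i,j) = (if i < d g \<and> j < d g then g t $$ (i,j)
     else if d g \<le> i \<and> d g \<le> j then diag_block_mat (map (\<lambda>g. g t) gs) $$ (i - d g, j - d g) else 0)" if t: "t \<in> S" for t
    using g[OF t] D[OF t] ij by (simp add: diag_block_mat_Cons dirsum_index del: diag_block_mat.simps(2))
  moreover have "continuous_on S (\<lambda>t. if i < d g \<and> j < d g then g t $$ (i,j)
     else if d g \<le> i \<and> d g \<le> j then diag_block_mat (map (\<lambda>g. g t) gs) $$ (i - d g, j - d g) else 0)"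
  proof -
    consider "i < d g \<and> j < d g" | "d g \<le> i \<and> d g \<le> j" | "\<not> (i < d g \<and> j < d g)" "\<not> (d g \<le> i \<and> d g \<le> j)" by blast
    then show ?thesis
    proof cases
      case 1
      then show ?thesis using Cons.prems(2)[of g i j] by simp
    next
      case 2
      have "continuous_on S (\<lambda>t. diag_block_mat (map (\<lambda>g. g t) gs) $$ (i - d g, j - d g))"
        using Cons.prems(1,2) 2 ij by (intro Cons.hyps) auto
      then show ?thesis using 2 by simp
    next
      case 3
      then have e: "(i < d g \<and> j < d g) = False" "(d g \<le> i \<and> d g \<le> j) = False" by auto
      show ?thesis unfolding e by simp
    qed
  qed
  ultimately show ?case by (subst continuous_on_cong[OF refl]) auto
qed simp

section \<open>Block compressions and normal forms at the endpoints of B\<close>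

lemma blk_carrier: "blk rs i M \<in> carrier_mat (rs ! i) (rs ! i)"
  by (simp add: blk_def)

text \<open>A row of the block diagonal left factor is supported in its own block, so the sum over
  intermediate indices does not leave it.\<close>

lemma blk_mult:
  assumes M: "M \<in> carrier_mat (sum_list rs) (sum_list rs)" "block_diag_wrt rs M"
    and N: "N \<in> carrier_mat (sum_list rs) (sum_list rs)" and i: "i < length rs"
  shows "blk rs i (M * N) = blk rs i M * blk rs i N"
proof (rule eq_matI)
  fix a b assume "a < dim_row (blk rs i M * blk rs i N)" "b < dim_col (blk rs i M * blk rs i N)"
  then have ab: "a < rs ! i" "b < rs ! i" by (auto simp: blk_def)
  let ?s = "blk_start rs i" and ?n = "sum_list rs"
  have le: "?s + rs ! i \<le> ?n" by (rule blk_start_le[OF i])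
  have z: "M $$ (?s + a, x) = 0" if "x < ?n" "x \<notin> {?s..<?s + rs ! i}" for x
  proof -
    have "\<not> same_block rs (?s + a) x" using that same_block_iff[OF i, of "?s + a" x] ab by auto
    then show ?thesis using M(2) that ab le unfolding block_diag_iff by (meson add_strict_left_mono order.strict_trans2)
  qed
  have "blk rs i (M * N) $$ (a,b) = (M * N) $$ (?s + a, ?s + b)" using ab by (simp add: blk_def)
  also have "\<dots> = (\<Sum>x<?n. M $$ (?s + a, x) * N $$ (x, ?s + b))"
    using ab le by (intro mult_index[OF M(1) N]) auto
  also have "\<dots> = (\<Sum>x\<in>{?s..<?s + rs ! i}. M $$ (?s + a, x) * N $$ (x, ?s + b))"
    using z le by (intro sum.mono_neutral_right) auto
  also have "\<dots> = (\<Sum>x<rs ! i. M $$ (?s + a, ?s + x) * N $$ (?s + x, ?s + b))"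
    by (rule sum.reindex_bij_witness[of _ "\<lambda>x. ?s + x" "\<lambda>x. x - ?s"]) auto
  also have "\<dots> = (\<Sum>x<rs ! i. blk rs i M $$ (a,x) * blk rs i N $$ (x,b))"
    using ab by (intro sum.cong) (auto simp: blk_def)
  also have "\<dots> = (blk rs i M * blk rs i N) $$ (a,b)"
    by (rule mult_index[OF blk_carrier blk_carrier ab, symmetric])
  finally show "blk rs i (M * N) $$ (a,b) = (blk rs i M * blk rs i N) $$ (a,b)" .
qed (auto simp: blk_def)

lemma blk_linear:
  assumes "M \<in> carrier_mat (sum_list rs) (sum_list rs)" "N \<in> carrier_mat (sum_list rs) (sum_list rs)" "i < length rs"
  shows "blk rs i (M + N) = blk rs i M + blk rs i N" "blk rs i (c \<cdot>\<^sub>m M) = c \<cdot>\<^sub>m blk rs i M"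
    "blk rs i (mat_adjoint M) = mat_adjoint (blk rs i M)" "blk rs i (1\<^sub>m (sum_list rs)) = (1\<^sub>m (rs ! i) :: complex mat)"
proof -
  have le: "blk_start rs i + a < sum_list rs" if "a < rs ! i" for a using blk_start_le[OF assms(3)] that by simp
  show "blk rs i (M + N) = blk rs i M + blk rs i N" "blk rs i (c \<cdot>\<^sub>m M) = c \<cdot>\<^sub>m blk rs i M"
    "blk rs i (mat_adjoint M) = mat_adjoint (blk rs i M)" "blk rs i (1\<^sub>m (sum_list rs)) = (1\<^sub>m (rs ! i) :: complex mat)"
    using assms(1,2) le by (auto simp: blk_def intro!: eq_matI)
qed

lemma diag_block_blocks:
  fixes X :: "nat \<Rightarrow> complex mat"
  assumes X: "\<And>i. i < length rs \<Longrightarrow> X i \<in> carrier_mat (rs ! i) (rs ! i)"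
  shows "diag_block_mat (map X [0..<length rs]) \<in> carrier_mat (sum_list rs) (sum_list rs)"
    "block_diag_wrt rs (diag_block_mat (map X [0..<length rs]))"
    "i < length rs \<Longrightarrow> blk rs i (diag_block_mat (map X [0..<length rs])) = X i"
proof -
  let ?D = "\<lambda>k. diag_block_mat (map X [0..<k])"
  have main: "?D k \<in> carrier_mat (blk_start rs k) (blk_start rs k)
    \<and> (\<forall>a<blk_start rs k. \<forall>b<blk_start rs k. ?D k $$ (a,b) \<noteq> 0 \<longrightarrow> same_block rs a b)
    \<and> (\<forall>i<k. \<forall>a<rs ! i. \<forall>b<rs ! i. ?D k $$ (blk_start rs i + a, blk_start rs i + b) = X i $$ (a,b))"
    if "k \<le> length rs" for k
    using that
  proof (induct k)
    case 0
    show ?case by simp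
  next
    case (Suc k)
    let ?s = "blk_start rs k"
    have k: "k < length rs" using Suc.prems by simp
    have IH: "?D k \<in> carrier_mat ?s ?s" "\<And>a b. a < ?s \<Longrightarrow> b < ?s \<Longrightarrow> ?D k $$ (a,b) \<noteq> 0 \<Longrightarrow> same_block rs a b"
      "\<And>i a b. i < k \<Longrightarrow> a < rs ! i \<Longrightarrow> b < rs ! i \<Longrightarrow> ?D k $$ (blk_start rs i + a, blk_start rs i + b) = X i $$ (a,b)"
      using Suc by auto
    have e: "?D (Suc k) = dirsum (?D k) (X k)" by (simp add: diag_block_append del: diag_block_mat.simps(2))
    have idx: "?D (Suc k) $$ (a,b) = (if a < ?s \<and> b < ?s then ?D k $$ (a,b) else if ?s \<le> a \<and> ?s \<le> b then X k $$ (a - ?s, b - ?s) else 0)"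
      if "a < ?s + rs ! k" "b < ?s + rs ! k" for a b
      unfolding e using IH(1) X[OF k] that by (subst dirsum_index) auto
    have c: "?D (Suc k) \<in> carrier_mat (?s + rs ! k) (?s + rs ! k)" unfolding e using IH(1) X[OF k] by (rule dirsum_carrier)
    moreover have "same_block rs a b" if ab: "a < ?s + rs ! k" "b < ?s + rs ! k" and "?D (Suc k) $$ (a,b) \<noteq> 0" for a b
    proof -
      have "(a < ?s \<and> b < ?s \<and> ?D k $$ (a,b) \<noteq> 0) \<or> (?s \<le> a \<and> ?s \<le> b)"
        using that(3) unfolding idx[OF ab] by (auto split: if_splits)
      then show ?thesis using IH(2) ab same_block_iff[OF k, of a b] by auto
    qed
    moreover have "?D (Suc k) $$ (blk_start rs i + a, blk_start rs i + b) = X i $$ (a,b)"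
      if i: "i < Suc k" and ab: "a < rs ! i" "b < rs ! i" for i a b
    proof (cases "i = k")
      case True
      then show ?thesis using ab by (subst idx) auto
    next
      case False
      then have ik: "i < k" using i by simp
      have "blk_start rs i + rs ! i \<le> ?s"
        using blk_start_mono[of "Suc i" k rs] ik k by (simp add: blk_start_Suc)
      then show ?thesis using ab ik IH(3)[OF ik ab] by (subst idx) auto
    qed
    ultimately show ?case by (simp add: blk_start_Suc[OF k] del: upt_Suc)
  qed
  note m = main[OF order.refl, unfolded blk_start_length]
  show "diag_block_mat (map X [0..<length rs]) \<in> carrier_mat (sum_list rs) (sum_list rs)" using m by blast
  show "block_diag_wrt rs (diag_block_mat (map X [0..<length rs]))" unfolding block_diag_iff using m by blast
  show "blk rs i (diag_block_mat (map X [0..<length rs])) = X i" if "i < length rs"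
    using m X[OF that] that by (intro eq_matI) (auto simp: blk_def)
qed

lemma diag_block_conj:
  fixes V X :: "'i \<Rightarrow> complex mat"
  assumes "\<And>i. i \<in> set is \<Longrightarrow> unitary_mat (d i) (V i)" "\<And>i. i \<in> set is \<Longrightarrow> X i \<in> carrier_mat (d i) (d i)"
  shows "unitary_mat (sum_list (map d is)) (diag_block_mat (map V is)) \<and>
    diag_block_mat (map (\<lambda>i. mat_adjoint (V i) * X i * V i) is)
      = mat_adjoint (diag_block_mat (map V is)) * diag_block_mat (map X is) * diag_block_mat (map V is)"
  using assms
proof (induct "is")
  case Nil
  show ?case by (auto intro!: unitaryI eq_matI)
next
  case (Cons i "is")
  let ?n = "sum_list (map d is)"
  have IH: "unitary_mat ?n (diag_block_mat (map V is))"
    "diag_block_mat (map (\<lambda>i. mat_adjoint (V i) * X i * V i) is)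
      = mat_adjoint (diag_block_mat (map V is)) * diag_block_mat (map X is) * diag_block_mat (map V is)"
    using Cons by auto
  have V: "unitary_mat (d i) (V i)" and X: "X i \<in> carrier_mat (d i) (d i)" using Cons.prems by auto
  have D: "diag_block_mat (map X is) \<in> carrier_mat ?n ?n"
    using Cons.prems by (intro diag_block_carrier) auto
  show ?case
    using dirsum_unitary[OF V IH(1)] unitaryD(1)[OF V] unitaryD(1)[OF IH(1)] X D
    by (simp add: diag_block_mat_Cons dirsum_adj dirsum_mult IH(2) del: diag_block_mat.simps(2))
qed

context splitting_data
begin

lemma blk_rep:
  assumes rep: "is_rep (sum_list rs) \<rho>" and bd: "\<And>f. f \<in> A \<Longrightarrow> block_diag_wrt rs (\<rho> f)" and i: "i < length rs"
  shows "is_rep (rs ! i) (\<lambda>f. blk rs i (\<rho> f))"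
  unfolding is_rep_def
proof (intro conjI ballI allI)
  have c: "\<rho> f \<in> carrier_mat (sum_list rs) (sum_list rs)" if "f \<in> A" for f using rep that by (simp add: is_rep_def)
  fix f g z
  assume f: "f \<in> A"
  show "blk rs i (\<rho> f) \<in> carrier_mat (rs ! i) (rs ! i)" by (rule blk_carrier)
  show "blk rs i (\<rho> (fsmult z f)) = z \<cdot>\<^sub>m blk rs i (\<rho> f)"
    using rep f blk_linear(2)[OF c[OF f] c[OF f] i] by (simp add: is_rep_def)
  show "blk rs i (\<rho> (fadj f)) = mat_adjoint (blk rs i (\<rho> f))"
    using rep f blk_linear(3)[OF c[OF f] c[OF f] i] by (simp add: is_rep_def)
  assume g: "g \<in> A"
  show "blk rs i (\<rho> (fadd f g)) = blk rs i (\<rho> f) + blk rs i (\<rho> g)"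
    using rep f g blk_linear(1)[OF c[OF f] c[OF g] i] by (simp add: is_rep_def)
  show "blk rs i (\<rho> (fmul f g)) = blk rs i (\<rho> f) * blk rs i (\<rho> g)"
    using rep f g blk_mult[OF c[OF f] bd[OF f] c[OF g] i] by (simp add: is_rep_def)
next
  have "\<rho> (funit m) = 1\<^sub>m (sum_list rs)" using rep by (simp add: is_rep_def)
  then show "blk rs i (\<rho> (funit m)) = 1\<^sub>m (rs ! i)"
    using blk_linear(4)[OF one_carrier_mat one_carrier_mat i] by simp
qed

text \<open>A unitary conjugate is the complement of a zero-dimensional summand, so the restriction
  result covers it.\<close>

lemma conj_rep:
  assumes rep: "is_rep n \<rho>" and U: "unitary_mat n U"
  shows "is_rep n (\<lambda>f. mat_adjoint U * \<rho> f * U)"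
proof -
  have "is_rep (0 + n) \<rho>" "unitary_mat (0 + n) U" using rep U by simp_all
  then show ?thesis
  proof (rule rep_restrict[where B = "\<lambda>_. 1\<^sub>m 0"])
    fix f assume "f \<in> A"
    then have r: "\<rho> f \<in> carrier_mat n n" using rep by (simp add: is_rep_def)
    have "dirsum (1\<^sub>m 0) (mat_adjoint U * \<rho> f * U) = mat_adjoint U * \<rho> f * U" by (rule dirsum_empty) simp
    then show "1\<^sub>m 0 \<in> carrier_mat 0 0 \<and> mat_adjoint U * \<rho> f * U \<in> carrier_mat n n \<and>
       \<rho> f = U * dirsum (1\<^sub>m 0) (mat_adjoint U * \<rho> f * U) * mat_adjoint U"
      using conj_unitary_inv(1)[OF U r] unitaryD(1)[OF U] r by (auto intro!: carrier_matI)
  qed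
qed

lemma nf_list_pieces: "is_nf nu om xs \<Longrightarrow> set (nf_list nu om xs) \<subseteq> pieces"
  by (auto simp: nf_list_def pieces_def is_nf_def)

text \<open>Every block has its own normal form, reached by a unitary of that block; together these
  unitaries form the block diagonal \<open>V\<close>. The concatenated piece list differs from the
  global normal form by trades, which change no matrix, and by a reordering, which is
  \<open>P\<close>. Thus \<open>P\<close> alone exhibits the blockwise normal forms, and
  \<open>P * V\<close> recovers the given representation exactly.\<close>

lemma endpoint_normal_form:
  assumes rep: "is_rep (sum_list rs) \<rho>" and bd: "\<And>f. f \<in> A \<Longrightarrow> block_diag_wrt rs (\<rho> f)"
  obtains nu om xs P V where
    "is_nf nu om xs" "tdim (nf_list nu om xs) = sum_list rs" "perm_matrix (sum_list rs) P"
    "unitary_mat (sum_list rs) V" "block_diag_wrt rs V"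
    "\<And>f. f \<in> A \<Longrightarrow> mat_adjoint (P * V) * D (nf_list nu om xs) f * (P * V) = \<rho> f"
    "\<And>f. f \<in> A \<Longrightarrow> block_diag_wrt rs (mat_adjoint P * D (nf_list nu om xs) f * P)"
    "\<And>i. i < length rs \<Longrightarrow> \<exists>nu' om' xs'. is_nf nu' om' xs' \<and>
       (\<forall>f\<in>A. blk rs i (mat_adjoint P * D (nf_list nu om xs) f * P) = D (nf_list nu' om' xs') f)"
proof -
  let ?n = "sum_list rs"
  have "\<forall>i\<in>{..<length rs}. \<exists>LV. (\<exists>nu om xs. is_nf nu om xs \<and> fst LV = nf_list nu om xs) \<and> tdim (fst LV) = rs ! i \<and>
     unitary_mat (rs ! i) (snd LV) \<and> (\<forall>f\<in>A. blk rs i (\<rho> f) = mat_adjoint (snd LV) * D (fst LV) f * snd LV)"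
  proof
    fix i assume "i \<in> {..<length rs}"
    then have "is_rep (rs ! i) (\<lambda>f. blk rs i (\<rho> f))" using blk_rep[OF rep bd] by simp
    then obtain nu om xs U where "is_nf nu om xs" "tdim (nf_list nu om xs) = rs ! i" "unitary_mat (rs ! i) U"
      "\<And>f. f \<in> A \<Longrightarrow> blk rs i (\<rho> f) = mat_adjoint U * D (nf_list nu om xs) f * U"
      by (rule rep_normal_form) blast
    then show "\<exists>LV. (\<exists>nu om xs. is_nf nu om xs \<and> fst LV = nf_list nu om xs) \<and> tdim (fst LV) = rs ! i \<and>
     unitary_mat (rs ! i) (snd LV) \<and> (\<forall>f\<in>A. blk rs i (\<rho> f) = mat_adjoint (snd LV) * D (fst LV) f * snd LV)"
      by (intro exI[of _ "(nf_list nu om xs, U)"]) auto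
  qed
  from bchoice[OF this] obtain LV where LV: "\<forall>i\<in>{..<length rs}. (\<exists>nu om xs. is_nf nu om xs \<and> fst (LV i) = nf_list nu om xs) \<and> tdim (fst (LV i)) = rs ! i \<and>
     unitary_mat (rs ! i) (snd (LV i)) \<and> (\<forall>f\<in>A. blk rs i (\<rho> f) = mat_adjoint (snd (LV i)) * D (fst (LV i)) f * snd (LV i))"
    by blast
  define L where "L i = fst (LV i)" for i
  define v where "v i = snd (LV i)" for i
  have L: "\<exists>nu om xs. is_nf nu om xs \<and> L i = nf_list nu om xs" "tdim (L i) = rs ! i" and v: "unitary_mat (rs ! i) (v i)"
    and \<rho>i: "\<And>f. f \<in> A \<Longrightarrow> blk rs i (\<rho> f) = mat_adjoint (v i) * D (L i) f * v i" if "i < length rs" for i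
    using LV that unfolding L_def v_def by blast+
  define V where "V = diag_block_mat (map v [0..<length rs])"
  have slen: "sum_list (map ((!) rs) [0..<length rs]) = ?n" by (simp add: map_nth)
  have DL: "D (L i) f \<in> carrier_mat (rs ! i) (rs ! i)" if "i < length rs" "f \<in> A" for i f
    using D_carrier[OF that(2), of "L i"] L(2)[OF that(1)] by simp
  have Vu: "unitary_mat ?n V"
    using diag_block_conj[of "[0..<length rs]" "(!) rs" v "\<lambda>i. 1\<^sub>m (rs ! i)"] v by (simp add: V_def slen)
  have Vb: "block_diag_wrt rs V"
    unfolding V_def using v unitaryD(1) by (intro diag_block_blocks(2)) blast
  have \<rho>V: "\<rho> f = mat_adjoint V * diag_block_mat (map (\<lambda>i. D (L i) f) [0..<length rs]) * V" if f: "f \<in> A" for f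
  proof -
    have "\<rho> f \<in> carrier_mat ?n ?n" using rep f by (simp add: is_rep_def)
    then have "\<rho> f = diag_block_mat (map (\<lambda>i. blk rs i (\<rho> f)) [0..<length rs])"
      using diag_block_of_blocks[OF bd[OF f]] by simp
    also have "map (\<lambda>i. blk rs i (\<rho> f)) [0..<length rs] = map (\<lambda>i. mat_adjoint (v i) * D (L i) f * v i) [0..<length rs]"
      using \<rho>i f by simp
    also have "diag_block_mat \<dots> = mat_adjoint V * diag_block_mat (map (\<lambda>i. D (L i) f) [0..<length rs]) * V"
      unfolding V_def using diag_block_conj[of "[0..<length rs]" "(!) rs" v "\<lambda>i. D (L i) f"] v DL f by simp
    finally show ?thesis .
  qed
  define cs where "cs = concat (map L [0..<length rs])"
  have Dcs: "diag_block_mat (map (\<lambda>i. D (L i) f) [0..<length rs]) = D cs f" for f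
    using diag_block_concat[of "map (\<lambda>i. map (\<lambda>c. ev c f) (L i)) [0..<length rs]"]
    by (simp add: cs_def map_concat comp_def)
  have "tdim (concat (map L [0..<k])) = sum_list (map ((!) rs) [0..<k])" if "k \<le> length rs" for k
    using that L(2) by (induct k) auto
  then have tcs: "tdim cs = ?n" using slen by (simp add: cs_def)
  have "set (L i) \<subseteq> pieces" if "i < length rs" for i using L(1)[OF that] nf_list_pieces by metis
  then have "set cs \<subseteq> pieces" by (fastforce simp: cs_def)
  then obtain nu om xs where nf: "is_nf nu om xs" and s: "sim cs (nf_list nu om xs)" using normal_form by blast
  obtain P where P: "perm_matrix ?n P" "\<And>f. f \<in> A \<Longrightarrow> D cs f = mat_adjoint P * D (nf_list nu om xs) f * P"
    using sim_perm[OF s] tcs by metis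
  have t: "tdim (nf_list nu om xs) = ?n" using simE[OF s] tcs by metis
  have E: "mat_adjoint P * D (nf_list nu om xs) f * P = diag_block_mat (map (\<lambda>i. D (L i) f) [0..<length rs])" if "f \<in> A" for f
    using P(2)[OF that] by (simp add: Dcs)
  have Dc: "D (nf_list nu om xs) f \<in> carrier_mat ?n ?n" if "f \<in> A" for f
    using D_carrier[OF that, of "nf_list nu om xs"] t by simp
  show ?thesis
  proof (rule that[OF nf t P(1) Vu Vb])
    fix f assume f: "f \<in> A"
    show "mat_adjoint (P * V) * D (nf_list nu om xs) f * (P * V) = \<rho> f"
      using conj_mult[OF unitaryD(1)[OF perm_matrix_unitary[OF P(1)]] unitaryD(1)[OF Vu] Dc[OF f]] E[OF f] \<rho>V[OF f] by simp
    show "block_diag_wrt rs (mat_adjoint P * D (nf_list nu om xs) f * P)"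
      unfolding E[OF f] by (rule diag_block_blocks(2)) (rule DL[OF _ f])
  next
    fix i assume i: "i < length rs"
    obtain nu' om' xs' where L': "is_nf nu' om' xs'" "L i = nf_list nu' om' xs'" using L(1)[OF i] by blast
    have "blk rs i (mat_adjoint P * D (nf_list nu om xs) f * P) = D (L i) f" if f: "f \<in> A" for f
      unfolding E[OF f] by (rule diag_block_blocks(3)[OF DL[OF _ f] i])
    then show "\<exists>nu' om' xs'. is_nf nu' om' xs' \<and>
       (\<forall>f\<in>A. blk rs i (mat_adjoint P * D (nf_list nu om xs) f * P) = D (nf_list nu' om' xs') f)"
      using L' by metis
  qed
qed

end

section \<open>Homomorphisms as families of representations, and continuity of normal forms\<close>

lemma pointwise_apply [simp]:
  "fadd f g t = f t + g t" "fsmult c f t = c \<cdot>\<^sub>m f t" "fmul f g t = f t * g t"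
  "fadj f t = mat_adjoint (f t)" "fminus f g t = f t - g t" "funit n t = 1\<^sub>m n"
  by (simp_all add: fadd_def fsmult_def fmul_def fadj_def fminus_def funit_def)

context splitting_data
begin

lemma is_rep_cong:
  assumes "is_rep n \<rho>" "\<And>f. f \<in> A \<Longrightarrow> \<rho>' f = \<rho> f"
  shows "is_rep n \<rho>'"
  using assms unfolding is_rep_def by (auto simp: closed funit_in)

lemma hom_rep:
  assumes "unital_star_hom m ps qs m' ps' qs' \<phi>"
  shows "is_rep m' (\<lambda>f. \<phi> f t)"
proof -
  have "\<phi> f t \<in> carrier_mat m' m'" if "f \<in> A" for f
    using assms that S_algD(1) unfolding unital_star_hom_def by blast
  then show ?thesis using assms unfolding is_rep_def unital_star_hom_def by simp
qed

lemma rep_hom: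
  assumes "\<And>f. f \<in> A \<Longrightarrow> \<psi> f \<in> S_alg m' ps' qs'" "\<And>t. is_rep m' (\<lambda>f. \<psi> f t)"
  shows "unital_star_hom m ps qs m' ps' qs' \<psi>"
  using assms unfolding unital_star_hom_def is_rep_def by (auto intro!: ext)

lemma nf_list_split: "nf_list nu om xs = nf_list nu om [] @ map PX xs"
  by (simp add: nf_list_def)

lemma D_nf_continuous:
  fixes xs :: "real \<Rightarrow> real list"
  assumes f: "f \<in> A" and len: "\<And>t. t \<in> {0..1} \<Longrightarrow> length (xs t) = \<mu>"
    and range: "\<And>t k. t \<in> {0..1} \<Longrightarrow> k < \<mu> \<Longrightarrow> xs t ! k \<in> {0..1}"
    and cont: "\<And>k. k < \<mu> \<Longrightarrow> continuous_on {0..1} (\<lambda>t. xs t ! k)"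
    and ij: "i < tdim (nf_list nu om (xs 0))" "j < tdim (nf_list nu om (xs 0))"
  shows "continuous_on {0..1} (\<lambda>t. D (nf_list nu om (xs t)) f $$ (i,j))"
proof -
  \<comment> \<open>The normal form as one list of matrix functions of \<open>t\<close>: constant
    ones for the endpoint blocks, and \<open>f\<close> along each moving point.\<close>
  define gs where "gs = map (\<lambda>c (t::real). ev c f) (nf_list nu om []) @ map (\<lambda>k t. f (xs t ! k)) [0..<\<mu>]"
  define d where "d = (\<lambda>g :: real \<Rightarrow> complex mat. dim_row (g 0))"
  have D: "D (nf_list nu om (xs t)) f = diag_block_mat (map (\<lambda>g. g t) gs)" if "t \<in> {0..1}" for t
  proof -
    have "map f (xs t) = map (\<lambda>k. f (xs t ! k)) [0..<\<mu>]"
      by (intro nth_equalityI) (auto simp: len[OF that])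
    then show ?thesis by (subst nf_list_split) (simp add: gs_def comp_def)
  qed
  have "dim_row (D (nf_list nu om (xs 0)) f) = sum_list (map d gs)"
    unfolding D[of 0, simplified] dim_diag_block_mat by (simp add: d_def comp_def)
  then have tot: "tdim (nf_list nu om (xs 0)) = sum_list (map d gs)"
    using D_carrier[OF f, of "nf_list nu om (xs 0)"] by simp
  have "continuous_on {0..1} (\<lambda>t. diag_block_mat (map (\<lambda>g. g t) gs) $$ (i,j))"
  proof (rule diag_block_continuous[where d = d])
    fix g assume "g \<in> set gs"
    then consider c where "g = (\<lambda>t. ev c f)" | k where "k < \<mu>" "g = (\<lambda>t. f (xs t ! k))"
      unfolding gs_def by auto
    note cases = this
    show "g t \<in> carrier_mat (d g) (d g)" for t
      using cases
    proof cases
      case 1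
      then show ?thesis using ev_carrier[OF f, of c] by (simp add: d_def)
    next
      case 2
      then show ?thesis using S_algD(1,2)[OF f] by (simp add: d_def)
    qed
    fix i j assume ij: "i < d g" "j < d g"
    show "continuous_on {0..1} (\<lambda>t. g t $$ (i,j))"
      using cases
    proof cases
      case 1
      then show ?thesis by simp
    next
      case 2
      then have "i < m" "j < m" using ij S_algD(2)[OF f] by (auto simp: d_def)
      then show ?thesis unfolding 2(2)
        by (intro continuous_on_compose2[OF S_algD(5)[OF f] cont[OF 2(1)]]) (use range 2(1) in auto)
    qed
  qed (use ij tot in auto)
  then show ?thesis by (subst continuous_on_cong[OF refl D[THEN arg_cong]]) auto
qed

end

theorem theorem2p10:
  fixes m m' :: nat and ps qs ps' qs' :: "nat list"
    and \<phi> :: "(real \<Rightarrow> complex mat) \<Rightarrow> (real \<Rightarrow> complex mat)"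
  assumes "split_data m ps qs" and "split_data m' ps' qs'"
    and "unital_star_hom m ps qs m' ps' qs' \<phi>"
  shows "\<exists>\<psi>. unital_star_hom m ps qs m' ps' qs' \<psi>
    \<and> approx_unit_equiv m ps qs m' ps' qs' \<phi> \<psi>
    \<and> (\<exists>(U :: real \<Rightarrow> complex mat) (nu :: nat list) (om :: nat list) (lams :: (real \<Rightarrow> real) list).
          (\<forall>t\<in>{0..1}. unitary_mat m' (U t))
        \<and> (\<forall>i<m'. \<forall>j<m'. continuous_on {0..1} (\<lambda>t. U t $$ (i,j)))
        \<and> perm_matrix m' (U 0) \<and> perm_matrix m' (U 1)
        \<and> length nu = length ps \<and> (\<exists>i<length ps. nu ! i = 0)
        \<and> length om = length qs \<and> (\<exists>j<length qs. om ! j = 0)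
        \<and> (\<forall>l\<in>set lams. continuous_on {0..1} l \<and> l ` {0..1} \<subseteq> {0..1})
        \<and> (\<forall>t\<in>{0..1}. sorted (map (\<lambda>l. l t) lams))
        \<and> (\<Sum>i<length ps. nu ! i * ps ! i) + (\<Sum>j<length qs. om ! j * qs ! j) + length lams * m = m'
        \<and> (\<forall>f\<in>S_alg m ps qs. \<forall>t\<in>{0..1}.
             \<psi> f t = mat_adjoint (U t)
                     * diag_block_mat ([Lambda ps nu (f 0), Lambda qs om (f 1)] @ map (\<lambda>l. f (l t)) lams)
                     * U t))
    \<and> (\<forall>i<length ps'. \<exists>(nu :: nat list) (om :: nat list) (xs :: real list).
          length nu = length ps \<and> (\<exists>k<length ps. nu ! k = 0)
        \<and> length om = length qs \<and> (\<exists>k<length qs. om ! k = 0)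
        \<and> sorted xs \<and> set xs \<subseteq> {0..1}
        \<and> (\<forall>f\<in>S_alg m ps qs.
             blk ps' i (\<psi> f 0) = diag_block_mat ([Lambda ps nu (f 0), Lambda qs om (f 1)] @ map f xs)))
    \<and> (\<forall>j<length qs'. \<exists>(nu :: nat list) (om :: nat list) (xs :: real list).
          length nu = length ps \<and> (\<exists>k<length ps. nu ! k = 0)
        \<and> length om = length qs \<and> (\<exists>k<length qs. om ! k = 0)
        \<and> sorted xs \<and> set xs \<subseteq> {0..1}
        \<and> (\<forall>f\<in>S_alg m ps qs.
             blk qs' j (\<psi> f 1) = diag_block_mat ([Lambda ps nu (f 0), Lambda qs om (f 1)] @ map f xs)))"
proof -
  interpret A: splitting_data m ps qs using assms(1) by unfold_locales
  interpret B: splitting_data m' ps' qs' using assms(2) by unfold_locales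
  let ?A = "S_alg m ps qs" and ?B = "S_alg m' ps' qs'"
  have \<phi>B: "\<phi> f \<in> ?B" if "f \<in> ?A" for f using assms(3) that by (simp add: unital_star_hom_def)
  note \<phi>D = S_algD[OF \<phi>B]
  have rep: "A.is_rep m' (\<lambda>f. \<phi> f t)" for t by (rule A.hom_rep[OF assms(3)])
  have r0: "A.is_rep (sum_list ps') (\<lambda>f. \<phi> f 0)" and r1: "A.is_rep (sum_list qs') (\<lambda>f. \<phi> f 1)"
    using rep B.sums by simp_all
  obtain nu0 om0 xs0 Q0 V0 where
    nf0: "A.is_nf nu0 om0 xs0" "A.tdim (A.nf_list nu0 om0 xs0) = m'" and Q0: "perm_matrix m' Q0"
    and V0: "unitary_mat m' V0" "block_diag_wrt ps' V0"
    and X0: "\<And>f. f \<in> ?A \<Longrightarrow> mat_adjoint (Q0 * V0) * A.D (A.nf_list nu0 om0 xs0) f * (Q0 * V0) = \<phi> f 0"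
    and E0: "\<And>f. f \<in> ?A \<Longrightarrow> block_diag_wrt ps' (mat_adjoint Q0 * A.D (A.nf_list nu0 om0 xs0) f * Q0)"
    and B0: "\<And>i. i < length ps' \<Longrightarrow> \<exists>nu om xs. A.is_nf nu om xs \<and>
       (\<forall>f\<in>?A. blk ps' i (mat_adjoint Q0 * A.D (A.nf_list nu0 om0 xs0) f * Q0) = A.D (A.nf_list nu om xs) f)"
    by (rule A.endpoint_normal_form[OF r0 \<phi>D(6), unfolded B.sums(1)]) (assumption, rule that)
  obtain nu1 om1 xs1 Q1 V1 where
    nf1: "A.is_nf nu1 om1 xs1" "A.tdim (A.nf_list nu1 om1 xs1) = m'" and Q1: "perm_matrix m' Q1"
    and V1: "unitary_mat m' V1" "block_diag_wrt qs' V1"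
    and X1: "\<And>f. f \<in> ?A \<Longrightarrow> mat_adjoint (Q1 * V1) * A.D (A.nf_list nu1 om1 xs1) f * (Q1 * V1) = \<phi> f 1"
    and E1: "\<And>f. f \<in> ?A \<Longrightarrow> block_diag_wrt qs' (mat_adjoint Q1 * A.D (A.nf_list nu1 om1 xs1) f * Q1)"
    and B1: "\<And>i. i < length qs' \<Longrightarrow> \<exists>nu om xs. A.is_nf nu om xs \<and>
       (\<forall>f\<in>?A. blk qs' i (mat_adjoint Q1 * A.D (A.nf_list nu1 om1 xs1) f * Q1) = A.D (A.nf_list nu om xs) f)"
    by (rule A.endpoint_normal_form[OF r1 \<phi>D(7), unfolded B.sums(2)]) (assumption, rule that)
  have Q0u: "unitary_mat m' Q0" and Q1u: "unitary_mat m' Q1" using Q0 Q1 by (auto intro: perm_matrix_unitary)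

  define T where "T t z \<longleftrightarrow> (case z of (nu, om, xs) \<Rightarrow> A.is_nf nu om xs \<and> A.tdim (A.nf_list nu om xs) = m' \<and>
    (\<exists>W. unitary_mat m' W \<and> (\<forall>f\<in>?A. mat_adjoint W * A.D (A.nf_list nu om xs) f * W = \<phi> f t)))" for t z
  \<comment> \<open>At 0 and 1 the data are prescribed, so that the family agrees there with the
    normal forms for which the permutation matrices were built.\<close>
  have "\<forall>t\<in>{0..1}. \<exists>z. T t z \<and> (t = 0 \<longrightarrow> z = (nu0, om0, xs0)) \<and> (t = 1 \<longrightarrow> z = (nu1, om1, xs1))"
  proof
    fix t :: real assume "t \<in> {0..1}"
    consider "t = 0" | "t = 1" | "t \<noteq> 0" "t \<noteq> 1" by blast
    then show "\<exists>z. T t z \<and> (t = 0 \<longrightarrow> z = (nu0, om0, xs0)) \<and> (t = 1 \<longrightarrow> z = (nu1, om1, xs1))"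
    proof cases
      case 1
      then show ?thesis using nf0 X0 unitary_mult[OF Q0u V0(1)] by (auto simp: T_def)
    next
      case 2
      then show ?thesis using nf1 X1 unitary_mult[OF Q1u V1(1)] by (auto simp: T_def)
    next
      case 3
      obtain nu om xs U where "A.is_nf nu om xs" "A.tdim (A.nf_list nu om xs) = m'" "unitary_mat m' U"
        "\<And>f. f \<in> ?A \<Longrightarrow> \<phi> f t = mat_adjoint U * A.D (A.nf_list nu om xs) f * U"
        by (rule A.rep_normal_form[OF rep[of t]]) blast
      then have "T t (nu, om, xs)" unfolding T_def by (auto intro!: exI[of _ U])
      then show ?thesis using 3 by blast
    qed
  qed
  from bchoice[OF this] obtain z where
    zT: "\<forall>t\<in>{0..1}. T t (z t) \<and> (t = 0 \<longrightarrow> z t = (nu0, om0, xs0)) \<and> (t = 1 \<longrightarrow> z t = (nu1, om1, xs1))" ..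
  have z: "\<And>t. t \<in> {0..1} \<Longrightarrow> T t (z t)" and z01: "z 0 = (nu0, om0, xs0)" "z 1 = (nu1, om1, xs1)"
    using zT by auto
  define nu om xs where "nu t = fst (z t)" and "om t = fst (snd (z t))" and "xs t = snd (snd (z t))" for t
  have T: "A.is_nf (nu t) (om t) (xs t)" "A.tdim (A.nf_list (nu t) (om t) (xs t)) = m'"
    "\<exists>W. unitary_mat m' W \<and> (\<forall>f\<in>?A. mat_adjoint W * A.D (A.nf_list (nu t) (om t) (xs t)) f * W = \<phi> f t)" if "t \<in> {0..1}" for t
    using z[OF that] by (auto simp: T_def nu_def om_def xs_def split: prod.splits)
  \<comment> \<open>The intertwiners are chosen separately for each \<open>t\<close>, but the trace
    does not see them and equals that of \<open>\<phi> f t\<close>.\<close>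
  have trace: "continuous_on {0..1} (\<lambda>t. mat_trace (A.D (A.nf_list (nu t) (om t) (xs t)) f))" if f: "f \<in> ?A" for f
  proof -
    have "mat_trace (A.D (A.nf_list (nu t) (om t) (xs t)) f) = (\<Sum>i<m'. \<phi> f t $$ (i,i))" if t: "t \<in> {0..1}" for t
    proof -
      obtain W where "unitary_mat m' W" "mat_adjoint W * A.D (A.nf_list (nu t) (om t) (xs t)) f * W = \<phi> f t"
        using T(3)[OF t] f by blast
      then have "mat_trace (\<phi> f t) = mat_trace (A.D (A.nf_list (nu t) (om t) (xs t)) f)"
        using mat_trace_unitary_conj[of m' W "A.D (A.nf_list (nu t) (om t) (xs t)) f"] A.D_carrier[OF f, of "A.nf_list (nu t) (om t) (xs t)"] T(2)[OF t] by simp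
      then show ?thesis using \<phi>D(2)[OF f] by (simp add: mat_trace_def)
    qed
    moreover have "continuous_on {0..1} (\<lambda>t. \<Sum>i<m'. \<phi> f t $$ (i,i))"
      using \<phi>D(5)[OF f] by (intro continuous_intros) auto
    ultimately show ?thesis by (subst continuous_on_cong) auto
  qed
  have fam: "nu t = nu 0" "om t = om 0" "length (xs t) = length (xs 0)" if "t \<in> {0..1}" for t
    by (rule A.normal_form_family(1-3)[where nu = nu and om = om and xs = xs, OF T(1,2) trace]; use that in auto)+
  have famc: "continuous_on {0..1} (\<lambda>t. xs t ! k)" if "k < length (xs 0)" for k
    by (rule A.normal_form_family(4)[where nu = nu and om = om and xs = xs, OF T(1,2) trace]; use that in auto)
  have init: "nu 0 = nu0" "om 0 = om0" "xs 0 = xs0" and fin: "nu 1 = nu1" "om 1 = om1" "xs 1 = xs1"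
    using z01 by (simp_all add: nu_def om_def xs_def)
  have const: "nu t = nu0" "om t = om0" "length (xs t) = length xs0" if "t \<in> {0..1}" for t
    using fam[OF that] init by simp_all
  \<comment> \<open>Constancy of the multiplicities along the interval identifies the two endpoint
    computations, so \<open>Q0\<close> and \<open>Q1\<close> conjugate members of one and the same
    family.\<close>
  have eq1: "nu1 = nu0" "om1 = om0" using const[of 1] fin by simp_all
  define \<mu> where "\<mu> = length xs0"
  define cs where "cs t = A.nf_list nu0 om0 (xs t)" for t
  have nft: "A.is_nf nu0 om0 (xs t)" "A.tdim (cs t) = m'"
    "\<exists>W. unitary_mat m' W \<and> (\<forall>f\<in>?A. mat_adjoint W * A.D (cs t) f * W = \<phi> f t)" if "t \<in> {0..1}" for t
    using T[OF that] const[OF that] by (simp_all add: cs_def)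
  have xs01: "xs t ! k \<in> {0..1}" if "t \<in> {0..1}" "k < \<mu>" for t k
  proof -
    have "set (xs t) \<subseteq> {0..1}" using nft(1)[OF that(1)] unfolding A.is_nf_def by blast
    moreover have "xs t ! k \<in> set (xs t)" using const(3)[OF that(1)] that(2) by (simp add: \<mu>_def)
    ultimately show ?thesis by blast
  qed
  have xsc: "continuous_on {0..1} (\<lambda>t. xs t ! k)" if "k < \<mu>" for k
    using famc[of k] that init by (simp add: \<mu>_def)
  have Dc: "A.D (cs t) f \<in> carrier_mat m' m'" if "f \<in> ?A" "t \<in> {0..1}" for f t
    using A.D_carrier[OF that(1), of "cs t"] nft(2)[OF that(2)] by simp
  have Dcont: "continuous_on {0..1} (\<lambda>t. A.D (cs t) f $$ (i,j))" if "f \<in> ?A" "i < m'" "j < m'" for f i j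
    unfolding cs_def using that const(3) xs01 xsc nft(2)[of 0]
    by (intro A.D_nf_continuous[where \<mu> = \<mu>]) (auto simp: \<mu>_def cs_def)
  interpret J: intertwining m' ?A "\<lambda>f t. A.D (cs t) f" \<phi>
    using Dc Dcont \<phi>D(1,5) by unfold_locales auto
  have Jne: "J.I t \<noteq> {}" if "t \<in> {0..1}" for t
    using nft(3)[OF that] by (auto simp: J.I_def)
  have cs0: "cs 0 = A.nf_list nu0 om0 xs0" and cs1: "cs 1 = A.nf_list nu1 om1 xs1"
    by (simp_all add: cs_def init fin eq1)
  have JX0: "Q0 * V0 \<in> J.I 0" and JX1: "Q1 * V1 \<in> J.I 1"
    using X0 X1 unitary_mult[OF Q0u V0(1)] unitary_mult[OF Q1u V1(1)]
    by (simp_all add: J.I_def cs0 cs1)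

  obtain U where arc: "unitary_arc m' Q0 Q1 U" using unitary_path[OF Q0u Q1u] .
  have Uu: "unitary_mat m' (U t)" and Ucont: "i < m' \<Longrightarrow> j < m' \<Longrightarrow> continuous_on {0..1} (\<lambda>t. U t $$ (i,j))"
    and U01: "U 0 = Q0" "U 1 = Q1" for t i j
    using arc continuous_on_subset[OF _ subset_UNIV] unfolding unitary_arc_def by blast+
  note Uc = unitaryD[OF Uu]
  define \<psi> where "\<psi> f t = mat_adjoint (U (clamp01 t)) * A.D (cs (clamp01 t)) f * U (clamp01 t)" for f t
  have \<psi>t: "\<psi> f t = mat_adjoint (U t) * A.D (cs t) f * U t" if "t \<in> {0..1}" for f t
    using that by (simp add: \<psi>_def)
  \<comment> \<open>At each point \<open>\<psi>\<close> is a unitary conjugate of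
    \<open>\<phi>\<close>, via the normal form, so the algebraic laws carry over without any
    continuity of the conjugating matrices.\<close>
  have \<psi>rep: "A.is_rep m' (\<lambda>f. \<psi> f t)" for t
  proof -
    let ?t = "clamp01 t"
    obtain W where W: "unitary_mat m' W" and WD: "\<And>f. f \<in> ?A \<Longrightarrow> mat_adjoint W * A.D (cs ?t) f * W = \<phi> f ?t"
      using nft(3)[of ?t] by auto
    let ?Y = "mat_adjoint W * U ?t"
    have \<psi>Y: "\<psi> f t = mat_adjoint ?Y * \<phi> f ?t * ?Y" if f: "f \<in> ?A" for f
    proof -
      have "W * \<phi> f ?t * mat_adjoint W = A.D (cs ?t) f"
        using conj_unitary_inv(1)[OF W Dc[OF f, of ?t]] WD[OF f] by simp
      then show ?thesis
        using conj_mult[OF unitaryD(2)[OF W] Uc(1) \<phi>D(1)[OF f]] by (simp add: \<psi>_def)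
    qed
    show ?thesis
      by (rule A.is_rep_cong[OF A.conj_rep[OF rep unitary_mult[OF unitary_adj[OF W] Uu]] \<psi>Y])
  qed
  have \<psi>0: "\<psi> f 0 = mat_adjoint Q0 * A.D (A.nf_list nu0 om0 xs0) f * Q0" for f
    by (simp add: \<psi>t U01 cs0)
  have \<psi>1: "\<psi> f 1 = mat_adjoint Q1 * A.D (A.nf_list nu1 om1 xs1) f * Q1" for f
    by (simp add: \<psi>t U01 cs1)
  have \<psi>B: "\<psi> f \<in> ?B" if f: "f \<in> ?A" for f
  proof -
    have "\<psi> f t \<in> carrier_mat m' m'" for t using \<psi>rep f by (simp add: A.is_rep_def)
    moreover have "\<psi> f t = \<psi> f (clamp01 t)" for t by (simp add: \<psi>_def)
    moreover have "continuous_on {0..1} (\<lambda>t. \<psi> f t $$ (i,j))" if ij: "i < m'" "j < m'" for i j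
    proof -
      have "\<psi> f t $$ (i,j) = (\<Sum>y<m'. (\<Sum>x<m'. cnj (U t $$ (x,i)) * A.D (cs t) f $$ (x,y)) * U t $$ (y,j))" if "t \<in> {0..1}" for t
        unfolding \<psi>t[OF that] by (rule conj_index[OF Uc(1) Dc[OF f that] ij])
      moreover have "continuous_on {0..1} (\<lambda>t. \<Sum>y<m'. (\<Sum>x<m'. cnj (U t $$ (x,i)) * A.D (cs t) f $$ (x,y)) * U t $$ (y,j))"
        using Ucont Dcont[OF f] ij by (intro continuous_intros) auto
      ultimately show ?thesis by (subst continuous_on_cong) auto
    qed
    moreover have "block_diag_wrt ps' (\<psi> f 0)" "block_diag_wrt qs' (\<psi> f 1)"
      unfolding \<psi>0 \<psi>1 using E0[OF f] E1[OF f] by blast+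
    ultimately show ?thesis unfolding S_alg_def by blast
  qed
  have hom: "unital_star_hom m ps qs m' ps' qs' \<psi>" using \<psi>B \<psi>rep by (rule A.rep_hom)

  have "\<forall>k. mpath m' (J.good (inverse (real (Suc k)))) 0 1 (Q0 * V0) (Q1 * V1)"
    using J.intertwining_path[OF Jne _ JX0 JX1] by simp
  then have "\<forall>k. \<exists>W. (\<forall>t\<in>{0..1}. J.good (inverse (real (Suc k))) t (W t)) \<and>
     (\<forall>i<m'. \<forall>j<m'. continuous_on {0..1} (\<lambda>t. W t $$ (i,j))) \<and> W 0 = Q0 * V0 \<and> W 1 = Q1 * V1"
    unfolding mpath_def .
  from choice[OF this] obtain W where W: "\<And>k t. t \<in> {0..1} \<Longrightarrow> J.good (inverse (real (Suc k))) t (W k t)"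
    and Wcont: "\<And>k i j. i < m' \<Longrightarrow> j < m' \<Longrightarrow> continuous_on {0..1} (\<lambda>t. W k t $$ (i,j))"
    and W01: "\<And>k. W k 0 = Q0 * V0" "\<And>k. W k 1 = Q1 * V1"
    by blast
  have Wu: "unitary_mat m' (W k t)" if "t \<in> {0..1}" for k t using W[OF that] by (simp add: J.good_def)
  \<comment> \<open>Divides the intertwining path by \<open>U\<close>. At the ends \<open>W\<close>
    is \<open>Q0 * V0\<close> and \<open>Q1 * V1\<close> while \<open>U\<close> is \<open>Q0\<close>
    and \<open>Q1\<close>; the block diagonal factors remain, which places \<open>u k\<close> in
    B.\<close>
  define u where "u k t = mat_adjoint (U (clamp01 t)) * W k (clamp01 t)" for k :: nat and t
  have uu: "unitary_mat m' (u k t)" for k t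
    unfolding u_def by (intro unitary_mult unitary_adj Uu Wu) simp
  have uB: "u k \<in> ?B" for k
  proof -
    have "continuous_on {0..1} (\<lambda>t. u k t $$ (i,j))" if ij: "i < m'" "j < m'" for i j
    proof -
      have "u k t $$ (i,j) = (\<Sum>x<m'. cnj (U t $$ (x,i)) * W k t $$ (x,j))" if t: "t \<in> {0..1}" for t
      proof -
        have "u k t $$ (i,j) = (\<Sum>x<m'. mat_adjoint (U t) $$ (i,x) * W k t $$ (x,j))"
          using t mult_index[OF Uc(2) unitaryD(1)[OF Wu[OF t]] ij] by (simp add: u_def del: index_mult_mat)
        then show ?thesis using ij Uc(1)[of t] by simp
      qed
      moreover have "continuous_on {0..1} (\<lambda>t. \<Sum>x<m'. cnj (U t $$ (x,i)) * W k t $$ (x,j))"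
        using Ucont Wcont ij by (intro continuous_intros) auto
      ultimately show ?thesis by (subst continuous_on_cong) auto
    qed
    moreover have "u k 0 = V0" "u k 1 = V1"
      using unitary_cancel(1)[OF Q0u, of V0] unitary_cancel(1)[OF Q1u, of V1] unitaryD(1)[OF V0(1)] unitaryD(1)[OF V1(1)]
      by (simp_all add: u_def U01 W01)
    moreover have "u k t = u k (clamp01 t)" for t by (simp add: u_def)
    ultimately show ?thesis using V0(2) V1(2) unitaryD(1)[OF uu] unfolding S_alg_def by auto
  qed
  have aue: "approx_unit_equiv m ps qs m' ps' qs' \<phi> \<psi>"
    unfolding approx_unit_equiv_def
  proof (intro exI[of _ u] conjI allI ballI)
    fix a assume a: "a \<in> ?A"
    let ?E = "\<lambda>k. fminus (fmul (fmul (fadj (u k)) (\<psi> a)) (u k)) (\<phi> a)"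
    \<comment> \<open>In conjugating \<open>\<psi>\<close> by \<open>u\<close> the matrices
      \<open>U\<close> cancel; what is left compares the normal form conjugated by \<open>W\<close>
      with \<open>\<phi>\<close>.\<close>
    have E: "?E k t = mat_adjoint (W k t) * A.D (cs t) a * W k t - \<phi> a t" if t: "t \<in> {0..1}" for k t
    proof -
      have X: "\<psi> a t \<in> carrier_mat m' m'" using \<psi>rep a by (simp add: A.is_rep_def)
      have "U t * \<psi> a t * mat_adjoint (U t) = A.D (cs t) a"
        unfolding \<psi>t[OF t] by (rule conj_unitary_inv(1)[OF Uu Dc[OF a t]])
      then show ?thesis
        using conj_mult[OF Uc(2)[of t] unitaryD(1)[OF Wu[OF t, of k]] X] t by (simp add: u_def)
    qed
    show "(\<lambda>k. fnorm (?E k)) \<longlonglongrightarrow> 0"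
    proof (rule LIMSEQ_I)
      fix r :: real assume r: "0 < r"
      \<comment> \<open>Passing to the operator norm costs the square of \<open>m'\<close>; the half
        yields a strict inequality.\<close>
      define \<eta> where "\<eta> = r / 2 / ((real m')\<^sup>2 + 1)"
      have p: "(real m')\<^sup>2 + 1 > 0" by (simp add: add_nonneg_pos)
      have \<eta>: "0 < \<eta>" using r p by (simp add: \<eta>_def)
      have "(real m')\<^sup>2 * \<eta> \<le> ((real m')\<^sup>2 + 1) * \<eta>" using \<eta> by (simp add: mult_right_mono)
      also have "\<dots> = r / 2"
      proof -
        have "x * (r / 2 / x) = r / 2" if "x > 0" for x :: real using that by simp
        then show ?thesis unfolding \<eta>_def using p by blast
      qed
      finally have \<eta>r: "(real m')\<^sup>2 * \<eta> < r" using r by linarith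
      obtain e where e: "0 < e" and est: "\<And>t W e'. t \<in> {0..1} \<Longrightarrow> e' \<le> e \<Longrightarrow> J.good e' t W \<Longrightarrow> entry_bounded m' \<eta> (mat_adjoint W * A.D (cs t) a * W - \<phi> a t)"
        using J.good_estimate[OF a \<eta>] by metis
      obtain K where K: "inverse (real (Suc K)) < e" using reals_Archimedean[OF e] by blast
      have "norm (fnorm (?E k) - 0) < r" if "K \<le> k" for k
      proof -
        have "inverse (real (Suc k)) \<le> inverse (real (Suc K))" using that by (intro le_imp_inverse_le) auto
        then have le: "inverse (real (Suc k)) \<le> e" using K by linarith
        have "\<bar>fnorm (?E k)\<bar> \<le> (real m')\<^sup>2 * \<eta>"
        proof (rule fnorm_bound)
          fix t :: real assume t: "t \<in> {0..1}"
          show "?E k t \<in> carrier_mat m' m'" unfolding E[OF t] using \<phi>D(1)[OF a] by (rule minus_carrier_mat)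
          show "entry_bounded m' \<eta> (?E k t)" unfolding E[OF t] using est[OF t le W[OF t]] .
        qed (use \<eta> in simp)
        then show ?thesis using \<eta>r by simp
      qed
      then show "\<exists>K. \<forall>k\<ge>K. norm (fnorm (?E k) - 0) < r" by blast
    qed
  qed (use uB uu in auto)

  define lams where "lams = map (\<lambda>k t. xs t ! k) [0..<\<mu>]"
  have lams_at: "map (\<lambda>l. l t) lams = xs t" if "t \<in> {0..1}" for t
    using const(3)[OF that] by (auto simp: lams_def \<mu>_def intro: nth_equalityI)
  have len: "length lams = length (xs 0)" by (simp add: lams_def \<mu>_def init)
  have nf: "length nu0 = length ps" "\<exists>i<length ps. nu0 ! i = 0" "length om0 = length qs" "\<exists>j<length qs. om0 ! j = 0"
    using nf0(1) by (simp_all add: A.is_nf_def)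
  have dims: "(\<Sum>i<length ps. nu0 ! i * ps ! i) + (\<Sum>j<length qs. om0 ! j * qs ! j) + length lams * m = m'"
    using nf0(2) by (simp add: A.tdim_nf_list len init)
  have l1: "\<forall>l\<in>set lams. continuous_on {0..1} l \<and> l ` {0..1} \<subseteq> {0..1}"
    using xsc xs01 by (auto simp: lams_def)
  have l2: "\<forall>t\<in>{0..1}. sorted (map (\<lambda>l. l t) lams)"
    using nft(1) lams_at by (simp add: A.is_nf_def)
  have form: "\<psi> f t = mat_adjoint (U t) * diag_block_mat ([Lambda ps nu0 (f 0), Lambda qs om0 (f 1)] @ map (\<lambda>l. f (l t)) lams) * U t"
    if "t \<in> {0..1}" for f t
  proof -
    have "map (\<lambda>l. f (l t)) lams = map f (xs t)" by (simp flip: lams_at[OF that] add: comp_def)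
    then show ?thesis using \<psi>t[OF that, of f] by (simp only: cs_def A.D_nf_list)
  qed
  \<comment> \<open>As \<open>\<psi>\<close> at the endpoints is the normal form conjugated by
    \<open>Q0\<close> and \<open>Q1\<close> alone, the blockwise normal forms are literally the
    second claim.\<close>
  note blocks = B0[folded \<psi>0, unfolded A.D_nf_list A.is_nf_def conj_assoc]
    B1[folded \<psi>1, unfolded A.D_nf_list A.is_nf_def conj_assoc]
  have Uperm: "perm_matrix m' (U 0)" "perm_matrix m' (U 1)" using Q0 Q1 by (simp_all add: U01)
  show ?thesis
  proof (intro exI[of _ \<psi>] conjI)
    show "unital_star_hom m ps qs m' ps' qs' \<psi>" by (rule hom)
    show "approx_unit_equiv m ps qs m' ps' qs' \<phi> \<psi>" by (rule aue)
    show "\<exists>(U :: real \<Rightarrow> complex mat) (nu :: nat list) (om :: nat list) (lams :: (real \<Rightarrow> real) list).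
          (\<forall>t\<in>{0..1}. unitary_mat m' (U t))
        \<and> (\<forall>i<m'. \<forall>j<m'. continuous_on {0..1} (\<lambda>t. U t $$ (i,j)))
        \<and> perm_matrix m' (U 0) \<and> perm_matrix m' (U 1)
        \<and> length nu = length ps \<and> (\<exists>i<length ps. nu ! i = 0)
        \<and> length om = length qs \<and> (\<exists>j<length qs. om ! j = 0)
        \<and> (\<forall>l\<in>set lams. continuous_on {0..1} l \<and> l ` {0..1} \<subseteq> {0..1})
        \<and> (\<forall>t\<in>{0..1}. sorted (map (\<lambda>l. l t) lams))
        \<and> (\<Sum>i<length ps. nu ! i * ps ! i) + (\<Sum>j<length qs. om ! j * qs ! j) + length lams * m = m'
        \<and> (\<forall>f\<in>S_alg m ps qs. \<forall>t\<in>{0..1}.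
             \<psi> f t = mat_adjoint (U t)
                     * diag_block_mat ([Lambda ps nu (f 0), Lambda qs om (f 1)] @ map (\<lambda>l. f (l t)) lams)
                     * U t)"
      by (intro exI[of _ U] exI[of _ nu0] exI[of _ om0] exI[of _ lams] conjI ballI allI impI Uu Ucont Uperm nf dims
          l1[rule_format] l2[rule_format] form) (use l1 in auto)
  qed (use blocks in blast)+
qed

end
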